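(* Let $d\ge1$ and $j\in\{1,\dots,d\}$. The discrete Riesz transform $R_j$, defined on $\ell^2(\mathbb{Z}^d)$ by $$\mathcal{F}_{\mathbb{Z}^d}(R_j f)(\xi)=\frac{e^{-i\pi\xi_j}\sin(\pi\xi_j)}{2\left(\sum_{k=1}^d\sin^2(\pi\xi_k)\right)^{1/2}}\,\mathcal{F}_{\mathbb{Z}^d}(f)(\xi),$$ is bounded on $\ell^p(\mathbb{Z}^d)$ for every $1<p<\infty$.
   Context: $\ell^p(\mathbb{Z}^d)$ is the usual space of $p$-summable complex functions on $\mathbb{Z}^d$. The Fourier transform is $\mathcal{F}_{\mathbb{Z}^d}(f)(\xi)=\sum_{n\in\mathbb{Z}^d}f(n)e^{2\pi i n\cdot\xi}$, an isometry of $\ell^2(\mathbb{Z}^d)$ onto $L^2(\mathbb{T}^d)$, where $\mathbb{T}^d=\mathbb{R}^d/\mathbb{Z}^d$ carries Lebesgue measure on $[0,1)^d$. The multiplier is defined for $\xi\notin\mathbb{Z}^d$, hence almost everywhere. Boundedness on $\ell^p$ means that there is a constant $C$ with $\|R_jf\|_{\ell^p}\le C\|f\|_{\ell^p}$ for all $f\in\ell^2\cap\ell^p$, so that $R_j$ extends to a bounded operator on $\ell^p(\mathbb{Z}^d)$. *)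

theory Defs
  imports "HOL-Analysis.Analysis"
begin

definition lp_space :: "real \<Rightarrow> ('a \<Rightarrow> complex) set" where
  "lp_space p = {f. (\<lambda>n. norm (f n) powr p) summable_on UNIV}"

definition lp_norm :: "real \<Rightarrow> ('a \<Rightarrow> complex) \<Rightarrow> real" where
  "lp_norm p f = (\<Sum>\<^sub>\<infinity>n. norm (f n) powr p) powr (1 / p)"

definition torus :: "(real ^ 'd::finite) measure" where
  "torus = restrict_space lborel {\<xi>. \<forall>k. 0 \<le> \<xi> $ k \<and> \<xi> $ k < 1}"

definition torus_L2 :: "(real ^ 'd::finite \<Rightarrow> complex) set" where
  "torus_L2 = {F. F \<in> borel_measurable torus \<and> integrable torus (\<lambda>\<xi>. (norm (F \<xi>))\<^sup>2)}"

definition fourier_partial ::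
  "(int ^ 'd::finite \<Rightarrow> complex) \<Rightarrow> (int ^ 'd) set \<Rightarrow> real ^ 'd \<Rightarrow> complex" where
  "fourier_partial f A \<xi> =
     (\<Sum>n\<in>A. f n * exp (2 * of_real pi * \<i> * of_real ((\<chi> k. real_of_int (n $ k)) \<bullet> \<xi>)))"

(* For f in l^2 the Fourier series need not converge pointwise, so its sum is taken
   unconditionally in L^2 of the torus; it is determined up to null sets only, and
   SOME picks a representative. *)
definition fourier_transform :: "(int ^ 'd::finite \<Rightarrow> complex) \<Rightarrow> real ^ 'd \<Rightarrow> complex" where
  "fourier_transform f = (SOME F. F \<in> torus_L2 \<and>
     ((\<lambda>A. \<integral>\<xi>. (norm (F \<xi> - fourier_partial f A \<xi>))\<^sup>2 \<partial>torus) \<longlongrightarrow> 0)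
       (finite_subsets_at_top UNIV))"

(* The division by zero at integer points has no effect: they form a null set. *)
definition riesz_multiplier :: "'d::finite \<Rightarrow> real ^ 'd \<Rightarrow> complex" where
  "riesz_multiplier j \<xi> =
     exp (- \<i> * of_real pi * of_real (\<xi> $ j)) * of_real (sin (pi * \<xi> $ j)) /
     of_real (2 * sqrt (\<Sum>k\<in>UNIV. (sin (pi * \<xi> $ k))\<^sup>2))"

definition discrete_riesz ::
  "'d::finite \<Rightarrow> (int ^ 'd \<Rightarrow> complex) \<Rightarrow> int ^ 'd \<Rightarrow> complex" where
  "discrete_riesz j f = (THE g. g \<in> lp_space 2 \<and>
     (AE \<xi> in torus. fourier_transform g \<xi> = riesz_multiplier j \<xi> * fourier_transform f \<xi>))"

(* Membership in the conclusion is explicit because infsum, hence lp_norm, is 0 outside lp_space. *)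
definition bounded_on_lp :: "real \<Rightarrow> (('a \<Rightarrow> complex) \<Rightarrow> 'a \<Rightarrow> complex) \<Rightarrow> bool" where
  "bounded_on_lp p T \<longleftrightarrow>
     (\<exists>C. \<forall>f \<in> lp_space 2 \<inter> lp_space p. T f \<in> lp_space p \<and> lp_norm p (T f) \<le> C * lp_norm p f)"

end

theory Submission
  imports Defs
begin

text \<open>Up to a constant, the Riesz transform is \<open>D\<^sub>j (1 - S)\<^sup>-\<^sup>1\<^sup>/\<^sup>2\<close>, where \<open>D\<^sub>j\<close> is a difference operator and \<open>S\<close> is
the lazy nearest neighbour walk on the lattice, with symbol \<open>1 - (1/d) \<Sum> sin\<^sup>2(\<pi>\<xi>\<^sub>k)\<close>. The operator
\<open>Q = 1 - (1 - S)\<^sup>1\<^sup>/\<^sup>2\<close> is a power series in \<open>S\<close> with nonnegative coefficients of sum 1, hence again an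
average, and \<open>Q\<^sup>2 - 2Q + S = 0\<close>. So \<open>u\<^sub>k = Q\<^sup>k f\<close> is a discrete Poisson extension: it satisfies
\<open>u\<^sub>k\<^sub>+\<^sub>1 = (u\<^sub>k\<^sub>+\<^sub>2 + S u\<^sub>k)/2\<close>, i.e. it is harmonic for a Markov chain on the half space. Since
\<open>1/(1-q) = (1-q) \<Sum> (i+1) q\<^sup>i\<close>, the form \<open>\<langle>R\<^sub>j f, h\<rangle>\<close> is a constant times the sum over \<open>i\<close> of
\<open>(i+1) \<langle>D\<^sub>j Q\<^sup>m f, (1-Q) Q\<^sup>n h\<rangle>\<close> with \<open>m = i div 2\<close> and \<open>n = (i+1) div 2\<close>: a sum, weighted by the
level, of products of increments of the two extensions along the chain (\<open>riesz_multiplier_damped\<close>,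
\<open>pairing_fourier\<close>).

Such sums are bounded by the Bellman function method. Let \<open>p \<ge> 2\<close> and let \<open>2 - a\<close> be the conjugate
exponent. On the region \<open>0 \<le> U \<le> F\<^sup>1\<^sup>-\<^sup>a\<close> the function \<open>U\<^sup>2 F\<^sup>a + M F\<^sup>2\<^sup>-\<^sup>a\<close> is so convex that one step of
the chain increases its mean by at least a constant times any product of an increment of \<open>U\<close> and
one of \<open>F\<close> (\<open>bellman_jensen_gain\<close>). Nonnegative harmonic functions change by at most a
constant factor upwards in one step, so only scalar inequalities are needed, although the state
space is discrete. Summation over the lattice gives a bounded convex sequence of levels, and the
weighted sum of its second differences telescopes to at most its initial value
(\<open>harmonic_energy\<close>). Jensen's inequality preserves the region, and the data can be moved into it by
replacing \<open>h\<close> with \<open>h + f\<^sup>p\<^sup>-\<^sup>1\<close> and subtracting the contribution of \<open>f\<^sup>p\<^sup>-\<^sup>1\<close> (\<open>energy_bound_ge_2\<close>).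
The resulting bound is symmetric in the two functions, which gives \<open>p < 2\<close> as well.

The Fourier side has to identify the operator. The multiplier is the bounded pointwise limit of
symbols of operators that act on summable functions (\<open>damped_multiplier_tendsto\<close>), so the product of
the multiplier with a transform is an \<open>L\<^sup>2\<close> limit of trigonometric polynomials; best approximation
then makes it the transform of its own coefficients (\<open>discrete_riesz_eq\<close>). Testing these
coefficients \<open>g\<close> against a small multiple of \<open>|g|\<^sup>p\<^sup>-\<^sup>1 sgn g\<close> on finite sets turns the bilinear bound into
the norm bound.\<close>

section \<open>The power series of one minus a square root\<close>

text \<open>The Taylor coefficients at 0 of \<open>1 - (1 - x)\<^sup>1\<^sup>/\<^sup>2\<close>, by the binomial series.\<close>

definition sqrt_coeff :: "nat \<Rightarrow> real" where
  "sqrt_coeff k = (if k = 0 then 1 else 0) - (-1) ^ k * ((1/2) gchoose k)"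

lemma gbinomial_neg_eq_pochhammer: "(-1) ^ k * (a gchoose k) = pochhammer (- a) k / fact k"
  for a :: real
  by (simp add: gbinomial_pochhammer flip: power_mult_distrib mult.assoc)

lemma sqrt_coeff_nonneg: "0 \<le> sqrt_coeff k"
proof (cases k)
  case (Suc n)
  have "pochhammer (- (1/2)) (Suc n) = - (1/2) * pochhammer (1/2 :: real) n"
    by (simp add: pochhammer_rec)
  moreover have "0 \<le> pochhammer (1/2 :: real) n"
    by (intro pochhammer_nonneg) simp
  ultimately show ?thesis
    using gbinomial_neg_eq_pochhammer[of k "1/2"] Suc
    by (simp add: sqrt_coeff_def divide_nonpos_pos del: power_Suc)
qed (simp add: sqrt_coeff_def)

text \<open>The partial sums of the alternating binomial coefficients of exponent \<open>1/2\<close> are, up to sign, binomial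
coefficients of exponent \<open>-1/2\<close>, and these have the right sign.\<close>

lemma sum_sqrt_coeff_le_1: "(\<Sum>k\<le>n. sqrt_coeff k) \<le> 1"
proof -
  have "(\<Sum>k\<le>n. (-1) ^ k * ((1/2 :: real) gchoose k)) = (-1) ^ n * ((- (1/2)) gchoose n)"
    using gbinomial_sum_lower_neg[of "1/2 :: real" n] by (simp add: mult.commute)
  also have "\<dots> = pochhammer (1/2) n / fact n"
    using gbinomial_neg_eq_pochhammer[of n "- (1/2)"] by simp
  also have "\<dots> \<ge> 0"
    by (intro divide_nonneg_pos pochhammer_nonneg) auto
  finally show ?thesis
    by (simp add: sqrt_coeff_def sum_subtractf)
qed

lemma summable_sqrt_coeff: "summable sqrt_coeff"
  by (rule bounded_imp_summable[of _ 1]) (auto simp: sqrt_coeff_nonneg sum_sqrt_coeff_le_1)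

text \<open>The Cauchy square of the binomial series of exponent \<open>1/2\<close> is \<open>1 - x\<close> (Vandermonde). This is the
coefficient form of \<open>(1 - q(x))\<^sup>2 = 1 - x\<close>.\<close>

lemma sqrt_coeff_convolution:
  "(\<Sum>i\<le>k. sqrt_coeff i * sqrt_coeff (k - i)) = 2 * sqrt_coeff k - (if k = 1 then 1 else 0)"
proof -
  define c where "c = (\<lambda>k. (-1) ^ k * ((1/2 :: real) gchoose k))"
  have b: "sqrt_coeff i = (if i = 0 then 1 else 0) - c i" for i
    by (simp add: sqrt_coeff_def c_def)
  have "(\<Sum>i\<le>k. c i * c (k - i))
      = (\<Sum>i\<le>k. (-1) ^ k * (((1/2 :: real) gchoose i) * ((1/2) gchoose (k - i))))"
    by (intro sum.cong) (auto simp: c_def simp flip: power_add)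
  also have "\<dots> = (-1) ^ k * (1 gchoose k)"
    using gbinomial_Vandermonde[of "1/2 :: real" "1/2" k]
    by (simp add: atLeast0AtMost flip: sum_distrib_left)
  also have "(1 gchoose k) = (of_nat (1 choose k) :: real)"
    by (metis binomial_gbinomial of_nat_1)
  also have "(-1) ^ k * of_nat (1 choose k) = (if k = 0 then 1 else if k = 1 then -1 else (0 :: real))"
    by (auto simp: binomial_eq_0)
  finally have cc: "(\<Sum>i\<le>k. c i * c (k - i)) = (if k = 0 then 1 else if k = 1 then -1 else 0)" .
  have "(\<Sum>i\<le>k. sqrt_coeff i * sqrt_coeff (k - i))
      = (\<Sum>i\<le>k. (if i = 0 then (if k = i then 1 else 0) - c (k - i) else 0)
           - (if i = k then c i else 0) + c i * c (k - i))"
    by (intro sum.cong) (auto simp: b algebra_simps)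
  also have "\<dots> = (if k = 0 then 1 else 0) - c k - c k + (\<Sum>i\<le>k. c i * c (k - i))"
    by (simp add: sum.distrib sum_subtractf)
  finally show ?thesis
    unfolding cc by (auto simp: b)
qed

definition poisson_symbol :: "real \<Rightarrow> real" where
  "poisson_symbol x = (\<Sum>k. sqrt_coeff k * x ^ k)"

lemma summable_poisson_symbol:
  assumes "0 \<le> x" "x \<le> 1" shows "summable (\<lambda>k. sqrt_coeff k * x ^ k)"
proof (rule summable_comparison_test'[OF summable_sqrt_coeff, of 0])
  fix n show "norm (sqrt_coeff n * x ^ n) \<le> sqrt_coeff n"
    using assms by (simp add: abs_mult sqrt_coeff_nonneg mult_left_le power_le_one)
qed

lemma poisson_symbol_square:
  assumes x: "0 \<le> x" "x \<le> 1"
  shows "poisson_symbol x * poisson_symbol x = 2 * poisson_symbol x - x"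
proof -
  note s = summable_poisson_symbol[OF x]
  have s': "summable (\<lambda>k. norm (sqrt_coeff k * x ^ k))"
    using s x by (simp add: abs_mult sqrt_coeff_nonneg)
  have "poisson_symbol x * poisson_symbol x
      = (\<Sum>k. \<Sum>i\<le>k. (sqrt_coeff i * x ^ i) * (sqrt_coeff (k - i) * x ^ (k - i)))"
    unfolding poisson_symbol_def by (rule Cauchy_product[OF s' s'])
  also have "\<dots> = (\<Sum>k. (\<Sum>i\<le>k. sqrt_coeff i * sqrt_coeff (k - i)) * x ^ k)"
  proof (intro suminf_cong)
    fix k
    show "(\<Sum>i\<le>k. (sqrt_coeff i * x ^ i) * (sqrt_coeff (k - i) * x ^ (k - i)))
        = (\<Sum>i\<le>k. sqrt_coeff i * sqrt_coeff (k - i)) * x ^ k"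
      unfolding sum_distrib_right
    proof (intro sum.cong refl)
      fix i assume "i \<in> {..k}"
      then have "x ^ k = x ^ i * x ^ (k - i)" by (simp flip: power_add)
      then show "(sqrt_coeff i * x ^ i) * (sqrt_coeff (k - i) * x ^ (k - i))
          = sqrt_coeff i * sqrt_coeff (k - i) * x ^ k" by simp
    qed
  qed
  also have "\<dots> = (\<Sum>k. 2 * (sqrt_coeff k * x ^ k) - (if k = 1 then x ^ k else 0))"
    by (intro suminf_cong) (simp add: sqrt_coeff_convolution algebra_simps)
  also have "\<dots> = (\<Sum>k. 2 * (sqrt_coeff k * x ^ k)) - (\<Sum>k. if k = 1 then x ^ k else 0)"
    by (intro suminf_diff[symmetric] summable_mult s) (rule summable_single)
  also have "(\<Sum>k. if k = 1 then x ^ k else 0) = x ^ 1"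
    using sums_single[of 1 "\<lambda>k. x ^ k"] by (simp add: sums_iff)
  also have "(\<Sum>k. 2 * (sqrt_coeff k * x ^ k)) = 2 * poisson_symbol x"
    unfolding poisson_symbol_def by (rule suminf_mult[OF s])
  finally show ?thesis by simp
qed

lemma poisson_symbol_nonneg:
  assumes "0 \<le> x" "x \<le> 1" shows "0 \<le> poisson_symbol x"
  unfolding poisson_symbol_def using assms
  by (intro suminf_nonneg summable_poisson_symbol) (auto simp: sqrt_coeff_nonneg)

text \<open>At \<open>x = 1\<close> the quadratic equation \<open>q\<^sup>2 = 2q - x\<close> has the double root 1.\<close>

lemma suminf_sqrt_coeff: "(\<Sum>k. sqrt_coeff k) = 1"
  using poisson_symbol_square[of 1] by (simp add: poisson_symbol_def algebra_simps) algebra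

lemma poisson_symbol_le_1:
  assumes "0 \<le> x" "x \<le> 1" shows "poisson_symbol x \<le> 1"
proof -
  have "poisson_symbol x \<le> (\<Sum>k. sqrt_coeff k)"
    unfolding poisson_symbol_def
    using assms by (intro suminf_le summable_poisson_symbol summable_sqrt_coeff)
      (auto simp: sqrt_coeff_nonneg mult_left_le power_le_one)
  then show ?thesis by (simp add: suminf_sqrt_coeff)
qed

text \<open>The quadratic equation leaves two signs for the root; \<open>q \<le> 1\<close> selects one.\<close>

lemma one_minus_poisson_symbol:
  assumes x: "0 \<le> x" "x \<le> 1" shows "1 - poisson_symbol x = sqrt (1 - x)"
proof (rule real_sqrt_unique[symmetric])
  show "(1 - poisson_symbol x)\<^sup>2 = 1 - x"
    using poisson_symbol_square[OF x] by (simp add: power2_eq_square algebra_simps)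
qed (use poisson_symbol_le_1[OF x] in simp)

section \<open>Scalar inequalities and a Bellman function\<close>

lemma powr_le_tangent:
  fixes t a :: real assumes "0 \<le> t" "0 \<le> a" "a \<le> 1"
  shows "t powr a \<le> 1 + a * (t - 1)"
proof (cases "t = 0")
  case False
  have "t powr a * 1 powr (1 - a) \<le> a * t + (1 - a) * 1"
    using assms False by (intro Youngs_inequality_0) auto
  then show ?thesis by (simp add: algebra_simps)
qed (use assms in simp)

text \<open>Apply the tangent bound to the complementary exponent, using \<open>t = t\<^sup>a t\<^sup>1\<^sup>-\<^sup>a\<close>: this bounds the deficit in
the concavity of \<open>t\<^sup>a\<close> by a square, uniformly down to \<open>t = 0\<close>.\<close>

lemma powr_ge_tangent:
  fixes t a :: real assumes "0 \<le> t" "0 \<le> a" "a < 1"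
  shows "t powr a \<ge> 1 + a * (t - 1) - (t - 1)\<^sup>2"
proof (cases "t = 0")
  case True then show ?thesis using assms by simp
next
  case False
  define s where "s = t - 1"
  have D: "1 + (1 - a) * s > 0"
  proof -
    have "1 + (1 - a) * s = a + (1 - a) * t" by (simp add: s_def algebra_simps)
    also have "\<dots> > 0" using assms False by (intro add_nonneg_pos mult_pos_pos) auto
    finally show ?thesis .
  qed
  have "(1 + a * s - s\<^sup>2) * (1 + (1 - a) * s) \<le> 1 + s"
  proof -
    have e: "(1 + a * s - s\<^sup>2) * (1 + (1 - a) * s) = 1 + s - s\<^sup>2 * ((1 - a) * (1 + s) + a\<^sup>2)"
      by (simp add: algebra_simps power2_eq_square)
    have "0 \<le> (1 - a) * (1 + s)" using assms by (simp add: s_def)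
    then have "0 \<le> s\<^sup>2 * ((1 - a) * (1 + s) + a\<^sup>2)" by simp
    then show ?thesis unfolding e by simp
  qed
  also have "1 + s = t powr (a + (1 - a))"
    using False assms by (simp add: s_def)
  also have "\<dots> = t powr a * t powr (1 - a)"
    by (rule powr_add)
  also have "\<dots> \<le> t powr a * (1 + (1 - a) * s)"
    unfolding s_def using assms by (intro mult_left_mono powr_le_tangent) auto
  finally show ?thesis
    using D unfolding s_def by simp
qed

lemma abs_powr_minus_1_le:
  fixes t a :: real assumes "0 \<le> t" "0 \<le> a" "a \<le> 1"
  shows "\<bar>t powr a - 1\<bar> \<le> \<bar>t - 1\<bar>"
proof (cases "1 \<le> t")
  case True
  have "1 \<le> t powr a" using True assms by (simp add: ge_one_powr_ge_zero)
  moreover have "t powr a \<le> t powr 1" using True assms by (intro powr_mono) auto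
  ultimately show ?thesis using True by simp
next
  case False
  show ?thesis
  proof (cases "t = 0")
    case F: False
    have "t powr 1 \<le> t powr a" using F False assms by (intro powr_mono') auto
    moreover have "t powr a \<le> 1" using False assms by (simp add: powr_le1)
    ultimately show ?thesis using assms F by simp
  qed simp
qed

text \<open>Strict convexity of \<open>t\<^sup>2\<^sup>-\<^sup>a\<close> with an explicit constant. It follows from \<open>t\<^sup>2\<^sup>-\<^sup>a = t\<^sup>2 / t\<^sup>a\<close> and the tangent
bound for \<open>t\<^sup>a\<close>; the upper bound on \<open>t\<close> is where the comparability of neighbouring values of
harmonic functions will be used.\<close>

lemma powr_convexity_gain:
  fixes t a C :: real
  assumes "0 \<le> t" "t \<le> C" "1 \<le> C" "0 \<le> a" "a < 1"
  shows "(1 - a)\<^sup>2 / C * (t - 1)\<^sup>2 \<le> t powr (2 - a) - 1 - (2 - a) * (t - 1)"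
proof -
  define s where "s = t - 1"
  have D: "1 + a * s > 0" "1 + a * s \<le> C"
  proof -
    have e: "1 + a * s = (1 - a) + a * t" by (simp add: s_def algebra_simps)
    show "1 + a * s > 0" unfolding e using assms by (intro add_pos_nonneg mult_nonneg_nonneg) auto
    have "(1 - a) + a * t \<le> (1 - a) * C + a * C"
      using assms by (intro add_mono mult_left_mono) (auto simp: mult_le_cancel_left1)
    then show "1 + a * s \<le> C" unfolding e by (simp add: algebra_simps)
  qed
  have p: "t powr (2 - a) * t powr a = t\<^sup>2"
  proof (cases "t = 0")
    case False
    have "t powr (2 - a) * t powr a = t powr 2" by (simp flip: powr_add)
    then show ?thesis using assms False by simp
  qed (use assms in simp)
  have "(1 - a)\<^sup>2 / C * s\<^sup>2 \<le> (1 - a)\<^sup>2 * s\<^sup>2 / (1 + a * s)"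
    using D assms by (simp add: divide_left_mono mult_pos_pos)
  also have "\<dots> = ((1 + s)\<^sup>2 - (1 + (2 - a) * s) * (1 + a * s)) / (1 + a * s)"
    by (simp add: algebra_simps power2_eq_square)
  also have "\<dots> = (1 + s)\<^sup>2 / (1 + a * s) - (1 + (2 - a) * s)"
    using D by (simp add: field_simps)
  also have "(1 + s)\<^sup>2 / (1 + a * s) \<le> t powr (2 - a)"
  proof -
    have "(1 + s)\<^sup>2 \<le> t powr (2 - a) * (1 + a * s)"
      using p powr_le_tangent[of t a] assms
      by (metis (no_types, lifting) add_diff_cancel_left' diff_add_cancel less_eq_real_def mult_left_mono powr_ge_zero s_def add.commute)
    then show ?thesis using D by (simp add: field_simps)
  qed
  finally show ?thesis by (simp add: s_def)
qed

text \<open>The first term produces the square of the increment of \<open>U\<close> with weight \<open>F\<^sup>a\<close>, the second the square of the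
increment of \<open>F\<close> with weight \<open>F\<^sup>-\<^sup>a\<close> and, for large \<open>M\<close>, pays for the concavity of \<open>F\<^sup>a\<close> in the first. The
weights are inverse to each other, so products of increments are controlled.\<close>

definition bellman :: "real \<Rightarrow> real \<Rightarrow> real \<Rightarrow> real \<Rightarrow> real" where
  "bellman M a U F = U\<^sup>2 * F powr a + M * F powr (2 - a)"

text \<open>The deviation from the tangent plane at \<open>(\<mu>, 1)\<close> contains \<open>(\<nu> - \<mu>)\<^sup>2 t\<^sup>a\<close> and, from the term with \<open>M\<close>, a
large multiple of \<open>(t - 1)\<^sup>2\<close>. These absorb the rest, which is bounded by multiples of \<open>(t - 1)\<^sup>2\<close> and of
\<open>|\<nu> - \<mu>| |t - 1|\<close>, thanks to \<open>\<mu> \<le> 1\<close>. If \<open>t < 1/2\<close> the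
factor \<open>t\<^sup>a\<close> may be small, but then \<open>|\<nu> - \<mu>| \<le> 1 \<le> 2 |t - 1|\<close>.\<close>

lemma bellman_gain_normalized:
  fixes t a C \<mu> \<nu> M :: real
  assumes t: "0 \<le> t" "t \<le> C" "1 \<le> C" and a: "0 \<le> a" "a < 1"
    and \<mu>: "0 \<le> \<mu>" "\<mu> \<le> 1" and \<nu>: "0 \<le> \<nu>" "\<nu> \<le> t powr (1 - a)"
    and M: "M = 7 * C / (1 - a)\<^sup>2"
  shows "(\<nu> - \<mu>)\<^sup>2 / 4 + (t - 1)\<^sup>2
    \<le> bellman M a \<nu> t - bellman M a \<mu> 1
      - (2 * \<mu> * (\<nu> - \<mu>) + (a * \<mu>\<^sup>2 + M * (2 - a)) * (t - 1))"
proof -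
  define s where "s = t - 1"
  define x where "x = \<nu> - \<mu>"
  define A where "A = t powr a"
  have \<mu>2: "0 \<le> \<mu>\<^sup>2" "\<mu>\<^sup>2 \<le> 1" using \<mu> by (auto simp: power_le_one)
  have "7 * s\<^sup>2 = M * ((1 - a)\<^sup>2 / C * s\<^sup>2)"
    using M t a by (simp add: field_simps)
  also have "\<dots> \<le> M * (t powr (2 - a) - 1 - (2 - a) * s)"
    unfolding s_def using M t a by (intro mult_left_mono powr_convexity_gain) auto
  finally have 1: "7 * s\<^sup>2 \<le> M * (t powr (2 - a) - 1 - (2 - a) * s)" .
  have "\<bar>2 * \<mu> * x * (A - 1)\<bar> \<le> 2 * 1 * \<bar>x\<bar> * \<bar>s\<bar>"
    unfolding abs_mult A_def s_def using \<mu> t a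
    by (intro mult_mono abs_powr_minus_1_le) (auto intro!: mult_nonneg_nonneg)
  then have 2: "2 * \<mu> * x * (A - 1) \<ge> - (2 * \<bar>x\<bar> * \<bar>s\<bar>)" by linarith
  have "\<mu>\<^sup>2 * (- s\<^sup>2) \<le> \<mu>\<^sup>2 * (A - 1 - a * s)"
    using powr_ge_tangent[of t a] t a \<mu>2 unfolding A_def s_def by (intro mult_left_mono) auto
  moreover have "\<mu>\<^sup>2 * s\<^sup>2 \<le> s\<^sup>2" using \<mu>2 by (simp add: mult_left_le_one_le)
  ultimately have 3: "\<mu>\<^sup>2 * (A - 1 - a * s) \<ge> - s\<^sup>2" by simp
  have 4: "x\<^sup>2 / 4 + 2 * \<bar>x\<bar> * \<bar>s\<bar> \<le> x\<^sup>2 * A + 5 * s\<^sup>2"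
  proof (cases "1/2 \<le> t")
    case True
    have "1/2 \<le> A"
    proof (cases "1 \<le> t")
      case True then show ?thesis using a ge_one_powr_ge_zero[of t a] by (simp add: A_def)
    next
      case False
      have "t powr 1 \<le> t powr a" using True False a t by (intro powr_mono') auto
      then show ?thesis using True by (simp add: A_def)
    qed
    then have "x\<^sup>2 * (1/2) \<le> x\<^sup>2 * A" by (intro mult_left_mono) auto
    moreover have "0 \<le> (\<bar>x\<bar> / 2 - 2 * \<bar>s\<bar>)\<^sup>2" by simp
    then have "2 * \<bar>x\<bar> * \<bar>s\<bar> \<le> x\<^sup>2 / 4 + 4 * s\<^sup>2"
      by (simp add: power2_diff power_mult_distrib power_divide)
    ultimately show ?thesis using zero_le_power2[of s] by linarith
  next
    case False
    have "t powr (1 - a) \<le> 1" using False t a by (simp add: powr_le1)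
    then have x1: "\<bar>x\<bar> \<le> 1" using \<mu> \<nu> by (simp add: x_def)
    have s1: "1/2 \<le> \<bar>s\<bar>" using False by (simp add: s_def)
    have "\<bar>x\<bar> * \<bar>s\<bar> \<le> 1 * \<bar>s\<bar>" using x1 by (intro mult_right_mono) auto
    moreover have "\<bar>s\<bar> * (1/2) \<le> \<bar>s\<bar> * \<bar>s\<bar>" using s1 by (intro mult_left_mono) auto
    moreover have "x\<^sup>2 \<le> 1" using x1 by (simp add: abs_square_le_1)
    moreover have "(1/2)\<^sup>2 \<le> \<bar>s\<bar>\<^sup>2" using s1 by (intro power_mono) auto
    moreover have "0 \<le> x\<^sup>2 * A" by (simp add: A_def)
    ultimately show ?thesis by (simp add: power2_eq_square)
  qed
  have "bellman M a \<nu> t - bellman M a \<mu> 1 - (2 * \<mu> * x + (a * \<mu>\<^sup>2 + M * (2 - a)) * s)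
     = x\<^sup>2 * A + 2 * \<mu> * x * (A - 1) + \<mu>\<^sup>2 * (A - 1 - a * s) + M * (t powr (2 - a) - 1 - (2 - a) * s)"
    unfolding bellman_def x_def A_def s_def by (simp add: power2_eq_square algebra_simps)
  then show ?thesis
    using 1 2 3 4 unfolding x_def[symmetric] s_def[symmetric] by linarith
qed

text \<open>The region \<open>U \<le> F\<^sup>1\<^sup>-\<^sup>a\<close> and the Bellman function are homogeneous under this scaling, which reduces
everything to the base point \<open>E = 1\<close>.\<close>

lemma bellman_scale:
  assumes "0 < E" "0 \<le> t"
  shows "bellman M a (E powr (1 - a) * \<nu>) (E * t) = E powr (2 - a) * bellman M a \<nu> t"
proof -
  have "(E powr (1 - a))\<^sup>2 * E powr a = E powr (2 - a)"
    using assms by (simp add: power2_eq_square flip: powr_add)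
  then show ?thesis
    using assms by (simp add: bellman_def powr_mult power_mult_distrib algebra_simps)
qed

text \<open>Only the existence of the slopes \<open>\<alpha>\<close> and \<open>\<beta>\<close> matters: linear terms vanish in a mean with barycentre
\<open>(u, E)\<close>.\<close>

lemma bellman_gain:
  fixes E C a M u :: real
  assumes E: "0 < E" and C: "1 \<le> C" and a: "0 \<le> a" "a < 1"
    and u: "0 \<le> u" "u \<le> E powr (1 - a)" and M: "M = 7 * C / (1 - a)\<^sup>2"
  shows "\<exists>\<alpha> \<beta>. \<forall>U F. 0 \<le> F \<longrightarrow> F \<le> C * E \<longrightarrow> 0 \<le> U \<longrightarrow> U \<le> F powr (1 - a) \<longrightarrow>
     (U - u)\<^sup>2 * E powr a / 4 + (F - E)\<^sup>2 / E powr a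
       \<le> bellman M a U F - bellman M a u E - (\<alpha> * (U - u) + \<beta> * (F - E))"
proof -
  define e where "e = E powr (1 - a)"
  define K where "K = E powr (2 - a)"
  have e: "e > 0" and K: "K > 0" using E by (auto simp: e_def K_def)
  define \<mu> where "\<mu> = u / e"
  have \<mu>: "0 \<le> \<mu>" "\<mu> \<le> 1" using u e by (auto simp: \<mu>_def e_def)
  have Ke: "K / e\<^sup>2 = E powr a" "K / E\<^sup>2 = 1 / E powr a"
  proof -
    have "E powr a * e\<^sup>2 = K"
      using E by (simp add: K_def e_def power2_eq_square flip: powr_add)
    then show "K / e\<^sup>2 = E powr a" using e by (simp add: field_simps)
    have "K * E powr a = E\<^sup>2"
      using E by (simp add: K_def flip: powr_add)
    then show "K / E\<^sup>2 = 1 / E powr a" using E by (simp add: field_simps)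
  qed
  show ?thesis
  proof (intro exI allI impI)
    fix U F assume F: "0 \<le> F" "F \<le> C * E" and U: "0 \<le> U" "U \<le> F powr (1 - a)"
    define t where "t = F / E"
    define \<nu> where "\<nu> = U / e"
    have t: "0 \<le> t" "t \<le> C" using F E by (auto simp: t_def field_simps)
    have "F powr (1 - a) = e * t powr (1 - a)"
      using E F by (simp add: t_def e_def powr_divide)
    then have \<nu>: "0 \<le> \<nu>" "\<nu> \<le> t powr (1 - a)"
      using U e by (auto simp: \<nu>_def field_simps)
    have eqs: "U = e * \<nu>" "F = E * t" "u = e * \<mu>"
      using e E by (auto simp: \<nu>_def t_def \<mu>_def)
    have b1: "bellman M a U F = K * bellman M a \<nu> t"
      using bellman_scale[OF E t(1)] by (simp add: eqs K_def e_def)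
    have b2: "bellman M a u E = K * bellman M a \<mu> 1"
      using bellman_scale[OF E, of 1] by (simp add: eqs K_def e_def)
    \<comment> \<open>undo the scaling; its slopes are the claimed witnesses\<close>
    have "K * ((\<nu> - \<mu>)\<^sup>2 / 4 + (t - 1)\<^sup>2) \<le> K * (bellman M a \<nu> t - bellman M a \<mu> 1
      - (2 * \<mu> * (\<nu> - \<mu>) + (a * \<mu>\<^sup>2 + M * (2 - a)) * (t - 1)))"
      using K by (intro mult_left_mono bellman_gain_normalized[OF t C a \<mu> \<nu> M]) auto
    also have "\<dots> = bellman M a U F - bellman M a u E
        - ((K * 2 * \<mu> / e) * (U - u) + (K * (a * \<mu>\<^sup>2 + M * (2 - a)) / E) * (F - E))"
      unfolding b1 b2 using e E by (simp add: eqs field_simps)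
    also have "K * ((\<nu> - \<mu>)\<^sup>2 / 4 + (t - 1)\<^sup>2) = (U - u)\<^sup>2 * (K / e\<^sup>2) / 4 + (F - E)\<^sup>2 * (K / E\<^sup>2)"
      using e E by (simp add: eqs field_simps power2_eq_square)
    finally show "(U - u)\<^sup>2 * E powr a / 4 + (F - E)\<^sup>2 / E powr a \<le> bellman M a U F - bellman M a u E
        - ((K * 2 * \<mu> / e) * (U - u) + (K * (a * \<mu>\<^sup>2 + M * (2 - a)) / E) * (F - E))"
      unfolding Ke by simp
  qed
qed

text \<open>Averaging the tangent plane inequality. The increments may be taken at different points \<open>i\<close> and \<open>l\<close>
because each of the two squares is summed separately and carries the weight of the barycentre,
common to all points. Since no probability is below \<open>w\<close>, each \<open>F i\<close> is at most \<open>E / w\<close>.\<close>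

lemma bellman_jensen_gain:
  fixes P U F :: "'i::finite \<Rightarrow> real"
  assumes w: "0 < w" "\<And>i. w \<le> P i" and P1: "(\<Sum>i\<in>UNIV. P i) = 1"
    and a: "0 \<le> a" "a < 1" and M: "M = 7 / (w * (1 - a)\<^sup>2)"
    and u: "u = (\<Sum>i\<in>UNIV. P i * U i)" "u \<le> E powr (1 - a)"
    and E: "E = (\<Sum>i\<in>UNIV. P i * F i)"
    and F: "\<And>i. 0 \<le> F i" and U: "\<And>i. 0 \<le> U i" "\<And>i. U i \<le> F i powr (1 - a)"
  shows "w * \<bar>U i - u\<bar> * \<bar>F l - E\<bar> \<le> (\<Sum>i\<in>UNIV. P i * bellman M a (U i) (F i)) - bellman M a u E"
proof -
  have P0: "0 < P i" for i using w(1) w(2)[of i] by linarith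
  have u0: "0 \<le> u" unfolding u using P0 U by (intro sum_nonneg mult_nonneg_nonneg) (auto intro: less_imp_le)
  have E0: "0 \<le> E" unfolding E using P0 F by (intro sum_nonneg mult_nonneg_nonneg) (auto intro: less_imp_le)
  have FE: "w * F i \<le> E" for i
  proof -
    have "w * F i \<le> P i * F i" using w F by (intro mult_right_mono) auto
    also have "\<dots> \<le> E" unfolding E
      by (rule member_le_sum) (use P0 F in \<open>auto intro: mult_nonneg_nonneg less_imp_le\<close>)
    finally show ?thesis .
  qed
  show ?thesis
  proof (cases "E = 0")
    case True
    have F0: "F i = 0" for i
      using FE[of i] F[of i] w True by (simp add: mult_le_0_iff)
    have "U i = 0" for i using U[of i] F0[of i] by simp
    moreover have "u = 0" using u0 u(2) True by simp
    ultimately show ?thesis by (simp add: bellman_def F0 True)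
  next
    case False
    then have Epos: "E > 0" using E0 by simp
    have w1: "w \<le> 1"
    proof -
      have "w \<le> P i" for i using w by auto
      also have "P i \<le> (\<Sum>i\<in>UNIV. P i)" for i by (rule member_le_sum) (use P0 in \<open>auto intro: less_imp_le\<close>)
      finally show ?thesis using P1 by simp
    qed
    obtain \<alpha> \<beta> where g: "\<And>U F. 0 \<le> F \<Longrightarrow> F \<le> 1 / w * E \<Longrightarrow> 0 \<le> U \<Longrightarrow> U \<le> F powr (1 - a) \<Longrightarrow>
     (U - u)\<^sup>2 * E powr a / 4 + (F - E)\<^sup>2 / E powr a
       \<le> bellman M a U F - bellman M a u E - (\<alpha> * (U - u) + \<beta> * (F - E))"
      using bellman_gain[OF Epos, of "1 / w" a u M] w w1 a u0 u(2) M by auto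
    define X where "X = (\<lambda>i. (U i - u)\<^sup>2 * E powr a / 4)"
    define Y where "Y = (\<lambda>i. (F i - E)\<^sup>2 / E powr a)"
    have g': "X i + Y i \<le> bellman M a (U i) (F i) - bellman M a u E - (\<alpha> * (U i - u) + \<beta> * (F i - E))" for i
      unfolding X_def Y_def using FE[of i] w F U by (intro g) (auto simp: field_simps)
    have XY: "0 \<le> X i" "0 \<le> Y i" for i by (auto simp: X_def Y_def)
    have "(\<Sum>i\<in>UNIV. P i * (X i + Y i)) \<le> (\<Sum>i\<in>UNIV. P i * (bellman M a (U i) (F i) - bellman M a u E - (\<alpha> * (U i - u) + \<beta> * (F i - E))))"
      using P0 by (intro sum_mono mult_left_mono g') (auto intro: less_imp_le)
    also have "\<dots> = (\<Sum>i\<in>UNIV. P i * bellman M a (U i) (F i) - bellman M a u E * P i - \<alpha> * (P i * U i) + \<alpha> * u * P i - \<beta> * (P i * F i) + \<beta> * E * P i)"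
      by (intro sum.cong) (auto simp: algebra_simps)
    also have "\<dots> = (\<Sum>i\<in>UNIV. P i * bellman M a (U i) (F i)) - bellman M a u E"
      unfolding sum.distrib sum_subtractf sum_distrib_left[symmetric] P1 u(1)[symmetric] E[symmetric] by simp
    finally have up: "(\<Sum>i\<in>UNIV. P i * (X i + Y i)) \<le> (\<Sum>i\<in>UNIV. P i * bellman M a (U i) (F i)) - bellman M a u E" .
    have "w * X i \<le> P i * X i" using w XY by (intro mult_right_mono) auto
    also have "\<dots> \<le> (\<Sum>i\<in>UNIV. P i * X i)"
      by (rule member_le_sum) (use P0 XY in \<open>auto intro: mult_nonneg_nonneg less_imp_le\<close>)
    finally have 1: "w * X i \<le> (\<Sum>i\<in>UNIV. P i * X i)" .
    have "w * Y l \<le> P l * Y l" using w XY by (intro mult_right_mono) auto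
    also have "\<dots> \<le> (\<Sum>i\<in>UNIV. P i * Y i)"
      by (rule member_le_sum) (use P0 XY in \<open>auto intro: mult_nonneg_nonneg less_imp_le\<close>)
    finally have 2: "w * Y l \<le> (\<Sum>i\<in>UNIV. P i * Y i)" .
    have "\<bar>U i - u\<bar> * \<bar>F l - E\<bar> \<le> X i + Y l"
    proof -
      define r where "r = sqrt (E powr a)"
      have r: "r > 0" "r\<^sup>2 = E powr a" using Epos by (auto simp: r_def)
      \<comment> \<open>the weights are reciprocal, so they cancel in the mixed term\<close>
      have "0 \<le> (\<bar>U i - u\<bar> * r / 2 - \<bar>F l - E\<bar> / r)\<^sup>2" by simp
      also have "\<dots> = X i + Y l - \<bar>U i - u\<bar> * \<bar>F l - E\<bar>"
        using r(1) unfolding X_def Y_def r(2)[symmetric]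
        by (simp add: power2_diff power_mult_distrib power_divide)
      finally show ?thesis by simp
    qed
    then have "w * (\<bar>U i - u\<bar> * \<bar>F l - E\<bar>) \<le> w * (X i + Y l)" using w by (intro mult_left_mono) auto
    also have "\<dots> \<le> (\<Sum>i\<in>UNIV. P i * (X i + Y i))"
      using 1 2 by (simp add: distrib_left sum.distrib)
    finally show ?thesis using up by (simp add: mult.assoc)
  qed
qed

section \<open>Weighted second differences\<close>

text \<open>A convex sequence that increases once grows at least linearly.\<close>

lemma bounded_convex_sequence_decreasing:
  fixes \<beta> :: "nat \<Rightarrow> real"
  assumes conv: "\<And>k. 0 \<le> \<beta> (k + 2) - 2 * \<beta> (k + 1) + \<beta> k" and bdd: "\<And>k. \<beta> k \<le> K"
  shows "\<beta> (k + 1) \<le> \<beta> k"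
proof (rule ccontr)
  define \<delta> where "\<delta> = \<beta> (k + 1) - \<beta> k"
  assume "\<not> ?thesis"
  then have \<delta>: "\<delta> > 0" by (simp add: \<delta>_def)
  have inc: "\<delta> \<le> \<beta> (k + n + 1) - \<beta> (k + n)" for n
  proof (induction n)
    case (Suc n)
    then show ?case using conv[of "k + n"] by simp
  qed (simp add: \<delta>_def)
  have "\<beta> k + real n * \<delta> \<le> \<beta> (k + n)" for n
  proof (induction n)
    case (Suc n)
    then show ?case using inc[of n] by (simp add: algebra_simps)
  qed simp
  moreover obtain n where "real n * \<delta> > K - \<beta> k"
    using reals_Archimedean3[OF \<delta>] by blast
  ultimately show False using bdd[of "k + n"] by (smt (verit))
qed

text \<open>Summation by parts twice; this is the discrete form of Green's identity \<open>\<integral> y \<beta>''(y) dy = \<beta>(0)\<close> on the half line.\<close>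

lemma sum_weighted_second_differences_le:
  fixes \<beta> :: "nat \<Rightarrow> real"
  assumes conv: "\<And>k. 0 \<le> \<beta> (k + 2) - 2 * \<beta> (k + 1) + \<beta> k"
    and bdd: "\<And>k. \<beta> k \<le> K" and nonneg: "\<And>k. 0 \<le> \<beta> k"
  shows "(\<Sum>k<N. real (k + 1) * (\<beta> (k + 2) - 2 * \<beta> (k + 1) + \<beta> k)) \<le> \<beta> 0"
proof -
  have "(\<Sum>k<N. real (k + 1) * (\<beta> (k + 2) - 2 * \<beta> (k + 1) + \<beta> k))
      = \<beta> 0 - \<beta> N + real N * (\<beta> (N + 1) - \<beta> N)"
  proof (induction N)
    case (Suc N)
    then show ?case by (simp add: algebra_simps)
  qed simp
  moreover have "real N * (\<beta> (N + 1) - \<beta> N) \<le> 0"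
    using bounded_convex_sequence_decreasing[OF conv bdd, of N]
    by (intro mult_nonneg_nonpos) auto
  ultimately show ?thesis using nonneg[of N] by linarith
qed

section \<open>The lazy walk and its Poisson operator\<close>

fun step :: "('d \<times> bool) option \<Rightarrow> int ^ 'd::finite" where
  "step None = 0"
| "step (Some (i, b)) = (if b then axis i 1 else - axis i 1)"

definition step_prob :: "('d::finite \<times> bool) option \<Rightarrow> real" where
  "step_prob z = (if z = None then 1/2 else 1 / (4 * real CARD('d)))"

text \<open>Holding with probability \<open>1/2\<close> makes the symbol of the walk range in \<open>[0, 1]\<close>, where the power series of the
square root converges.\<close>

definition walk :: "(int ^ 'd::finite \<Rightarrow> real) \<Rightarrow> int ^ 'd \<Rightarrow> real" where
  "walk f x = (\<Sum>z\<in>UNIV. step_prob z * f (x + step z))"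

text \<open>The operator \<open>1 - (1 - S)\<^sup>1\<^sup>/\<^sup>2\<close>, where \<open>S\<close> is the walk.\<close>

definition poisson :: "(int ^ 'd::finite \<Rightarrow> real) \<Rightarrow> int ^ 'd \<Rightarrow> real" where
  "poisson f x = (\<Sum>k. sqrt_coeff k * (walk ^^ k) f x)"

lemma step_prob_pos: "0 < step_prob z"
  by (simp add: step_prob_def)

lemma sum_option_UNIV: "(\<Sum>z\<in>UNIV. f z) = f None + (\<Sum>z\<in>UNIV. f (Some z))"
  for f :: "'a::finite option \<Rightarrow> real"
  unfolding UNIV_option_conv by (subst sum.insert) (auto simp: sum.reindex)

lemma sum_step_prob: "(\<Sum>z\<in>UNIV. step_prob (z :: ('d::finite \<times> bool) option)) = 1"
  by (simp add: sum_option_UNIV step_prob_def card_cartesian_product flip: UNIV_Times_UNIV)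

lemma walk_linear: "walk (\<lambda>x. c * f x + d * g x) = (\<lambda>x. c * walk f x + d * walk g x)"
  by (simp add: walk_def fun_eq_iff sum.distrib sum_distrib_left algebra_simps)

lemma walk_mono: "(\<And>x. f x \<le> g x) \<Longrightarrow> walk f x \<le> walk g x"
  unfolding walk_def by (intro sum_mono mult_left_mono) (auto intro: less_imp_le step_prob_pos)

lemma walk_const: "walk (\<lambda>_. c) = (\<lambda>_. c)"
  by (simp add: walk_def fun_eq_iff sum_step_prob flip: sum_distrib_right)

lemma walk_funpow_linear:
  "(walk ^^ k) (\<lambda>x. c * f x + d * g x) = (\<lambda>x. c * (walk ^^ k) f x + d * (walk ^^ k) g x)"
  by (induction k) (simp_all add: walk_linear)

lemma walk_funpow_mono: "(\<And>x. f x \<le> g x) \<Longrightarrow> (walk ^^ k) f x \<le> (walk ^^ k) g x"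
  by (induction k arbitrary: x) (simp_all add: walk_mono)

lemma walk_funpow_const: "(walk ^^ k) (\<lambda>_. c) = (\<lambda>_. c)"
  by (induction k) (simp_all add: walk_const)

lemma walk_funpow_bound:
  assumes "\<And>x. \<bar>f x\<bar> \<le> R" shows "\<bar>(walk ^^ k) f x\<bar> \<le> R"
proof -
  have "f x \<le> R" "- R \<le> f x" for x using assms[of x] by auto
  then show ?thesis
    using walk_funpow_mono[of f "\<lambda>_. R" k x] walk_funpow_mono[of "\<lambda>_. - R" f k x]
    by (simp add: walk_funpow_const abs_le_iff)
qed

lemma summable_poisson:
  assumes "\<And>x. \<bar>f x\<bar> \<le> R" shows "summable (\<lambda>k. sqrt_coeff k * (walk ^^ k) f x)"
proof (rule summable_comparison_test'[OF summable_mult[OF summable_sqrt_coeff, of R], of 0])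
  fix k
  show "norm (sqrt_coeff k * (walk ^^ k) f x) \<le> R * sqrt_coeff k"
    using mult_left_mono[OF walk_funpow_bound[of f R k x, OF assms] sqrt_coeff_nonneg[of k]]
    by (simp add: abs_mult sqrt_coeff_nonneg mult.commute)
qed

lemma poisson_linear:
  assumes "\<And>x. \<bar>f x\<bar> \<le> R" "\<And>x. \<bar>g x\<bar> \<le> R'"
  shows "poisson (\<lambda>x. c * f x + d * g x) = (\<lambda>x. c * poisson f x + d * poisson g x)"
proof
  fix x
  have "poisson (\<lambda>x. c * f x + d * g x) x
     = (\<Sum>k. c * (sqrt_coeff k * (walk ^^ k) f x) + d * (sqrt_coeff k * (walk ^^ k) g x))"
    by (simp add: poisson_def walk_funpow_linear algebra_simps)
  also have "\<dots> = c * poisson f x + d * poisson g x"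
    unfolding poisson_def
    using summable_poisson[of f R x, OF assms(1)] summable_poisson[of g R' x, OF assms(2)]
    by (simp add: suminf_add[symmetric] summable_mult suminf_mult)
  finally show "poisson (\<lambda>x. c * f x + d * g x) x = c * poisson f x + d * poisson g x" .
qed

lemma poisson_const: "poisson (\<lambda>_. c) = (\<lambda>_. c)"
  by (simp add: poisson_def fun_eq_iff walk_funpow_const suminf_mult2[OF summable_sqrt_coeff, symmetric]
      suminf_sqrt_coeff)

lemma poisson_mono:
  assumes "\<And>x. \<bar>f x\<bar> \<le> R" "\<And>x. \<bar>g x\<bar> \<le> R'" "\<And>x. f x \<le> g x"
  shows "poisson f x \<le> poisson g x"
  unfolding poisson_def
  by (intro suminf_le summable_poisson[of f R, OF assms(1)] summable_poisson[of g R', OF assms(2)] mult_left_mono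
      walk_funpow_mono assms sqrt_coeff_nonneg)

lemma poisson_nonneg:
  assumes "\<And>x. \<bar>f x\<bar> \<le> R" "\<And>x. 0 \<le> f x" shows "0 \<le> poisson f x"
  using poisson_mono[of "\<lambda>_. 0" 0 f R x, OF _ assms(1)] assms(2) by (simp add: poisson_const)

text \<open>Jensen's inequality for a concave power. Averaging the tangent at \<open>c\<close> gives the claim for \<open>c = Q f(x)\<close>; the
tangent does not exist at 0, hence \<open>c = Q f(x) + \<epsilon>\<close>.\<close>

lemma poisson_powr_le:
  assumes f: "\<And>x. 0 \<le> f x" "\<And>x. f x \<le> R" and s: "0 < s" "s \<le> 1"
  shows "poisson (\<lambda>x. f x powr s) x \<le> poisson f x powr s"
proof -
  have fb: "\<bar>f x\<bar> \<le> R" for x using f[of x] by simp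
  have p0: "0 \<le> poisson f x" using poisson_nonneg[of f R x, OF fb f(1)] .
  have R: "0 \<le> R" using f[of x] by linarith
  have bound: "poisson (\<lambda>x. f x powr s) x \<le> (poisson f x + \<epsilon>) powr s" if "\<epsilon> > 0" for \<epsilon>
  proof -
    define c where "c = poisson f x + \<epsilon>"
    have c: "c > 0" using p0 that by (simp add: c_def)
    define k where "k = c powr s"
    have k: "k > 0" using c by (simp add: k_def)
    have tangent: "f y powr s \<le> k * s / c * f y + k * (1 - s) * 1" for y
    proof -
      have "f y powr s = k * (f y / c) powr s"
        using c f(1)[of y] by (simp add: k_def powr_divide)
      also have "\<dots> \<le> k * (1 + s * (f y / c - 1))"
        using c f(1)[of y] s k by (intro mult_left_mono powr_le_tangent) auto
      finally show ?thesis by (simp add: algebra_simps)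
    qed
    have "poisson (\<lambda>x. f x powr s) x \<le> poisson (\<lambda>y. k * s / c * f y + k * (1 - s) * 1) x"
    proof (rule poisson_mono[OF _ _ tangent])
      show "\<bar>f y powr s\<bar> \<le> R powr s" for y using f s by (simp add: powr_mono2)
      show "\<bar>k * s / c * f y + k * (1 - s) * 1\<bar> \<le> k * s / c * R + k * (1 - s)" for y
      proof -
        have "0 \<le> k * s / c * f y" "k * s / c * f y \<le> k * s / c * R" "0 \<le> k * (1 - s)"
          using k s c f by (simp, intro mult_left_mono, simp_all)
        then show ?thesis by simp
      qed
    qed
    also have "\<dots> = k * s / c * poisson f x + k * (1 - s) * 1"
      by (subst poisson_linear[of f R "\<lambda>_. 1" 1, OF fb]) (auto simp: poisson_const)
    also have "\<dots> \<le> k * s / c * c + k * (1 - s) * 1"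
      using k s c that by (intro add_mono mult_left_mono) (auto simp: c_def)
    also have "\<dots> = k" using c by (simp add: algebra_simps)
    finally show ?thesis by (simp add: k_def c_def)
  qed
  have "((\<lambda>\<epsilon>. (poisson f x + \<epsilon>) powr s) \<longlongrightarrow> (poisson f x + 0) powr s) (at_right 0)"
    using s p0 by (intro tendsto_powr2 tendsto_intros) (auto simp: eventually_at_right_less intro!: eventually_mono[OF eventually_at_right_less[of 0]])
  then show ?thesis
    using bound by (intro tendsto_lowerbound[where F = "at_right 0"])
      (auto simp: eventually_at_right_less intro!: eventually_mono[OF eventually_at_right_less[of 0]])
qed

section \<open>Energy of pairs of harmonic sequences\<close>

text \<open>The increments of \<open>u\<close> from the point \<open>x\<close> at level \<open>k + 1\<close> along the edges of the Markov chain: either one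
level up without moving, or one level down together with a step of the walk.\<close>

definition increment :: "(nat \<Rightarrow> int ^ 'd::finite \<Rightarrow> real) \<Rightarrow> nat \<Rightarrow> int ^ 'd
    \<Rightarrow> ('d \<times> bool) option option \<Rightarrow> real" where
  "increment u k x i = (case i of None \<Rightarrow> u (k + 2) x | Some z \<Rightarrow> u k (x + step z)) - u (k + 1) x"

definition harmonic :: "(nat \<Rightarrow> int ^ 'd::finite \<Rightarrow> real) \<Rightarrow> bool" where
  "harmonic u \<longleftrightarrow> (\<forall>k x. u (k + 1) x = (u (k + 2) x + walk (u k) x) / 2)"

lemma has_sum_sum_index:
  fixes f :: "'i \<Rightarrow> 'x \<Rightarrow> 'b::real_normed_vector"
  assumes "finite I" "\<And>i. i \<in> I \<Longrightarrow> (f i has_sum s i) A"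
  shows "((\<lambda>x. \<Sum>i\<in>I. f i x) has_sum (\<Sum>i\<in>I. s i)) A"
  using assms by (induction I) (auto intro!: has_sum_add)

lemma has_sum_shift:
  fixes f :: "int ^ 'd::finite \<Rightarrow> 'b::real_normed_vector"
  assumes "(f has_sum s) UNIV" shows "((\<lambda>x. f (x + y)) has_sum s) UNIV"
  using assms by (subst has_sum_reindex_bij_betw[OF bij_plus_right])

lemma has_sum_walk:
  fixes f :: "int ^ 'd::finite \<Rightarrow> real"
  assumes "(f has_sum s) UNIV" shows "(walk f has_sum s) UNIV"
proof -
  have "((\<lambda>x. \<Sum>z\<in>UNIV. step_prob z * f (x + step z))
      has_sum (\<Sum>z\<in>UNIV. step_prob (z :: ('d \<times> bool) option) * s)) UNIV"
    by (intro has_sum_sum_index has_sum_cmult_right has_sum_shift assms) auto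
  then show ?thesis
    by (simp add: walk_def[abs_def] sum_step_prob flip: sum_distrib_right)
qed

text \<open>The Bellman function of the pair, summed over the lattice, depends on the level as a bounded convex
sequence: translation invariance turns the mean over the steps of the walk into a second difference in
the level, and the gain inequality makes it dominate the products of increments.\<close>

lemma harmonic_energy:
  fixes u v :: "nat \<Rightarrow> int ^ 'd::finite \<Rightarrow> real"
  assumes a: "0 \<le> a" "a < 1" and harm: "harmonic u" "harmonic v"
    and u: "\<And>k x. 0 \<le> u k x" "\<And>k x. u k x \<le> v k x powr (1 - a)"
    and v: "\<And>k x. 0 \<le> v k x" "\<And>k x. v k x \<le> R" "\<And>k. (v k has_sum K) UNIV"
    and M: "M = 56 * real CARD('d) / (1 - a)\<^sup>2"
  shows "(\<lambda>x. \<bar>increment u k x i\<bar> * \<bar>increment v k x l\<bar>) summable_on UNIV"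
    and "(\<Sum>k<N. real (k + 1) * (\<Sum>\<^sub>\<infinity>x. \<bar>increment u k x i\<bar> * \<bar>increment v k x l\<bar>))
      \<le> 8 * real CARD('d) * (1 + M) * (\<Sum>\<^sub>\<infinity>x. v 0 x powr (2 - a))"
proof -
  define w where "w = 1 / (8 * real CARD('d))"
  have w: "0 < w" by (simp add: w_def)
  have Mw: "M = 7 / (w * (1 - a)\<^sup>2)" by (simp add: w_def M)
  have M0: "0 \<le> M" by (simp add: M)
  define B where "B = (\<lambda>k x. bellman M a (u k x) (v k x))"
  define D where "D = (\<lambda>k x. (B (k + 2) x + walk (B k) x) / 2 - B (k + 1) x)"
  have B0: "0 \<le> B k x" for k x using M0 u v by (simp add: B_def bellman_def)
  have Bv: "B k x \<le> (1 + M) * v k x powr (2 - a)" for k x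
  proof -
    have "(u k x)\<^sup>2 * v k x powr a \<le> (v k x powr (1 - a))\<^sup>2 * v k x powr a"
      using u by (intro mult_right_mono power_mono) auto
    also have "\<dots> = v k x powr (2 - a)"
      by (simp add: power2_eq_square flip: powr_add)
    finally show ?thesis by (simp add: B_def bellman_def algebra_simps)
  qed
  have R: "0 \<le> R" using v(1,2) order_trans by blast
  have vR: "v k x powr (2 - a) \<le> R powr (1 - a) * v k x" for k x
  proof -
    have "v k x powr (2 - a) = v k x powr (1 - a) * v k x powr 1"
      by (simp only: powr_add[symmetric]) simp
    also have "\<dots> \<le> R powr (1 - a) * v k x"
      using v(1,2)[of k x] a by (intro mult_mono powr_mono2) auto
    finally show ?thesis .
  qed
  have vs: "v k summable_on UNIV" for k using v(3) by (rule has_sum_imp_summable)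
  have vqs: "(\<lambda>x. v k x powr (2 - a)) summable_on UNIV" for k
    using summable_on_cmult_right[OF vs] vR by (rule summable_on_comparison_test) auto
  have Bs: "B k summable_on UNIV" for k
    using summable_on_cmult_right[OF vqs] Bv by (rule summable_on_comparison_test) (auto simp: B0)
  define \<beta> where "\<beta> = (\<lambda>k. \<Sum>\<^sub>\<infinity>x. B k x)"
  have Bh: "(B k has_sum \<beta> k) UNIV" for k unfolding \<beta>_def using Bs by (rule has_sum_infsum)
  have \<beta>0: "0 \<le> \<beta> k" for k unfolding \<beta>_def by (intro infsum_nonneg B0)
  \<comment> \<open>a crude bound suffices: it only has to be uniform in the level\<close>
  have \<beta>K: "\<beta> k \<le> (1 + M) * R powr (1 - a) * K" for k
  proof (rule has_sum_mono[OF Bh has_sum_cmult_right[OF v(3)]])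
    show "B k x \<le> (1 + M) * R powr (1 - a) * v k x" for x
      using order_trans[OF Bv mult_left_mono[OF vR]] M0 by (simp add: mult.assoc)
  qed
  have Dh: "(D k has_sum (\<beta> (k + 2) - 2 * \<beta> (k + 1) + \<beta> k) / 2) UNIV" for k
  proof -
    have "((\<lambda>x. (B (k + 2) x + walk (B k) x) * (1/2) + (- 1) * B (k + 1) x)
        has_sum (\<beta> (k + 2) + \<beta> k) * (1/2) + (- 1) * \<beta> (k + 1)) UNIV"
      by (intro has_sum_add has_sum_cmult_left has_sum_cmult_right has_sum_walk Bh)
    then show ?thesis by (simp add: D_def[abs_def] diff_divide_distrib add_divide_distrib algebra_simps)
  qed
  define P :: "('d \<times> bool) option option \<Rightarrow> real"
    where "P = (\<lambda>i. case i of None \<Rightarrow> 1/2 | Some z \<Rightarrow> step_prob z / 2)"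
  define val where "val = (\<lambda>(f :: nat \<Rightarrow> int ^ 'd \<Rightarrow> real) k x i.
    (case i of None \<Rightarrow> f (k + 2) x | Some z \<Rightarrow> f k (x + step z)))"
  have Pval: "(\<Sum>i\<in>UNIV. P i * val f k x i) = (f (k + 2) x + walk (f k) x) / 2" for f k x
    by (subst sum_option_UNIV) (simp add: P_def val_def walk_def sum_divide_distrib add_divide_distrib)
  have wP: "w \<le> P i" for i
  proof -
    define r where "r = real CARD('d)"
    have "1 \<le> r" by (simp add: r_def Suc_leI)
    then show ?thesis
      unfolding w_def P_def step_prob_def r_def[symmetric]
      by (auto simp: field_simps split: option.splits)
  qed
  have P1: "(\<Sum>i\<in>UNIV. P i) = 1"
    by (subst sum_option_UNIV) (simp add: P_def sum_step_prob flip: sum_divide_distrib)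
  have gain: "w * (\<bar>increment u k x i\<bar> * \<bar>increment v k x l\<bar>) \<le> D k x" for k x
  proof -
    have "w * \<bar>val u k x i - u (k + 1) x\<bar> * \<bar>val v k x l - v (k + 1) x\<bar>
      \<le> (\<Sum>i\<in>UNIV. P i * bellman M a (val u k x i) (val v k x i)) - bellman M a (u (k + 1) x) (v (k + 1) x)"
    proof (rule bellman_jensen_gain[OF w wP P1 a Mw _ u(2)])
      show "u (k + 1) x = (\<Sum>i\<in>UNIV. P i * val u k x i)"
        unfolding Pval using harm(1) unfolding harmonic_def by blast
      show "v (k + 1) x = (\<Sum>i\<in>UNIV. P i * val v k x i)"
        unfolding Pval using harm(2) unfolding harmonic_def by blast
      show "0 \<le> val v k x i" "0 \<le> val u k x i" "val u k x i \<le> val v k x i powr (1 - a)" for i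
        using u v by (auto simp: val_def split: option.splits)
    qed
    also have "(\<lambda>i. bellman M a (val u k x i) (val v k x i)) = val B k x"
      by (auto simp: val_def B_def fun_eq_iff split: option.splits)
    then have "(\<Sum>i\<in>UNIV. P i * bellman M a (val u k x i) (val v k x i)) = (\<Sum>i\<in>UNIV. P i * val B k x i)"
      by metis
    finally show ?thesis
      unfolding Pval by (cases i; cases l) (simp_all add: D_def B_def increment_def val_def mult.assoc)
  qed
  have D0: "0 \<le> D k x" for k x
    using gain[of k x] w by (meson abs_ge_zero mult_nonneg_nonneg order_trans less_imp_le)
  have gain': "\<bar>increment u k x i\<bar> * \<bar>increment v k x l\<bar> \<le> 1 / w * D k x" for k x
    using gain[of k x] w by (simp add: field_simps)
  show s: "(\<lambda>x. \<bar>increment u k x i\<bar> * \<bar>increment v k x l\<bar>) summable_on UNIV" for k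
    using summable_on_cmult_right[OF has_sum_imp_summable[OF Dh]] gain'
    by (rule summable_on_comparison_test) auto
  have conv: "0 \<le> \<beta> (k + 2) - 2 * \<beta> (k + 1) + \<beta> k" for k
    using has_sum_nonneg[OF Dh D0, of k] by simp
  have le: "(\<Sum>\<^sub>\<infinity>x. \<bar>increment u k x i\<bar> * \<bar>increment v k x l\<bar>)
      \<le> 1 / w * (\<beta> (k + 2) - 2 * \<beta> (k + 1) + \<beta> k)" for k
  proof -
    have "(\<Sum>\<^sub>\<infinity>x. \<bar>increment u k x i\<bar> * \<bar>increment v k x l\<bar>)
        \<le> 1 / w * ((\<beta> (k + 2) - 2 * \<beta> (k + 1) + \<beta> k) / 2)"
      by (rule has_sum_mono[OF has_sum_infsum[OF s] has_sum_cmult_right[OF Dh] gain'])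
    also have "\<dots> \<le> 1 / w * (\<beta> (k + 2) - 2 * \<beta> (k + 1) + \<beta> k)"
      using conv[of k] w by (intro mult_left_mono) auto
    finally show ?thesis .
  qed
  have "(\<Sum>k<N. real (k + 1) * (\<Sum>\<^sub>\<infinity>x. \<bar>increment u k x i\<bar> * \<bar>increment v k x l\<bar>))
      \<le> (\<Sum>k<N. real (k + 1) * (1 / w * (\<beta> (k + 2) - 2 * \<beta> (k + 1) + \<beta> k)))"
    by (intro sum_mono mult_left_mono le) auto
  also have "\<dots> = 1 / w * (\<Sum>k<N. real (k + 1) * (\<beta> (k + 2) - 2 * \<beta> (k + 1) + \<beta> k))"
    by (simp only: sum_distrib_left mult.left_commute)
  also have "\<dots> \<le> 1 / w * \<beta> 0"
    using w by (intro mult_left_mono sum_weighted_second_differences_le[OF conv \<beta>K \<beta>0]) auto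
  also have "\<dots> \<le> 1 / w * ((1 + M) * (\<Sum>\<^sub>\<infinity>x. v 0 x powr (2 - a)))"
    using w by (intro mult_left_mono has_sum_mono[OF Bh has_sum_cmult_right[OF has_sum_infsum[OF vqs]] Bv]) auto
  finally show "(\<Sum>k<N. real (k + 1) * (\<Sum>\<^sub>\<infinity>x. \<bar>increment u k x i\<bar> * \<bar>increment v k x l\<bar>))
      \<le> 8 * real CARD('d) * (1 + M) * (\<Sum>\<^sub>\<infinity>x. v 0 x powr (2 - a))"
    by (simp add: w_def mult.assoc)
qed

section \<open>Characters and square integrable functions on the torus\<close>

definition character :: "int ^ 'd::finite \<Rightarrow> real ^ 'd \<Rightarrow> complex" where
  "character n \<xi> = exp (2 * of_real pi * \<i> * of_real ((\<chi> k. real_of_int (n $ k)) \<bullet> \<xi>))"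

lemma fourier_partial_eq: "fourier_partial f A \<xi> = (\<Sum>n\<in>A. f n * character n \<xi>)"
  by (simp add: fourier_partial_def character_def)

lemma character_0 [simp]: "character 0 \<xi> = 1"
  by (simp add: character_def inner_vec_def)

lemma character_add: "character (n + m) \<xi> = character n \<xi> * character m \<xi>"
proof -
  have "(\<chi> k. real_of_int ((n + m) $ k)) = (\<chi> k. real_of_int (n $ k)) + (\<chi> k. real_of_int (m $ k))"
    by (simp add: vec_eq_iff)
  then show ?thesis
    by (simp add: character_def inner_add_left distrib_left exp_add)
qed

lemma norm_character [simp]: "norm (character n \<xi>) = 1"
  by (simp add: character_def norm_exp_eq_Re)

lemma cnj_character: "cnj (character n \<xi>) = character (- n) \<xi>"
proof -
  have "(\<chi> k. real_of_int ((- n) $ k)) = - (\<chi> k. real_of_int (n $ k))"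
    by (simp add: vec_eq_iff)
  then show ?thesis by (simp add: character_def exp_cnj)
qed

lemma character_axis: "character (axis i 1) \<xi> = cis (2 * pi * \<xi> $ i)"
proof -
  have "(\<chi> k. real_of_int (axis i 1 $ k)) = axis i (1 :: real)"
    by (simp add: vec_eq_iff axis_def)
  then show ?thesis
    by (simp add: character_def inner_axis' cis_conv_exp mult_ac)
qed

lemma continuous_character: "continuous_on S (character n)"
  unfolding character_def by (intro continuous_intros)

lemma borel_measurable_character: "character n \<in> borel_measurable borel"
  by (intro borel_measurable_continuous_onI continuous_character)

lemma cube_measurable: "{\<xi> :: real ^ 'd::finite. \<forall>k. 0 \<le> \<xi> $ k \<and> \<xi> $ k < 1} \<in> sets borel"
proof -
  have "{\<xi> :: real ^ 'd. \<forall>k. 0 \<le> \<xi> $ k \<and> \<xi> $ k < 1} = (\<Inter>k. {\<xi>. 0 \<le> \<xi> $ k} \<inter> {\<xi>. \<xi> $ k < 1})"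
    by auto
  also have "\<dots> \<in> sets borel"
    by (intro sets.finite_INT sets.Int borel_closed borel_open closed_Collect_le open_Collect_less
        continuous_intros) auto
  finally show ?thesis .
qed

lemma borel_measurable_torusI: "f \<in> borel_measurable borel \<Longrightarrow> f \<in> borel_measurable torus"
  unfolding torus_def by (intro measurable_restrict_space1) simp

text \<open>The half open interval matches the torus; the endpoint is a null set.\<close>

lemma character_integral_1:
  "(\<integral>x. indicator {0..<1::real} x *\<^sub>R exp (2 * of_real pi * \<i> * of_real (of_int m * x)) \<partial>lborel)
    = (if m = 0 then 1 else 0)"
proof -
  let ?g = "\<lambda>x. exp (2 * of_real pi * \<i> * of_real (of_int m * x)) :: complex"
  have "(\<integral>x. indicator {0..<1} x *\<^sub>R ?g x \<partial>lborel) = (\<integral>x. indicator {0..1} x *\<^sub>R ?g x \<partial>lborel)"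
  proof (rule integral_cong_AE)
    show "AE x in lborel. indicator {0..<1} x *\<^sub>R ?g x = indicator {0..1} x *\<^sub>R ?g x"
      using AE_lborel_singleton[of "1::real"] by eventually_elim (auto simp: indicator_def)
  qed (measurable)
  also have "\<dots> = (if m = 0 then 1 else 0)"
  proof (cases "m = 0")
    case False
    define c where "c = 2 * of_real pi * \<i> * of_int m"
    have c: "c \<noteq> 0" using False by (simp add: c_def)
    have g: "?g x = exp (c * of_real x)" for x by (simp add: c_def mult.assoc)
    have "(\<integral>x. indicator {0..1} x *\<^sub>R exp (c * of_real x) \<partial>lborel)
        = exp (c * of_real 1) / c - exp (c * of_real 0) / c"
    proof (rule integral_FTC_atLeastAtMost)
      show "((\<lambda>x. exp (c * of_real x) / c) has_vector_derivative exp (c * of_real x)) (at x within {0..1})" for x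
        using c by (auto intro!: derivative_eq_intros has_vector_derivative_real_field)
    qed (auto intro!: continuous_intros)
    moreover have "exp c = 1"
      using exp_integer_2pi[of "of_int m"] by (simp add: c_def mult_ac)
    ultimately show ?thesis using False by (simp only: g) simp
  qed simp
  finally show ?thesis .
qed

lemma prod_Basis_vec: "(\<Prod>b\<in>Basis. g b) = (\<Prod>i\<in>UNIV. g (axis i (1::real)))"
  for g :: "real ^ 'd::finite \<Rightarrow> complex"
proof -
  have B: "Basis = range (\<lambda>i. axis i (1::real) :: real ^ 'd)"
    by (auto simp: Basis_vec_def)
  have "inj (\<lambda>i. axis i (1::real) :: real ^ 'd)" by (simp add: inj_on_def axis_eq_axis)
  then show ?thesis unfolding B by (subst prod.reindex) auto
qed

text \<open>Fubini: both the indicator of the cube and the character are products over the coordinates.\<close>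

lemma integral_torus_character:
  "(\<integral>\<xi>. character n \<xi> \<partial>torus) = (if n = (0 :: int ^ 'd::finite) then 1 else 0)"
proof -
  define h where "h = (\<lambda>(b :: real ^ 'd) x. indicator {0..<1::real} x *\<^sub>R
     exp (2 * of_real pi * \<i> * of_real (((\<chi> k. real_of_int (n $ k)) \<bullet> b) * x)) :: complex)"
  let ?cube = "{\<xi> :: real ^ 'd. \<forall>k. 0 \<le> \<xi> $ k \<and> \<xi> $ k < 1}"
  interpret product_sigma_finite "\<lambda>_ :: real ^ 'd. lborel :: real measure" ..
  have hm [measurable]: "h b \<in> borel_measurable borel" for b unfolding h_def by measurable
  have hint: "integrable lborel (h b)" for b
  proof -
    have "integrable lborel (\<lambda>x. indicator {0..<1::real} x *\<^sub>R (1::real))"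
      by (simp add: integrable_indicator_iff)
    then show ?thesis by (rule Bochner_Integration.integrable_bound)
       (auto simp: h_def indicator_def norm_exp_eq_Re)
  qed
  have prod: "indicator ?cube \<xi> *\<^sub>R character n \<xi> = (\<Prod>b\<in>Basis. h b (\<xi> \<bullet> b))" for \<xi> :: "real ^ 'd"
  proof -
    have "(\<Prod>b\<in>Basis. h b (\<xi> \<bullet> b)) = (\<Prod>i\<in>UNIV. h (axis i 1) (\<xi> $ i))"
      by (simp add: prod_Basis_vec inner_axis)
    also have "\<dots> = (\<Prod>i\<in>UNIV. of_real (indicator {0..<1} (\<xi> $ i))) *
        (\<Prod>i\<in>UNIV. exp (2 * of_real pi * \<i> * of_real (real_of_int (n $ i) * \<xi> $ i)))"
      by (simp add: h_def inner_axis scaleR_conv_of_real prod.distrib)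
    also have "(\<Prod>i\<in>UNIV. of_real (indicator {0..<1} (\<xi> $ i))) = (of_real (indicator ?cube \<xi>) :: complex)"
      by (auto simp: indicator_def prod_zero_iff)
    also have "(\<Prod>i\<in>UNIV. exp (2 * of_real pi * \<i> * of_real (real_of_int (n $ i) * \<xi> $ i))) = character n \<xi>"
      by (simp add: character_def inner_vec_def exp_sum sum_distrib_left)
    finally show ?thesis by (simp add: scaleR_conv_of_real)
  qed
  have "(\<integral>\<xi>. character n \<xi> \<partial>torus) = (\<integral>\<xi>. indicator ?cube \<xi> *\<^sub>R character n \<xi> \<partial>lborel)"
    unfolding torus_def using cube_measurable by (intro integral_restrict_space) simp
  also have "\<dots> = (\<integral>\<xi>. (\<Prod>b\<in>Basis. h b (\<xi> \<bullet> b)) \<partial>lborel)"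
    by (simp add: prod)
  also have "\<dots> = (\<integral>f. (\<Prod>b\<in>Basis. h b ((\<Sum>b\<in>Basis. f b *\<^sub>R b) \<bullet> b)) \<partial>(\<Pi>\<^sub>M b\<in>Basis. lborel))"
    by (subst lborel_eq, subst integral_distr) auto
  also have "\<dots> = (\<integral>f. (\<Prod>b\<in>Basis. h b (f b)) \<partial>(\<Pi>\<^sub>M b\<in>Basis. lborel))"
    by (intro Bochner_Integration.integral_cong prod.cong refl) simp
  also have "\<dots> = (\<Prod>b\<in>Basis. \<integral>x. h b x \<partial>lborel)"
    by (intro product_integral_prod hint) simp
  also have "\<dots> = (\<Prod>i\<in>UNIV. \<integral>x. h (axis i 1) x \<partial>lborel)"
    by (rule prod_Basis_vec)
  also have "\<dots> = (\<Prod>i\<in>UNIV. if n $ i = 0 then 1 else 0)"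
    using character_integral_1 by (intro prod.cong) (auto simp: h_def inner_axis)
  also have "\<dots> = (if n = 0 then 1 else 0)"
    by (auto simp: vec_eq_iff prod_zero_iff)
  finally show ?thesis .
qed

lemma finite_measure_torus: "finite_measure (torus :: (real ^ 'd::finite) measure)"
proof -
  let ?cube = "{\<xi> :: real ^ 'd. \<forall>k. 0 \<le> \<xi> $ k \<and> \<xi> $ k < 1}"
  have "?cube \<subseteq> cbox 0 1" by (auto simp: mem_box_cart less_imp_le)
  then have "bounded ?cube" using bounded_cbox bounded_subset by blast
  then have "emeasure lborel ?cube < \<infinity>" by (rule emeasure_bounded_finite)
  then show ?thesis
    using cube_measurable
    by (intro finite_measureI) (auto simp: torus_def emeasure_restrict_space space_restrict_space)
qed

lemma measure_torus: "measure (torus :: (real ^ 'd::finite) measure) (space torus) = 1"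
proof -
  have "complex_of_real (measure (torus :: (real ^ 'd) measure) (space torus)) = (\<integral>\<xi>. character (0 :: int ^ 'd) \<xi> \<partial>torus)"
    by (simp add: scaleR_conv_of_real)
  then show ?thesis
    unfolding integral_torus_character by simp
qed


lemma integrable_torus_bounded:
  fixes F :: "real ^ 'd::finite \<Rightarrow> 'b::{banach, second_countable_topology}"
  assumes "F \<in> borel_measurable torus" "\<And>\<xi>. norm (F \<xi>) \<le> C"
  shows "integrable torus F"
proof -
  interpret finite_measure "torus :: (real ^ 'd) measure" by (rule finite_measure_torus)
  show ?thesis using assms by (intro integrable_const_bound[of _ C]) auto
qed

lemma measurable_character [measurable]: "character n \<in> borel_measurable torus"
  by (intro borel_measurable_torusI borel_measurable_character)

lemma measurable_fourier_partial [measurable]: "fourier_partial f A \<in> borel_measurable torus"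
  unfolding fourier_partial_eq[abs_def] by measurable

lemma norm_fourier_partial_le: "norm (fourier_partial f A \<xi>) \<le> (\<Sum>n\<in>A. norm (f n))"
  unfolding fourier_partial_eq by (rule order_trans[OF norm_sum]) (simp add: norm_mult)

lemma torus_L2_D: "F \<in> torus_L2 \<Longrightarrow> F \<in> borel_measurable torus"
  "F \<in> torus_L2 \<Longrightarrow> integrable torus (\<lambda>\<xi>. (norm (F \<xi>))\<^sup>2)"
  by (simp_all add: torus_L2_def)

lemma norm_add_square_le: "(norm (a + b))\<^sup>2 \<le> 2 * (norm a)\<^sup>2 + 2 * (norm b)\<^sup>2"
  for a b :: "'a::real_normed_vector"
proof -
  have "(norm (a + b))\<^sup>2 \<le> (norm a + norm b)\<^sup>2" by (intro power_mono norm_triangle_ineq) simp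
  moreover have "0 \<le> (norm a - norm b)\<^sup>2" by simp
  ultimately show ?thesis by (simp add: power2_eq_square algebra_simps)
qed

lemma torus_L2_add:
  assumes "F \<in> torus_L2" "G \<in> torus_L2" shows "(\<lambda>\<xi>. F \<xi> + G \<xi>) \<in> torus_L2"
proof -
  note [measurable] = torus_L2_D(1)[OF assms(1)] torus_L2_D(1)[OF assms(2)]
  have "integrable torus (\<lambda>\<xi>. 2 * (norm (F \<xi>))\<^sup>2 + 2 * (norm (G \<xi>))\<^sup>2)"
    using assms by (intro Bochner_Integration.integrable_add integrable_mult_right torus_L2_D)
  then have "integrable torus (\<lambda>\<xi>. (norm (F \<xi> + G \<xi>))\<^sup>2)"
    by (rule Bochner_Integration.integrable_bound) (auto simp: norm_add_square_le)
  then show ?thesis by (simp add: torus_L2_def)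
qed

lemma torus_L2_mult_bounded:
  assumes "F \<in> torus_L2" and [measurable]: "m \<in> borel_measurable torus" and "\<And>\<xi>. norm (m \<xi>) \<le> C"
  shows "(\<lambda>\<xi>. m \<xi> * F \<xi>) \<in> torus_L2"
proof -
  note [measurable] = torus_L2_D(1)[OF assms(1)]
  have "integrable torus (\<lambda>\<xi>. C\<^sup>2 * (norm (F \<xi>))\<^sup>2)"
    using assms by (intro integrable_mult_right torus_L2_D)
  then have "integrable torus (\<lambda>\<xi>. (norm (m \<xi> * F \<xi>))\<^sup>2)"
  proof (rule Bochner_Integration.integrable_bound)
    show "AE \<xi> in torus. norm ((norm (m \<xi> * F \<xi>))\<^sup>2) \<le> norm (C\<^sup>2 * (norm (F \<xi>))\<^sup>2)"
      using assms(3) by (auto simp: norm_mult power_mult_distrib intro!: mult_right_mono power_mono)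
  qed simp
  then show ?thesis by (simp add: torus_L2_def)
qed

lemma torus_L2_bounded:
  assumes [measurable]: "m \<in> borel_measurable torus" and "\<And>\<xi>. norm (m \<xi>) \<le> C"
  shows "m \<in> torus_L2"
proof -
  have "(\<lambda>_. 1) \<in> torus_L2"
    unfolding torus_L2_def by (auto intro!: integrable_torus_bounded[where C = 1])
  from torus_L2_mult_bounded[OF this assms] show ?thesis by simp
qed

lemma torus_L2_diff:
  assumes "F \<in> torus_L2" "G \<in> torus_L2" shows "(\<lambda>\<xi>. F \<xi> - G \<xi>) \<in> torus_L2"
  using torus_L2_add[OF assms(1) torus_L2_mult_bounded[OF assms(2), of "\<lambda>_. -1" 1]] by simp

lemma torus_L2_fourier_partial: "fourier_partial f A \<in> torus_L2"
  by (rule torus_L2_bounded[OF _ norm_fourier_partial_le]) measurable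

definition L2_dist :: "(real ^ 'd::finite \<Rightarrow> complex) \<Rightarrow> (real ^ 'd \<Rightarrow> complex) \<Rightarrow> real" where
  "L2_dist F G = (\<integral>\<xi>. (norm (F \<xi> - G \<xi>))\<^sup>2 \<partial>torus)"

lemma L2_dist_nonneg: "0 \<le> L2_dist F G"
  by (simp add: L2_dist_def)

lemma L2_dist_commute: "L2_dist F G = L2_dist G F"
  by (simp add: L2_dist_def norm_minus_commute)

lemma L2_dist_triangle:
  assumes "F \<in> torus_L2" "G \<in> torus_L2" "H \<in> torus_L2"
  shows "L2_dist F H \<le> 2 * L2_dist F G + 2 * L2_dist G H"
proof -
  note i = torus_L2_D(2)[OF torus_L2_diff[OF assms(1,2)]] torus_L2_D(2)[OF torus_L2_diff[OF assms(2,3)]]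
    torus_L2_D(2)[OF torus_L2_diff[OF assms(1,3)]]
  have "L2_dist F H \<le> (\<integral>\<xi>. 2 * (norm (F \<xi> - G \<xi>))\<^sup>2 + 2 * (norm (G \<xi> - H \<xi>))\<^sup>2 \<partial>torus)"
    unfolding L2_dist_def
    using i norm_add_square_le[of "F \<xi> - G \<xi>" "G \<xi> - H \<xi>" for \<xi>]
    by (intro integral_mono Bochner_Integration.integrable_add integrable_mult_right) auto
  also have "\<dots> = 2 * L2_dist F G + 2 * L2_dist G H"
    unfolding L2_dist_def using i by (simp add: Bochner_Integration.integral_add)
  finally show ?thesis .
qed

lemma L2_dist_mult_le:
  assumes "F \<in> torus_L2" "G \<in> torus_L2" and [measurable]: "m \<in> borel_measurable torus"
    and m: "\<And>\<xi>. norm (m \<xi>) \<le> C"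
  shows "L2_dist (\<lambda>\<xi>. m \<xi> * F \<xi>) (\<lambda>\<xi>. m \<xi> * G \<xi>) \<le> C\<^sup>2 * L2_dist F G"
proof -
  have "L2_dist (\<lambda>\<xi>. m \<xi> * F \<xi>) (\<lambda>\<xi>. m \<xi> * G \<xi>) \<le> (\<integral>\<xi>. C\<^sup>2 * (norm (F \<xi> - G \<xi>))\<^sup>2 \<partial>torus)"
    unfolding L2_dist_def
  proof (rule integral_mono)
    show "integrable torus (\<lambda>\<xi>. (norm (m \<xi> * F \<xi> - m \<xi> * G \<xi>))\<^sup>2)"
      using torus_L2_D(2)[OF torus_L2_diff[OF torus_L2_mult_bounded[OF assms(1,3) m] torus_L2_mult_bounded[OF assms(2,3) m]]] .
    show "integrable torus (\<lambda>\<xi>. C\<^sup>2 * (norm (F \<xi> - G \<xi>))\<^sup>2)"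
      using torus_L2_D(2)[OF torus_L2_diff[OF assms(1,2)]] by (rule integrable_mult_right)
    show "(norm (m \<xi> * F \<xi> - m \<xi> * G \<xi>))\<^sup>2 \<le> C\<^sup>2 * (norm (F \<xi> - G \<xi>))\<^sup>2" for \<xi>
      using m[of \<xi>] unfolding right_diff_distrib[symmetric] norm_mult power_mult_distrib
      by (intro mult_right_mono power_mono) auto
  qed
  then show ?thesis by (simp add: L2_dist_def)
qed

lemma torus_L2_integrable:
  assumes "F \<in> torus_L2" shows "integrable torus F"
proof -
  note [measurable] = torus_L2_D(1)[OF assms]
  have "integrable torus (\<lambda>\<xi>. 1 + (norm (F \<xi>))\<^sup>2)"
    by (intro Bochner_Integration.integrable_add integrable_torus_bounded[where C = 1] torus_L2_D(2)[OF assms]) auto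
  then show ?thesis
  proof (rule Bochner_Integration.integrable_bound)
    have "norm (F \<xi>) \<le> 1 + (norm (F \<xi>))\<^sup>2" for \<xi>
    proof -
      have "2 * norm (F \<xi>) \<le> (norm (F \<xi>))\<^sup>2 + 1"
        using zero_le_power2[of "norm (F \<xi>) - 1"] by (simp add: power2_diff)
      then show ?thesis using norm_ge_zero[of "F \<xi>"] by linarith
    qed
    then show "AE \<xi> in torus. norm (F \<xi>) \<le> norm (1 + (norm (F \<xi>))\<^sup>2)"
      by (auto simp: abs_of_nonneg)
  qed measurable
qed

lemma integral_norm_square_le:
  assumes "F \<in> torus_L2" shows "(\<integral>\<xi>. norm (F \<xi>) \<partial>torus)\<^sup>2 \<le> (\<integral>\<xi>. (norm (F \<xi>))\<^sup>2 \<partial>torus)"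
proof -
  define c where "c = (\<integral>\<xi>. norm (F \<xi>) \<partial>torus)"
  have i: "integrable torus (\<lambda>\<xi>. norm (F \<xi>))" "integrable torus (\<lambda>\<xi>. (norm (F \<xi>))\<^sup>2)"
    "integrable torus (\<lambda>_ :: real ^ 'a. c\<^sup>2)"
    using torus_L2_integrable[OF assms] torus_L2_D(2)[OF assms]
    by (auto intro!: integrable_torus_bounded[where C = "c\<^sup>2"])
  have "0 \<le> (\<integral>\<xi>. (norm (F \<xi>) - c)\<^sup>2 \<partial>torus)" by simp
  also have "\<dots> = (\<integral>\<xi>. (norm (F \<xi>))\<^sup>2 - (2 * c) * norm (F \<xi>) + c\<^sup>2 \<partial>torus)"
    by (intro Bochner_Integration.integral_cong) (auto simp: power2_eq_square algebra_simps)
  also have "\<dots> = (\<integral>\<xi>. (norm (F \<xi>))\<^sup>2 \<partial>torus) - 2 * c * c + c\<^sup>2"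
    using i by (simp add: measure_torus c_def)
  finally show ?thesis by (simp add: c_def power2_eq_square)
qed

text \<open>The torus has measure 1, so \<open>L\<^sup>2\<close> distances dominate \<open>L\<^sup>1\<close> distances.\<close>

lemma norm_integral_diff_le:
  assumes "F \<in> torus_L2" "G \<in> torus_L2" and [measurable]: "m \<in> borel_measurable torus"
    and m: "\<And>\<xi>. norm (m \<xi>) \<le> C"
  shows "norm ((\<integral>\<xi>. F \<xi> * m \<xi> \<partial>torus) - (\<integral>\<xi>. G \<xi> * m \<xi> \<partial>torus)) \<le> C * sqrt (L2_dist F G)"
proof -
  have int: "integrable torus (\<lambda>\<xi>. H \<xi> * m \<xi>)" if "H \<in> torus_L2" for H
    using torus_L2_integrable[OF torus_L2_mult_bounded[OF that assms(3) m]] by (simp add: mult.commute)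
  note D = torus_L2_diff[OF assms(1,2)]
  have C: "0 \<le> C" using m[of undefined] norm_ge_zero order_trans by blast
  have "(\<integral>\<xi>. F \<xi> * m \<xi> \<partial>torus) - (\<integral>\<xi>. G \<xi> * m \<xi> \<partial>torus) = (\<integral>\<xi>. (F \<xi> - G \<xi>) * m \<xi> \<partial>torus)"
    using int assms by (simp add: left_diff_distrib)
  also have "norm \<dots> \<le> (\<integral>\<xi>. norm ((F \<xi> - G \<xi>) * m \<xi>) \<partial>torus)"
    by (rule integral_norm_bound)
  also have "\<dots> \<le> (\<integral>\<xi>. C * norm (F \<xi> - G \<xi>) \<partial>torus)"
  proof (rule integral_mono)
    show "integrable torus (\<lambda>\<xi>. norm ((F \<xi> - G \<xi>) * m \<xi>))" using int[OF D] by simp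
    show "integrable torus (\<lambda>\<xi>. C * norm (F \<xi> - G \<xi>))" using torus_L2_integrable[OF D] by simp
    show "norm ((F \<xi> - G \<xi>) * m \<xi>) \<le> C * norm (F \<xi> - G \<xi>)" for \<xi>
      using m[of \<xi>] by (simp add: norm_mult mult.commute mult_right_mono)
  qed
  also have "\<dots> = C * (\<integral>\<xi>. norm (F \<xi> - G \<xi>) \<partial>torus)" by simp
  also have "\<dots> \<le> C * sqrt (L2_dist F G)"
    unfolding L2_dist_def using C integral_norm_square_le[OF D] by (intro mult_left_mono real_le_rsqrt)
  finally show ?thesis .
qed

lemma AE_eq_if_L2_dist_0:
  assumes "F \<in> torus_L2" "G \<in> torus_L2" "L2_dist F G = 0" shows "AE \<xi> in torus. F \<xi> = G \<xi>"
proof -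
  have "AE \<xi> in torus. (norm (F \<xi> - G \<xi>))\<^sup>2 = 0"
    using assms(3) torus_L2_D(2)[OF torus_L2_diff[OF assms(1,2)]] unfolding L2_dist_def
    by (subst (asm) integral_nonneg_eq_0_iff_AE) auto
  then show ?thesis by eventually_elim simp
qed

lemma L2_limit_unique:
  assumes "F \<in> torus_L2" "G \<in> torus_L2" "\<And>i. H i \<in> torus_L2" "\<X> \<noteq> bot"
    and "((\<lambda>i. L2_dist F (H i)) \<longlongrightarrow> 0) \<X>" "((\<lambda>i. L2_dist G (H i)) \<longlongrightarrow> 0) \<X>"
  shows "AE \<xi> in torus. F \<xi> = G \<xi>"
proof (rule AE_eq_if_L2_dist_0[OF assms(1,2)])
  have "((\<lambda>i. 2 * L2_dist F (H i) + 2 * L2_dist G (H i)) \<longlongrightarrow> 2 * 0 + 2 * 0) \<X>"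
    by (intro tendsto_intros assms)
  moreover have "L2_dist F G \<le> 2 * L2_dist F (H i) + 2 * L2_dist G (H i)" for i
    using L2_dist_triangle[OF assms(1) assms(3)[of i] assms(2)] by (simp add: L2_dist_commute)
  ultimately have "L2_dist F G \<le> 2 * 0 + 2 * 0"
    by (intro tendsto_lowerbound[OF _ _ assms(4)]) auto
  then show "L2_dist F G = 0" using L2_dist_nonneg[of F G] by simp
qed

section \<open>Fourier coefficients and best approximation\<close>

abbreviation finite_sets :: "'a set filter" where
  "finite_sets \<equiv> finite_subsets_at_top UNIV"

definition fourier_coeff :: "(real ^ 'd::finite \<Rightarrow> complex) \<Rightarrow> int ^ 'd \<Rightarrow> complex" where
  "fourier_coeff G n = (\<integral>\<xi>. G \<xi> * cnj (character n \<xi>) \<partial>torus)"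

lemma integral_character_orthonormal:
  "(\<integral>\<xi>. character n \<xi> * cnj (character m \<xi>) \<partial>torus) = (if n = m then 1 else 0)"
proof -
  have "character n \<xi> * cnj (character m \<xi>) = character (n - m) \<xi>" for \<xi>
    by (simp add: cnj_character flip: character_add)
  then show ?thesis by (simp add: integral_torus_character)
qed

lemma measurable_cnj [measurable (raw)]:
  "f \<in> borel_measurable M \<Longrightarrow> (\<lambda>x. cnj (f x)) \<in> borel_measurable M"
  by (rule borel_measurable_continuous_on[OF continuous_on_cnj[OF continuous_on_id]])

lemma torus_L2_mult_integrable:
  assumes "G \<in> torus_L2" "m \<in> borel_measurable torus" "\<And>\<xi>. norm (m \<xi>) \<le> C"
  shows "integrable torus (\<lambda>\<xi>. G \<xi> * m \<xi>)"
  using torus_L2_integrable[OF torus_L2_mult_bounded[OF assms]] by (simp add: mult.commute)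

lemma integrable_mult_cnj_character:
  assumes "G \<in> torus_L2" shows "integrable torus (\<lambda>\<xi>. G \<xi> * cnj (character n \<xi>))"
  by (rule torus_L2_mult_integrable[OF assms, where C = 1]) auto

lemma fourier_coeff_partial:
  assumes "finite A" shows "fourier_coeff (fourier_partial c A) n = (if n \<in> A then c n else 0)"
proof -
  have "fourier_coeff (fourier_partial c A) n
      = (\<integral>\<xi>. (\<Sum>k\<in>A. c k * (character k \<xi> * cnj (character n \<xi>))) \<partial>torus)"
    unfolding fourier_coeff_def fourier_partial_eq by (simp add: sum_distrib_right mult.assoc)
  also have "\<dots> = (\<Sum>k\<in>A. \<integral>\<xi>. c k * (character k \<xi> * cnj (character n \<xi>)) \<partial>torus)"
  proof (rule Bochner_Integration.integral_sum)
    show "integrable torus (\<lambda>\<xi>. c k * (character k \<xi> * cnj (character n \<xi>)))" for k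
      by (rule integrable_torus_bounded[where C = "norm (c k)"]) (auto simp: norm_mult)
  qed
  also have "\<dots> = (\<Sum>k\<in>A. c k * (if k = n then 1 else 0))"
    by (simp only: integral_mult_right_zero integral_character_orthonormal)
  also have "\<dots> = (if n \<in> A then c n else 0)" using assms by (simp add: if_distrib cong: if_cong)
  finally show ?thesis .
qed

lemma fourier_coeff_diff:
  assumes "F \<in> torus_L2" "G \<in> torus_L2"
  shows "fourier_coeff (\<lambda>\<xi>. F \<xi> - G \<xi>) n = fourier_coeff F n - fourier_coeff G n"
  unfolding fourier_coeff_def using integrable_mult_cnj_character[OF assms(1)] integrable_mult_cnj_character[OF assms(2)]
  by (simp add: left_diff_distrib)

text \<open>The Pythagorean expansion, adding one frequency at a time.\<close>

lemma L2_dist_partial: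
  assumes G: "G \<in> torus_L2" and "finite A"
  shows "L2_dist G (fourier_partial c A) = (\<integral>\<xi>. (norm (G \<xi>))\<^sup>2 \<partial>torus)
     - (\<Sum>n\<in>A. (norm (fourier_coeff G n))\<^sup>2) + (\<Sum>n\<in>A. (norm (fourier_coeff G n - c n))\<^sup>2)"
  using assms(2)
proof (induction A)
  case empty
  show ?case by (simp add: L2_dist_def fourier_partial_eq)
next
  case (insert n A)
  define H where "H = (\<lambda>\<xi>. G \<xi> - fourier_partial c A \<xi>)"
  have H: "H \<in> torus_L2" unfolding H_def by (intro torus_L2_diff G torus_L2_fourier_partial)
  have Hn: "fourier_coeff H n = fourier_coeff G n"
    unfolding H_def using insert by (simp add: fourier_coeff_diff G torus_L2_fourier_partial fourier_coeff_partial)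
  have sq: "(norm (a - b))\<^sup>2 = (norm a)\<^sup>2 - 2 * Re (a * cnj b) + (norm b)\<^sup>2" for a b :: complex
    unfolding cmod_power2 by (simp add: power2_eq_square algebra_simps)
  have "L2_dist G (fourier_partial c (insert n A)) = (\<integral>\<xi>. (norm (H \<xi> - c n * character n \<xi>))\<^sup>2 \<partial>torus)"
    unfolding L2_dist_def H_def fourier_partial_eq using insert(1,2) by (simp add: algebra_simps)
  also have "\<dots> = (\<integral>\<xi>. (norm (H \<xi>))\<^sup>2 - 2 * Re (cnj (c n) * (H \<xi> * cnj (character n \<xi>))) + (norm (c n))\<^sup>2 \<partial>torus)"
    unfolding sq by (simp add: norm_mult mult_ac)
  also have "\<dots> = (\<integral>\<xi>. (norm (H \<xi>))\<^sup>2 \<partial>torus) - 2 * Re (cnj (c n) * fourier_coeff H n) + (norm (c n))\<^sup>2"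
  proof -
    have 1: "integrable torus (\<lambda>\<xi>. (norm (H \<xi>))\<^sup>2)" by (rule torus_L2_D(2)[OF H])
    have 2: "integrable torus (\<lambda>\<xi>. cnj (c n) * (H \<xi> * cnj (character n \<xi>)))"
      using integrable_mult_cnj_character[OF H] by (rule integrable_mult_right)
    have 3: "integrable torus (\<lambda>_ :: real ^ 'a. (norm (c n))\<^sup>2)"
      by (rule integrable_torus_bounded[where C = "(norm (c n))\<^sup>2"]) auto
    have "(\<integral>\<xi>. Re (cnj (c n) * (H \<xi> * cnj (character n \<xi>))) \<partial>torus) = Re (cnj (c n) * fourier_coeff H n)"
      unfolding fourier_coeff_def by (subst integral_Re[OF 2]) (simp only: integral_mult_right_zero)
    then show ?thesis
      using 1 integrable_Re[OF 2] 3
      by (simp only: Bochner_Integration.integral_add Bochner_Integration.integral_diff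
          Bochner_Integration.integrable_diff integrable_mult_right integral_mult_right_zero)
        (simp add: measure_torus)
  qed
  also have "(\<integral>\<xi>. (norm (H \<xi>))\<^sup>2 \<partial>torus) = L2_dist G (fourier_partial c A)"
    by (simp add: L2_dist_def H_def)
  finally have "L2_dist G (fourier_partial c (insert n A))
    = L2_dist G (fourier_partial c A) - 2 * Re (cnj (c n) * fourier_coeff H n) + (norm (c n))\<^sup>2" .
  moreover have "- 2 * Re (cnj (c n) * fourier_coeff H n) + (norm (c n))\<^sup>2
      = (norm (fourier_coeff G n - c n))\<^sup>2 - (norm (fourier_coeff G n))\<^sup>2"
    unfolding sq Hn by (simp add: mult.commute)
  ultimately show ?case unfolding insert(3) using insert(1,2) by simp
qed


text \<open>Closure of the trigonometric polynomials. The products of the multiplier with transforms are placed here by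
construction, and for elements of this closure the Fourier series converges by best approximation alone.\<close>

definition trig_closure :: "(real ^ 'd::finite \<Rightarrow> complex) set" where
  "trig_closure = {G \<in> torus_L2. \<forall>\<epsilon>>0. \<exists>A c. finite A \<and> L2_dist G (fourier_partial c A) < \<epsilon>}"

text \<open>A sum over an infinite index set is 0 by convention, hence also a trigonometric polynomial.\<close>

lemma fourier_partial_in_trig_closure: "fourier_partial c A \<in> trig_closure"
proof -
  have "\<exists>B. finite B \<and> fourier_partial c A = fourier_partial c B"
    by (intro exI[of _ "if finite A then A else {}"]) (simp add: fourier_partial_eq fun_eq_iff)
  then show ?thesis
    unfolding trig_closure_def
    by (auto simp: torus_L2_fourier_partial L2_dist_def intro!: exI[of _ c])
qed

lemma trig_closure_limit:
  assumes G: "G \<in> torus_L2" and H: "\<And>i. H i \<in> trig_closure" "\<X> \<noteq> bot"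
    and lim: "((\<lambda>i. L2_dist G (H i)) \<longlongrightarrow> 0) \<X>"
  shows "G \<in> trig_closure"
  unfolding trig_closure_def
proof (intro CollectI conjI G allI impI)
  fix \<epsilon> :: real assume \<epsilon>: "\<epsilon> > 0"
  have "eventually (\<lambda>i. L2_dist G (H i) < \<epsilon> / 4) \<X>"
    using lim \<epsilon> by (intro order_tendstoD(2)[OF lim]) auto
  then obtain i where i: "L2_dist G (H i) < \<epsilon> / 4"
    using H(2) eventually_happens by blast
  obtain A c where A: "finite A" "L2_dist (H i) (fourier_partial c A) < \<epsilon> / 4"
    using H(1)[of i] \<epsilon> unfolding trig_closure_def by (auto elim!: allE[of _ "\<epsilon> / 4"])
  have Hi: "H i \<in> torus_L2" using H(1) by (auto simp: trig_closure_def)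
  have "L2_dist G (fourier_partial c A) < \<epsilon>"
    using L2_dist_triangle[OF G Hi torus_L2_fourier_partial, of c A] i A by linarith
  then show "\<exists>A c. finite A \<and> L2_dist G (fourier_partial c A) < \<epsilon>" using A by blast
qed

lemma fourier_partial_restrict:
  "finite B \<Longrightarrow> A \<subseteq> B \<Longrightarrow> fourier_partial (\<lambda>n. if n \<in> A then c n else 0) B = fourier_partial c A"
  unfolding fourier_partial_eq fun_eq_iff
  by (auto intro!: sum.mono_neutral_cong_right)

lemma trig_closure_add:
  assumes "F \<in> trig_closure" "G \<in> trig_closure" shows "(\<lambda>\<xi>. F \<xi> + G \<xi>) \<in> trig_closure"
  unfolding trig_closure_def
proof (intro CollectI conjI allI impI)
  have L2: "F \<in> torus_L2" "G \<in> torus_L2" using assms by (auto simp: trig_closure_def)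
  show S: "(\<lambda>\<xi>. F \<xi> + G \<xi>) \<in> torus_L2" by (intro torus_L2_add L2)
  fix \<epsilon> :: real assume \<epsilon>: "\<epsilon> > 0"
  obtain A c where A: "finite A" "L2_dist F (fourier_partial c A) < \<epsilon> / 4"
    using assms(1) \<epsilon> unfolding trig_closure_def by (auto elim!: allE[of _ "\<epsilon> / 4"])
  obtain B d where B: "finite B" "L2_dist G (fourier_partial d B) < \<epsilon> / 4"
    using assms(2) \<epsilon> unfolding trig_closure_def by (auto elim!: allE[of _ "\<epsilon> / 4"])
  define h where "h = (\<lambda>n. (if n \<in> A then c n else 0) + (if n \<in> B then d n else 0))"
  have fin: "finite (A \<union> B)" using A B by simp
  have h: "fourier_partial h (A \<union> B) \<xi> = fourier_partial c A \<xi> + fourier_partial d B \<xi>" for \<xi>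
    unfolding fourier_partial_restrict[OF fin Un_upper1, symmetric] fourier_partial_restrict[OF fin Un_upper2, symmetric]
    by (simp add: h_def fourier_partial_eq sum.distrib distrib_right)
  have M: "(\<lambda>\<xi>. fourier_partial c A \<xi> + G \<xi>) \<in> torus_L2"
    by (intro torus_L2_add L2 torus_L2_fourier_partial)
  have "L2_dist (\<lambda>\<xi>. F \<xi> + G \<xi>) (fourier_partial h (A \<union> B)) \<le> 2 * L2_dist F (fourier_partial c A) + 2 * L2_dist G (fourier_partial d B)"
    using L2_dist_triangle[OF S M torus_L2_fourier_partial, of h "A \<union> B"]
    unfolding L2_dist_def h by simp
  then have "L2_dist (\<lambda>\<xi>. F \<xi> + G \<xi>) (fourier_partial h (A \<union> B)) < \<epsilon>" using A B by linarith
  then show "\<exists>A c. finite A \<and> L2_dist (\<lambda>\<xi>. F \<xi> + G \<xi>) (fourier_partial c A) < \<epsilon>" using fin by blast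
qed

lemma trig_closure_scale:
  assumes "F \<in> trig_closure" shows "(\<lambda>\<xi>. k * F \<xi>) \<in> trig_closure"
  unfolding trig_closure_def
proof (intro CollectI conjI allI impI)
  have L2: "F \<in> torus_L2" using assms by (auto simp: trig_closure_def)
  show "(\<lambda>\<xi>. k * F \<xi>) \<in> torus_L2" by (rule torus_L2_mult_bounded[OF L2, of _ "norm k"]) auto
  fix \<epsilon> :: real assume \<epsilon>: "\<epsilon> > 0"
  define \<delta> where "\<delta> = \<epsilon> / ((norm k)\<^sup>2 + 1)"
  have "\<delta> > 0" unfolding \<delta>_def using \<epsilon> by (intro divide_pos_pos add_nonneg_pos) auto
  then obtain A c where A: "finite A" "L2_dist F (fourier_partial c A) < \<delta>"
    using assms unfolding trig_closure_def by blast
  have e: "fourier_partial (\<lambda>n. k * c n) A = (\<lambda>\<xi>. k * fourier_partial c A \<xi>)"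
    by (simp add: fun_eq_iff fourier_partial_eq sum_distrib_left mult.assoc)
  have "L2_dist (\<lambda>\<xi>. k * F \<xi>) (fourier_partial (\<lambda>n. k * c n) A) \<le> (norm k)\<^sup>2 * L2_dist F (fourier_partial c A)"
    unfolding e by (rule L2_dist_mult_le[OF L2 torus_L2_fourier_partial]) auto
  also have "\<dots> \<le> (norm k)\<^sup>2 * \<delta>" using A by (intro mult_left_mono) auto
  also have "\<dots> < ((norm k)\<^sup>2 + 1) * \<delta>" using \<open>\<delta> > 0\<close> by simp
  also have "\<dots> = \<epsilon>"
    unfolding \<delta>_def using add_nonneg_pos[OF zero_le_power2[of "norm k"] zero_less_one] by simp
  finally show "\<exists>A c. finite A \<and> L2_dist (\<lambda>\<xi>. k * F \<xi>) (fourier_partial c A) < \<epsilon>" using A by blast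
qed

lemma fourier_coeff_bessel:
  assumes "G \<in> torus_L2" "finite A"
  shows "(\<Sum>n\<in>A. (norm (fourier_coeff G n))\<^sup>2) \<le> (\<integral>\<xi>. (norm (G \<xi>))\<^sup>2 \<partial>torus)"
  using L2_dist_partial[OF assms, of "fourier_coeff G"] L2_dist_nonneg[of G "fourier_partial (fourier_coeff G) A"]
  by simp

section \<open>Fourier series of square summable functions\<close>

lemma lp_space_2_iff: "f \<in> lp_space 2 \<longleftrightarrow> (\<lambda>n. (norm (f n))\<^sup>2) summable_on UNIV"
  by (simp add: lp_space_def)

lemma fourier_coeff_in_l2:
  assumes "G \<in> torus_L2" shows "fourier_coeff G \<in> lp_space 2"
  unfolding lp_space_2_iff
  by (rule nonneg_bounded_partial_sums_imp_summable_on[where C = "\<integral>\<xi>. (norm (G \<xi>))\<^sup>2 \<partial>torus"])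
    (auto simp: eventually_finite_subsets_at_top intro!: fourier_coeff_bessel[OF assms] exI[of _ "{}"])

text \<open>In the Pythagorean expansion only the last sum depends on \<open>c\<close>, and the Fourier coefficients make it 0.\<close>

lemma best_approximation:
  assumes "G \<in> torus_L2" "finite B" "A \<subseteq> B"
  shows "L2_dist G (fourier_partial (fourier_coeff G) B) \<le> L2_dist G (fourier_partial c A)"
proof -
  have "L2_dist G (fourier_partial (fourier_coeff G) B)
      \<le> L2_dist G (fourier_partial (\<lambda>n. if n \<in> A then c n else 0) B)"
    using assms by (simp add: L2_dist_partial sum_nonneg)
  then show ?thesis using assms by (simp add: fourier_partial_restrict)
qed

lemma trig_closure_fourier_series:
  assumes "G \<in> trig_closure"
  shows "((\<lambda>A. L2_dist G (fourier_partial (fourier_coeff G) A)) \<longlongrightarrow> 0) (finite_sets)"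
proof (rule tendstoI)
  fix \<epsilon> :: real assume "\<epsilon> > 0"
  then obtain A c where A: "finite A" "L2_dist G (fourier_partial c A) < \<epsilon>"
    using assms unfolding trig_closure_def by blast
  have G: "G \<in> torus_L2" using assms by (simp add: trig_closure_def)
  show "eventually (\<lambda>B. dist (L2_dist G (fourier_partial (fourier_coeff G) B)) 0 < \<epsilon>) (finite_sets)"
    unfolding eventually_finite_subsets_at_top
    using A best_approximation[OF G, of _ A c]
    by (intro exI[of _ A]) (auto simp: L2_dist_nonneg intro: order.strict_trans1)
qed

lemma L2_dist_partial_partial:
  assumes "finite B" "A \<subseteq> B"
  shows "L2_dist (fourier_partial f B) (fourier_partial f A) = (\<Sum>n\<in>B - A. (norm (f n))\<^sup>2)"
proof -
  have A: "finite A" using assms finite_subset by blast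
  have 1: "0 = (\<integral>\<xi>. (norm (fourier_partial f B \<xi>))\<^sup>2 \<partial>torus) - (\<Sum>n\<in>B. (norm (f n))\<^sup>2)"
    using L2_dist_partial[OF torus_L2_fourier_partial[of f B] assms(1), of f] assms
    by (simp add: fourier_coeff_partial L2_dist_def)
  have "(\<Sum>n\<in>A. (norm (fourier_coeff (fourier_partial f B) n))\<^sup>2) = (\<Sum>n\<in>A. (norm (f n))\<^sup>2)"
    "(\<Sum>n\<in>A. (norm (fourier_coeff (fourier_partial f B) n - f n))\<^sup>2) = 0"
    using assms by (auto simp: fourier_coeff_partial intro!: sum.cong sum.neutral)
  then show ?thesis
    using L2_dist_partial[OF torus_L2_fourier_partial[of f B] A, of f] 1 assms
    by (simp add: sum_diff A)
qed

text \<open>Fatou's lemma: almost everywhere limits of functions bounded in \<open>L\<^sup>2\<close>.\<close>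

lemma L2_fatou:
  assumes H: "\<And>i. H i \<in> torus_L2" and G[measurable]: "G \<in> borel_measurable torus"
    and lim: "AE \<xi> in torus. (\<lambda>i. H i \<xi>) \<longlonglongrightarrow> G \<xi>"
    and bound: "\<And>i. i \<ge> k \<Longrightarrow> (\<integral>\<xi>. (norm (H i \<xi>))\<^sup>2 \<partial>torus) \<le> C" and C: "0 \<le> C"
  shows "G \<in> torus_L2" "(\<integral>\<xi>. (norm (G \<xi>))\<^sup>2 \<partial>torus) \<le> C"
proof -
  note [measurable] = torus_L2_D(1)[OF H]
  have "(\<integral>\<^sup>+\<xi>. ennreal ((norm (G \<xi>))\<^sup>2) \<partial>torus) \<le> (\<integral>\<^sup>+\<xi>. liminf (\<lambda>i. ennreal ((norm (H (i + k) \<xi>))\<^sup>2)) \<partial>torus)"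
  proof (rule nn_integral_mono_AE)
    show "AE \<xi> in torus. ennreal ((norm (G \<xi>))\<^sup>2) \<le> liminf (\<lambda>i. ennreal ((norm (H (i + k) \<xi>))\<^sup>2))"
      using lim
    proof eventually_elim
      fix \<xi> assume "(\<lambda>i. H i \<xi>) \<longlonglongrightarrow> G \<xi>"
      then have "(\<lambda>i. H (i + k) \<xi>) \<longlonglongrightarrow> G \<xi>" by (rule LIMSEQ_ignore_initial_segment)
      then have "(\<lambda>i. ennreal ((norm (H (i + k) \<xi>))\<^sup>2)) \<longlonglongrightarrow> ennreal ((norm (G \<xi>))\<^sup>2)"
        by (intro tendsto_ennrealI tendsto_intros)
      then show "ennreal ((norm (G \<xi>))\<^sup>2) \<le> liminf (\<lambda>i. ennreal ((norm (H (i + k) \<xi>))\<^sup>2))"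
        by (simp only: lim_imp_Liminf[OF sequentially_bot] order_refl)
    qed
  qed
  also have "\<dots> \<le> liminf (\<lambda>i. \<integral>\<^sup>+\<xi>. ennreal ((norm (H (i + k) \<xi>))\<^sup>2) \<partial>torus)"
    by (rule nn_integral_liminf) measurable
  also have "\<dots> \<le> ennreal C"
  proof -
    have "(\<integral>\<^sup>+\<xi>. ennreal ((norm (H (i + k) \<xi>))\<^sup>2) \<partial>torus) \<le> ennreal C" for i
      using bound[of "i + k"] by (subst nn_integral_eq_integral[OF torus_L2_D(2)[OF H]]) (auto simp: ennreal_leI)
    then have "liminf (\<lambda>i. \<integral>\<^sup>+\<xi>. ennreal ((norm (H (i + k) \<xi>))\<^sup>2) \<partial>torus) \<le> liminf (\<lambda>i :: nat. ennreal C)"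
      by (intro Liminf_mono) auto
    then show ?thesis by (simp add: Liminf_const)
  qed
  finally have le: "(\<integral>\<^sup>+\<xi>. ennreal ((norm (G \<xi>))\<^sup>2) \<partial>torus) \<le> ennreal C" .
  have "integrable torus (\<lambda>\<xi>. (norm (G \<xi>))\<^sup>2)"
    using le by (intro integrableI_nonneg) (auto intro: order.strict_trans1 ennreal_less_top)
  then show "G \<in> torus_L2" by (simp add: torus_L2_def)
  show "(\<integral>\<xi>. (norm (G \<xi>))\<^sup>2 \<partial>torus) \<le> C" by (rule integral_real_bounded[OF C le])
qed

text \<open>Partial sums over suitable finite sets are Cauchy in \<open>L\<^sup>2\<close>, hence in \<open>L\<^sup>1\<close>, so a subsequence converges
almost everywhere; Fatou's lemma upgrades this to \<open>L\<^sup>2\<close> convergence along all finite sets.\<close>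

lemma riesz_fischer:
  assumes "f \<in> lp_space 2"
  shows "\<exists>F \<in> torus_L2. ((\<lambda>A. L2_dist F (fourier_partial f A)) \<longlongrightarrow> 0) (finite_sets)"
proof -
  define S where "S = (\<Sum>\<^sub>\<infinity>n. (norm (f n))\<^sup>2)"
  have hs: "((\<lambda>n. (norm (f n))\<^sup>2) has_sum S) UNIV"
    unfolding S_def using assms lp_space_2_iff by (intro has_sum_infsum) auto
  define \<epsilon> where "\<epsilon> = (\<lambda>k. 1 / real (Suc k))"
  have \<epsilon>: "\<epsilon> k > 0" "j \<ge> k \<Longrightarrow> \<epsilon> j \<le> \<epsilon> k" for j k by (auto simp: \<epsilon>_def divide_left_mono)
  have "\<exists>A. finite A \<and> S - \<epsilon> k < (\<Sum>n\<in>A. (norm (f n))\<^sup>2)" for k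
  proof -
    have "eventually (\<lambda>A. S - \<epsilon> k < (\<Sum>n\<in>A. (norm (f n))\<^sup>2)) (finite_sets)"
      using hs \<epsilon>(1)[of k] unfolding has_sum_def by (intro order_tendstoD(1)) auto
    then show ?thesis unfolding eventually_finite_subsets_at_top by blast
  qed
  then obtain A where A: "\<And>k. finite (A k)" "\<And>k. S - \<epsilon> k < (\<Sum>n\<in>A k. (norm (f n))\<^sup>2)"
    by metis
  have near: "L2_dist (fourier_partial f B) (fourier_partial f (A k)) \<le> \<epsilon> k" if "finite B" "A k \<subseteq> B" for B k
  proof -
    have "(\<Sum>n\<in>B. (norm (f n))\<^sup>2) \<le> S"
      using finite_sum_le_has_sum[OF hs that(1)] by auto
    then show ?thesis using A[of k] that by (simp add: L2_dist_partial_partial sum_diff)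
  qed
  have near2: "L2_dist (fourier_partial f B) (fourier_partial f (A j)) \<le> 4 * \<epsilon> k"
    if "finite B" "A k \<subseteq> B" "j \<ge> k" for B j k
  proof -
    let ?U = "fourier_partial f (B \<union> A j)"
    have "L2_dist (fourier_partial f B) (fourier_partial f (A j)) \<le> 2 * L2_dist (fourier_partial f B) ?U + 2 * L2_dist ?U (fourier_partial f (A j))"
      by (intro L2_dist_triangle torus_L2_fourier_partial)
    moreover have "L2_dist ?U (fourier_partial f (A j)) \<le> \<epsilon> k"
      using near[of "B \<union> A j" j] \<epsilon>(2)[OF that(3)] that A by simp
    moreover have "L2_dist (fourier_partial f B) ?U \<le> \<epsilon> k"
    proof -
      have "(\<Sum>n\<in>(B \<union> A j) - B. (norm (f n))\<^sup>2) \<le> (\<Sum>n\<in>(B \<union> A j) - A k. (norm (f n))\<^sup>2)"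
        using that A by (intro sum_mono2) auto
      also have "\<dots> \<le> \<epsilon> k"
        using near[of "B \<union> A j" k] that A by (simp add: L2_dist_partial_partial le_supI1)
      finally show ?thesis using that A by (subst L2_dist_commute) (simp add: L2_dist_partial_partial)
    qed
    ultimately show ?thesis by linarith
  qed
  define P where "P = (\<lambda>k. fourier_partial f (A k))"
  have P: "P k \<in> torus_L2" for k by (simp add: P_def torus_L2_fourier_partial)
  have cauchy: "\<exists>N. \<forall>i\<ge>N. \<forall>j\<ge>N. (LINT \<xi>|torus. norm (P i \<xi> - P j \<xi>)) < e" if e: "e > 0" for e
  proof -
    obtain N where "inverse (real (Suc N)) < e\<^sup>2 / 16"
      using reals_Archimedean[of "e\<^sup>2 / 16"] e by auto
    then have N: "16 * inverse (real (Suc N)) < e\<^sup>2" by simp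
    have "(LINT \<xi>|torus. norm (P i \<xi> - P j \<xi>)) < e" if "i \<ge> N" "j \<ge> N" for i j
    proof (rule power2_less_imp_less)
      have "(LINT \<xi>|torus. norm (P i \<xi> - P j \<xi>))\<^sup>2 \<le> L2_dist (P i) (P j)"
        unfolding L2_dist_def by (rule integral_norm_square_le[OF torus_L2_diff[OF P P]])
      also have "\<dots> \<le> 2 * L2_dist (P i) (fourier_partial f (A i \<union> A N)) + 2 * L2_dist (fourier_partial f (A i \<union> A N)) (P j)"
        by (intro L2_dist_triangle P torus_L2_fourier_partial)
      also have "\<dots> \<le> 2 * (4 * \<epsilon> N) + 2 * (4 * \<epsilon> N)"
        unfolding P_def using that A near2[of "A i \<union> A N" N]
        by (intro add_mono mult_left_mono) (auto simp: L2_dist_commute[of "fourier_partial f (A i)"])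
      also have "\<dots> < e\<^sup>2" using N by (simp add: \<epsilon>_def inverse_eq_divide)
      finally show "(LINT \<xi>|torus. norm (P i \<xi> - P j \<xi>))\<^sup>2 < e\<^sup>2" .
    qed (use e in simp)
    then show ?thesis by blast
  qed
  obtain r where r: "strict_mono r" "AE \<xi> in torus. Cauchy (\<lambda>i. P (r i) \<xi>)"
    using cauchy_L1_AE_cauchy_subseq[OF torus_L2_integrable[OF P] cauchy] by blast
  define F where "F = (\<lambda>\<xi>. lim (\<lambda>i. P (r i) \<xi>))"
  have [measurable]: "P k \<in> borel_measurable torus" for k using torus_L2_D(1)[OF P] .
  have Fm [measurable]: "F \<in> borel_measurable torus"
    unfolding F_def by (intro borel_measurable_lim_metric) measurable
  have lim: "AE \<xi> in torus. (\<lambda>i. P (r i) \<xi>) \<longlonglongrightarrow> F \<xi>"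
    using r(2) unfolding F_def by eventually_elim (rule convergent_LIMSEQ_iff[THEN iffD1, OF Cauchy_convergent])
  have rk: "r i \<ge> i" for i using r(1) by (rule seq_suble)
  have close: "(\<lambda>\<xi>. F \<xi> - fourier_partial f B \<xi>) \<in> torus_L2" "L2_dist F (fourier_partial f B) \<le> 4 * \<epsilon> k"
    if B: "finite B" "A k \<subseteq> B" for B k
  proof -
    have 1: "(\<lambda>\<xi>. P (r i) \<xi> - fourier_partial f B \<xi>) \<in> torus_L2" for i
      by (intro torus_L2_diff P torus_L2_fourier_partial)
    have 2: "(\<lambda>\<xi>. F \<xi> - fourier_partial f B \<xi>) \<in> borel_measurable torus" by measurable
    have 3: "AE \<xi> in torus. (\<lambda>i. P (r i) \<xi> - fourier_partial f B \<xi>) \<longlonglongrightarrow> F \<xi> - fourier_partial f B \<xi>"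
      using lim by eventually_elim (intro tendsto_intros)
    have 4: "(\<integral>\<xi>. (norm (P (r i) \<xi> - fourier_partial f B \<xi>))\<^sup>2 \<partial>torus) \<le> 4 * \<epsilon> k" if "i \<ge> k" for i
      using near2[OF B, of "r i"] that rk[of i] unfolding P_def
      by (simp add: L2_dist_def norm_minus_commute)
    have 5: "0 \<le> 4 * \<epsilon> k" using \<epsilon>(1)[of k] by simp
    show "(\<lambda>\<xi>. F \<xi> - fourier_partial f B \<xi>) \<in> torus_L2" "L2_dist F (fourier_partial f B) \<le> 4 * \<epsilon> k"
      unfolding L2_dist_def using L2_fatou[OF 1 2 3 4 5] by auto
  qed
  have F: "F \<in> torus_L2"
    using torus_L2_add[OF close(1)[OF A(1) order_refl, of 0] torus_L2_fourier_partial[of f "A 0"]] by simp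
  moreover have "((\<lambda>A. L2_dist F (fourier_partial f A)) \<longlongrightarrow> 0) (finite_sets)"
  proof (rule tendstoI)
    fix e :: real assume e: "e > 0"
    obtain k where "inverse (real (Suc k)) < e / 4"
      using reals_Archimedean[of "e / 4"] e by auto
    then have "4 * \<epsilon> k < e" by (simp add: \<epsilon>_def inverse_eq_divide)
    then show "eventually (\<lambda>B. dist (L2_dist F (fourier_partial f B)) 0 < e) (finite_sets)"
      unfolding eventually_finite_subsets_at_top
      using A close(2)[of _ k]
      by (intro exI[of _ "A k"]) (auto simp: L2_dist_nonneg intro: order.strict_trans1)
  qed
  ultimately show ?thesis by blast
qed

lemma fourier_transform_spec:
  assumes "f \<in> lp_space 2"
  shows "fourier_transform f \<in> torus_L2"
    "((\<lambda>A. L2_dist (fourier_transform f) (fourier_partial f A)) \<longlongrightarrow> 0) (finite_sets)"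
proof -
  have "\<exists>F. F \<in> torus_L2 \<and> ((\<lambda>A. \<integral>\<xi>. (norm (F \<xi> - fourier_partial f A \<xi>))\<^sup>2 \<partial>torus) \<longlongrightarrow> 0)
       (finite_sets)"
    using riesz_fischer[OF assms] unfolding L2_dist_def by blast
  from someI_ex[OF this] show "fourier_transform f \<in> torus_L2"
    "((\<lambda>A. L2_dist (fourier_transform f) (fourier_partial f A)) \<longlongrightarrow> 0) (finite_sets)"
    unfolding fourier_transform_def L2_dist_def by auto
qed

lemma fourier_transform_fourier_coeff:
  assumes "G \<in> trig_closure"
  shows "AE \<xi> in torus. fourier_transform (fourier_coeff G) \<xi> = G \<xi>"
proof -
  have G: "G \<in> torus_L2" using assms by (simp add: trig_closure_def)
  note s = fourier_transform_spec[OF fourier_coeff_in_l2[OF G]]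
  show ?thesis
    by (rule L2_limit_unique[OF s(1) G torus_L2_fourier_partial finite_subsets_at_top_neq_bot s(2)
          trig_closure_fourier_series[OF assms]])
qed

text \<open>Pairing with a bounded function is continuous in \<open>L\<^sup>2\<close>.\<close>

lemma integral_mult_tendsto:
  assumes "F \<in> torus_L2" "\<And>i. H i \<in> torus_L2" "((\<lambda>i. L2_dist F (H i)) \<longlongrightarrow> 0) \<X>"
    and "m \<in> borel_measurable torus" "\<And>\<xi>. norm (m \<xi>) \<le> C"
  shows "((\<lambda>i. \<integral>\<xi>. H i \<xi> * m \<xi> \<partial>torus) \<longlongrightarrow> (\<integral>\<xi>. F \<xi> * m \<xi> \<partial>torus)) \<X>"
proof (rule LIM_zero_cancel)
  have "((\<lambda>i. C * sqrt (L2_dist F (H i))) \<longlongrightarrow> C * sqrt 0) \<X>"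
    by (intro tendsto_intros assms)
  then have "((\<lambda>i. C * sqrt (L2_dist F (H i))) \<longlongrightarrow> 0) \<X>" by simp
  then show "((\<lambda>i. (\<integral>\<xi>. H i \<xi> * m \<xi> \<partial>torus) - (\<integral>\<xi>. F \<xi> * m \<xi> \<partial>torus)) \<longlongrightarrow> 0) \<X>"
  proof (rule Lim_null_comparison[rotated], intro always_eventually allI)
    show "norm ((\<integral>\<xi>. H i \<xi> * m \<xi> \<partial>torus) - (\<integral>\<xi>. F \<xi> * m \<xi> \<partial>torus)) \<le> C * sqrt (L2_dist F (H i))" for i
      by (subst norm_minus_commute) (rule norm_integral_diff_le[OF assms(1,2,4,5)])
  qed
qed

lemma fourier_coeff_fourier_transform:
  assumes "f \<in> lp_space 2" shows "fourier_coeff (fourier_transform f) = f"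
proof
  fix n
  note s = fourier_transform_spec[OF assms]
  have "((\<lambda>A. fourier_coeff (fourier_partial f A) n) \<longlongrightarrow> fourier_coeff (fourier_transform f) n) (finite_sets)"
    unfolding fourier_coeff_def
    by (rule integral_mult_tendsto[OF s(1) torus_L2_fourier_partial s(2), of _ 1]) auto
  moreover have "((\<lambda>A. fourier_coeff (fourier_partial f A) n) \<longlongrightarrow> f n) (finite_sets)"
    by (rule tendsto_eventually) (auto simp: eventually_finite_subsets_at_top fourier_coeff_partial intro!: exI[of _ "{n}"])
  ultimately show "fourier_coeff (fourier_transform f) n = f n"
    by (rule tendsto_unique[OF finite_subsets_at_top_neq_bot])
qed

text \<open>The Fourier transform of a summable function, which is given by an absolutely convergent series.\<close>

definition hat :: "(int ^ 'd::finite \<Rightarrow> real) \<Rightarrow> real ^ 'd \<Rightarrow> complex" where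
  "hat u \<xi> = (\<Sum>\<^sub>\<infinity>n. of_real (u n) * character n \<xi>)"

section \<open>Fourier transforms of summable functions\<close>

lemma infsum_complex_of_real: "(\<Sum>\<^sub>\<infinity>x\<in>A. complex_of_real (f x)) = of_real (\<Sum>\<^sub>\<infinity>x\<in>A. f x)"
proof (cases "f summable_on A")
  case True
  then show ?thesis by (intro infsumI has_sum_of_real has_sum_infsum)
next
  case False
  then have "\<not> (\<lambda>x. complex_of_real (f x)) summable_on A"
    using summable_on_Re[of "\<lambda>x. complex_of_real (f x)" A] by auto
  with False show ?thesis by (simp add: infsum_not_exists)
qed

lemma summable_on_abs_real: "u summable_on UNIV \<Longrightarrow> (\<lambda>n. \<bar>u n\<bar>) summable_on UNIV"
  for u :: "'a \<Rightarrow> real"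
  using summable_on_iff_abs_summable_on_real[of u UNIV] by simp

lemma has_sum_hat:
  assumes "u summable_on UNIV"
  shows "((\<lambda>n. of_real (u n) * character n \<xi>) has_sum hat u \<xi>) UNIV"
proof -
  have "(\<lambda>n. norm (of_real (u n) * character n \<xi>)) summable_on UNIV"
    using summable_on_abs_real[OF assms] by (simp add: norm_mult)
  then show ?thesis unfolding hat_def by (rule has_sum_infsum[OF abs_summable_summable])
qed

lemma norm_hat_le:
  assumes "u summable_on UNIV" shows "norm (hat u \<xi>) \<le> (\<Sum>\<^sub>\<infinity>n. \<bar>u n\<bar>)"
proof -
  have "(\<lambda>n. norm (of_real (u n) * character n \<xi>)) summable_on UNIV"
    using summable_on_abs_real[OF assms] by (simp add: norm_mult)
  from norm_infsum_bound[OF this] show ?thesis unfolding hat_def by (simp add: norm_mult)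
qed

lemma uniform_limit_hat:
  assumes "u summable_on UNIV"
  shows "uniform_limit UNIV (fourier_partial (\<lambda>n. of_real (u n))) (hat u) (finite_sets)"
  unfolding fourier_partial_eq[abs_def] hat_def[abs_def]
  by (rule Weierstrass_m_test_general[where M = "\<lambda>n. \<bar>u n\<bar>"])
    (auto simp: norm_mult summable_on_abs_real[OF assms])

lemma measurable_hat [measurable]:
  assumes "u summable_on UNIV" shows "hat u \<in> borel_measurable torus"
proof (intro borel_measurable_torusI borel_measurable_continuous_onI)
  show "continuous_on UNIV (hat u)"
  proof (rule uniform_limit_theorem[OF _ uniform_limit_hat[OF assms] finite_subsets_at_top_neq_bot])
    show "eventually (\<lambda>A. continuous_on UNIV (fourier_partial (\<lambda>n. of_real (u n)) A)) (finite_sets)"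
      unfolding fourier_partial_eq[abs_def]
      by (intro always_eventually allI continuous_intros continuous_character)
  qed
qed

lemma torus_L2_hat: "u summable_on UNIV \<Longrightarrow> hat u \<in> torus_L2"
  by (rule torus_L2_bounded[OF measurable_hat norm_hat_le])

lemma L2_dist_hat_tendsto:
  assumes "u summable_on UNIV"
  shows "((\<lambda>A. L2_dist (hat u) (fourier_partial (\<lambda>n. of_real (u n)) A)) \<longlongrightarrow> 0) (finite_sets)"
proof (rule tendstoI)
  fix \<epsilon> :: real assume \<epsilon>: "\<epsilon> > 0"
  define \<delta> where "\<delta> = sqrt (\<epsilon> / 2)"
  have \<delta>: "\<delta> > 0" "\<delta>\<^sup>2 = \<epsilon> / 2" using \<epsilon> by (auto simp: \<delta>_def)
  show "eventually (\<lambda>A. dist (L2_dist (hat u) (fourier_partial (\<lambda>n. of_real (u n)) A)) 0 < \<epsilon>) (finite_sets)"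
    using uniform_limitD[OF uniform_limit_hat[OF assms] \<delta>(1)]
  proof eventually_elim
    fix A assume A: "\<forall>\<xi>\<in>UNIV. dist (fourier_partial (\<lambda>n. of_real (u n)) A \<xi>) (hat u \<xi>) < \<delta>"
    have "L2_dist (hat u) (fourier_partial (\<lambda>n. of_real (u n)) A) \<le> (\<integral>\<xi>. \<delta>\<^sup>2 \<partial>(torus :: (real ^ 'a) measure))"
      unfolding L2_dist_def
    proof (rule integral_mono)
      show "(norm (hat u \<xi> - fourier_partial (\<lambda>n. of_real (u n)) A \<xi>))\<^sup>2 \<le> \<delta>\<^sup>2" for \<xi>
        using A by (intro power_mono) (auto simp: dist_norm norm_minus_commute intro: less_imp_le)
    qed (auto intro!: integrable_torus_bounded[where C = "\<delta>\<^sup>2"]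
          torus_L2_D(2)[OF torus_L2_diff[OF torus_L2_hat[OF assms] torus_L2_fourier_partial]])
    also have "\<dots> < \<epsilon>" using \<delta> \<epsilon> by (simp add: measure_torus)
    finally show "dist (L2_dist (hat u) (fourier_partial (\<lambda>n. of_real (u n)) A)) 0 < \<epsilon>"
      by (simp add: L2_dist_nonneg)
  qed
qed

lemma integral_fourier_partial_mult:
  assumes "m \<in> borel_measurable torus" "\<And>\<xi>. norm (m \<xi>) \<le> C"
  shows "(\<integral>\<xi>. fourier_partial c A \<xi> * m \<xi> \<partial>torus) = (\<Sum>n\<in>A. c n * (\<integral>\<xi>. character n \<xi> * m \<xi> \<partial>torus))"
proof -
  have "integrable torus (\<lambda>\<xi>. character n \<xi> * m \<xi>)" for n
    by (rule torus_L2_mult_integrable[OF torus_L2_bounded[of _ 1] assms]) auto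
  then show ?thesis
    unfolding fourier_partial_eq by (simp add: sum_distrib_right mult.assoc)
qed

lemma integral_hat_mult:
  assumes u: "u summable_on UNIV" and m: "m \<in> borel_measurable torus" "\<And>\<xi>. norm (m \<xi>) \<le> C"
  shows "((\<lambda>n. of_real (u n) * (\<integral>\<xi>. character n \<xi> * m \<xi> \<partial>torus)) has_sum (\<integral>\<xi>. hat u \<xi> * m \<xi> \<partial>torus)) UNIV"
  unfolding has_sum_def
  using integral_mult_tendsto[OF torus_L2_hat[OF u] torus_L2_fourier_partial L2_dist_hat_tendsto[OF u] m]
  unfolding integral_fourier_partial_mult[OF m] .

lemma fourier_coeff_hat:
  assumes u: "u summable_on UNIV" shows "fourier_coeff (hat u) n = of_real (u n)"
proof -
  have "((\<lambda>k. of_real (u k) * (if k = n then 1 else 0 :: complex)) has_sum fourier_coeff (hat u) n) UNIV"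
    using integral_hat_mult[OF u, of "\<lambda>\<xi>. cnj (character n \<xi>)" 1]
    unfolding integral_character_orthonormal fourier_coeff_def by simp
  moreover have "((\<lambda>k. of_real (u k) * (if k = n then 1 else 0 :: complex)) has_sum of_real (u n)) UNIV"
    by (rule has_sum_finite_neutralI[where B = "{n}"]) auto
  ultimately show ?thesis by (rule has_sum_unique)
qed

lemma hat_in_trig_closure: "u summable_on UNIV \<Longrightarrow> hat u \<in> trig_closure"
  by (rule trig_closure_limit[OF torus_L2_hat fourier_partial_in_trig_closure
        finite_subsets_at_top_neq_bot L2_dist_hat_tendsto])

lemma hat_inject:
  assumes "u summable_on UNIV" "v summable_on UNIV" "\<And>\<xi>. hat u \<xi> = hat v \<xi>"
  shows "u = v"
proof
  fix n
  have "hat u = hat v" using assms(3) by auto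
  then show "u n = v n" using fourier_coeff_hat[OF assms(1), of n] fourier_coeff_hat[OF assms(2), of n] by simp
qed

lemma parseval_l1:
  assumes u: "u summable_on UNIV" and v: "v summable_on UNIV"
  shows "((\<lambda>n. of_real (u n * v n)) has_sum (\<integral>\<xi>. hat u \<xi> * cnj (hat v \<xi>) \<partial>torus)) UNIV"
proof -
  have m: "(\<lambda>\<xi>. cnj (hat v \<xi>)) \<in> borel_measurable torus" "\<And>\<xi>. norm (cnj (hat v \<xi>)) \<le> (\<Sum>\<^sub>\<infinity>n. \<bar>v n\<bar>)"
    using measurable_hat[OF v] norm_hat_le[OF v] by (auto intro: measurable_cnj)
  have "(\<integral>\<xi>. character n \<xi> * cnj (hat v \<xi>) \<partial>torus) = cnj (fourier_coeff (hat v) n)" for n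
    unfolding fourier_coeff_def by (subst Bochner_Integration.integral_cnj[symmetric]) (simp add: mult.commute)
  then show ?thesis
    using integral_hat_mult[OF u m] by (simp add: fourier_coeff_hat[OF v])
qed

lemma hat_linear:
  assumes "u summable_on UNIV" "v summable_on UNIV"
  shows "hat (\<lambda>n. a * u n + b * v n) \<xi> = of_real a * hat u \<xi> + of_real b * hat v \<xi>"
proof -
  have "((\<lambda>n. of_real a * (of_real (u n) * character n \<xi>) + of_real b * (of_real (v n) * character n \<xi>))
      has_sum (of_real a * hat u \<xi> + of_real b * hat v \<xi>)) UNIV"
    by (intro has_sum_add has_sum_cmult_right has_sum_hat assms)
  then show ?thesis unfolding hat_def by (intro infsumI) (simp add: algebra_simps)
qed

lemma has_sum_hat_shift:
  assumes "u summable_on UNIV"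
  shows "((\<lambda>n. of_real (u (n + y)) * character n \<xi>) has_sum (cnj (character y \<xi>) * hat u \<xi>)) UNIV"
proof -
  have "((\<lambda>n. of_real (u (n + y)) * character (n + y) \<xi>) has_sum hat u \<xi>) UNIV"
    using has_sum_shift[OF has_sum_hat[OF assms]] .
  then have "((\<lambda>n. cnj (character y \<xi>) * (of_real (u (n + y)) * character (n + y) \<xi>)) has_sum (cnj (character y \<xi>) * hat u \<xi>)) UNIV"
    by (rule has_sum_cmult_right)
  moreover have "cnj (character y \<xi>) * character (n + y) \<xi> = character n \<xi>" for n
    by (simp add: cnj_character flip: character_add)
  then have "cnj (character y \<xi>) * (of_real (u (n + y)) * character (n + y) \<xi>) = of_real (u (n + y)) * character n \<xi>" for n
    by (simp add: mult.left_commute)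
  ultimately show ?thesis by simp
qed

lemma summable_shift: "u summable_on UNIV \<Longrightarrow> (\<lambda>x. u (x + y)) summable_on UNIV" for u :: "int ^ 'd::finite \<Rightarrow> real"
  using has_sum_shift[OF has_sum_infsum] has_sum_imp_summable by blast

section \<open>Symbols of the walk and of the Poisson operator\<close>

definition walk_symbol :: "real ^ 'd::finite \<Rightarrow> real" where
  "walk_symbol \<xi> = 1 - (\<Sum>i\<in>UNIV. (sin (pi * \<xi> $ i))\<^sup>2) / real CARD('d)"

lemma walk_symbol_bounds: "0 \<le> walk_symbol \<xi>" "walk_symbol \<xi> \<le> 1" for \<xi> :: "real ^ 'd::finite"
proof -
  have "(\<Sum>i\<in>UNIV. (sin (pi * \<xi> $ i))\<^sup>2) \<le> (\<Sum>i\<in>(UNIV :: 'd set). 1)"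
    by (intro sum_mono) (simp add: abs_square_le_1)
  then show "0 \<le> walk_symbol \<xi>" by (simp add: walk_symbol_def)
  show "walk_symbol \<xi> \<le> 1" by (simp add: walk_symbol_def sum_nonneg)
qed

text \<open>Opposite steps combine to \<open>2 cos(2\<pi>\<xi>\<^sub>i) = 2 - 4 sin\<^sup>2(\<pi>\<xi>\<^sub>i)\<close>.\<close>

lemma sum_step_prob_character:
  "(\<Sum>z\<in>UNIV. of_real (step_prob z) * cnj (character (step z) \<xi>)) = complex_of_real (walk_symbol \<xi>)"
  for \<xi> :: "real ^ 'd::finite"
proof -
  define r where "r = real CARD('d)"
  have r: "r > 0" by (simp add: r_def)
  have UN: "UNIV = insert None (range (Some :: 'd \<times> bool \<Rightarrow> _))" by (rule UNIV_option_conv)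
  have cis2: "cis t + cis (- t) = 2 * of_real (cos t)" for t by (simp add: complex_eq_iff)
  have c2: "cos (2 * pi * \<xi> $ i) = 1 - 2 * (sin (pi * \<xi> $ i))\<^sup>2" for i
    using cos_double_sin[of "pi * \<xi> $ i"] by (simp add: mult.assoc)
  have "(\<Sum>z\<in>UNIV. of_real (step_prob z) * cnj (character (step z) \<xi>))
      = 1/2 + (\<Sum>z\<in>UNIV. of_real (1 / (4 * r)) * cnj (character (step (Some (z :: 'd \<times> bool))) \<xi>))"
    unfolding UN by (subst sum.insert) (auto simp: sum.reindex step_prob_def r_def)
  also have "(\<Sum>z\<in>UNIV. of_real (1 / (4 * r)) * cnj (character (step (Some (z :: 'd \<times> bool))) \<xi>))
     = (\<Sum>i\<in>UNIV. \<Sum>b\<in>UNIV. of_real (1 / (4 * r)) * cnj (character (step (Some (i :: 'd, b))) \<xi>))"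
    by (subst sum.cartesian_product) (auto intro!: sum.cong)
  also have "\<dots> = (\<Sum>i\<in>UNIV. of_real (1 / (4 * r)) * (cis (2 * pi * \<xi> $ i) + cis (- (2 * pi * \<xi> $ i))))"
    by (intro sum.cong refl) (simp add: UNIV_bool cnj_character[of "axis _ _"] character_axis
        cis_cnj distrib_left cnj_character[of "- axis _ _", unfolded minus_minus] flip: cnj_character)
  also have "\<dots> = of_real (\<Sum>i\<in>UNIV. 1 / (4 * r) * (2 * (1 - 2 * (sin (pi * \<xi> $ i))\<^sup>2)))"
    unfolding cis2 c2 by simp
  also have "(\<Sum>i\<in>UNIV. 1 / (4 * r) * (2 * (1 - 2 * (sin (pi * \<xi> $ i))\<^sup>2)))
     = 1/2 - (\<Sum>i\<in>UNIV. (sin (pi * \<xi> $ i))\<^sup>2) / r"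
    using r by (simp add: sum_subtractf right_diff_distrib sum_distrib_left[symmetric] sum_divide_distrib[symmetric])
      (simp add: r_def)
  finally show ?thesis by (simp add: walk_symbol_def r_def)
qed

lemma hat_walk:
  fixes u :: "int ^ 'd::finite \<Rightarrow> real"
  assumes "u summable_on UNIV" shows "hat (walk u) \<xi> = of_real (walk_symbol \<xi>) * hat u \<xi>"
proof -
  have "((\<lambda>n. \<Sum>z\<in>UNIV. of_real (step_prob z) * (of_real (u (n + step z)) * character n \<xi>))
     has_sum (\<Sum>z\<in>UNIV. of_real (step_prob (z :: ('d \<times> bool) option)) * (cnj (character (step z) \<xi>) * hat u \<xi>))) UNIV"
    by (intro has_sum_sum_index has_sum_cmult_right has_sum_hat_shift assms) auto
  then have "hat (walk u) \<xi> = (\<Sum>z\<in>UNIV. of_real (step_prob (z :: ('d \<times> bool) option)) * (cnj (character (step z) \<xi>) * hat u \<xi>))"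
    unfolding hat_def walk_def[abs_def] by (intro infsumI) (simp add: sum_distrib_right mult.assoc)
  also have "\<dots> = of_real (walk_symbol \<xi>) * hat u \<xi>"
    unfolding sum_step_prob_character[symmetric] by (simp add: sum_distrib_right mult.assoc)
  finally show ?thesis .
qed

lemma summable_walk: "u summable_on UNIV \<Longrightarrow> walk u summable_on UNIV"
  using has_sum_walk[OF has_sum_infsum] has_sum_imp_summable by blast

lemma summable_walk_funpow: "u summable_on UNIV \<Longrightarrow> (walk ^^ k) u summable_on UNIV"
  by (induction k) (simp_all add: summable_walk)

lemma hat_walk_funpow:
  "u summable_on UNIV \<Longrightarrow> hat ((walk ^^ k) u) \<xi> = of_real (walk_symbol \<xi> ^ k) * hat u \<xi>"
  by (induction k) (simp_all add: hat_walk summable_walk_funpow)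

lemma infsum_abs_walk_funpow_le:
  assumes "u summable_on UNIV" shows "(\<Sum>\<^sub>\<infinity>x. \<bar>(walk ^^ k) u x\<bar>) \<le> (\<Sum>\<^sub>\<infinity>x. \<bar>u x\<bar>)"
proof -
  have "\<bar>(walk ^^ k) u x\<bar> \<le> (walk ^^ k) (\<lambda>x. \<bar>u x\<bar>) x" for x
    using walk_funpow_mono[of u "\<lambda>x. \<bar>u x\<bar>" k x] walk_funpow_mono[of "\<lambda>x. - 1 * u x + 0 * u x" "\<lambda>x. \<bar>u x\<bar>" k x]
    unfolding walk_funpow_linear by (simp add: abs_le_iff)
  moreover have "((walk ^^ k) (\<lambda>x. \<bar>u x\<bar>) has_sum (\<Sum>\<^sub>\<infinity>x. \<bar>u x\<bar>)) UNIV"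
  proof (induction k)
    case 0 show ?case using has_sum_infsum[OF summable_on_abs_real[OF assms]] by simp
  next
    case (Suc k) then show ?case using has_sum_walk by simp
  qed
  ultimately show ?thesis
    by (intro has_sum_mono[OF has_sum_infsum[OF summable_on_abs_real[OF summable_walk_funpow[OF assms]]]])
qed

lemma summable_on_imp_bounded:
  fixes u :: "'a \<Rightarrow> real"
  assumes "u summable_on UNIV" shows "\<bar>u x\<bar> \<le> (\<Sum>\<^sub>\<infinity>x. \<bar>u x\<bar>)"
  using finite_sum_le_infsum[OF summable_on_abs_real[OF assms], of "{x}"] by simp

text \<open>Fubini for the double series over powers of the walk and lattice points; it converges absolutely because
the walk is a contraction on summable functions.\<close>

lemma poisson_fourier:
  assumes u: "u summable_on UNIV"
  shows "poisson u summable_on UNIV"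
    and "hat (poisson u) \<xi> = of_real (poisson_symbol (walk_symbol \<xi>)) * hat u \<xi>"
proof -
  define W where "W = (\<Sum>\<^sub>\<infinity>x. \<bar>u x\<bar>)"
  define g where "g = (\<lambda>k x. sqrt_coeff k * (walk ^^ k) u x)"
  have gs: "g k summable_on UNIV" for k unfolding g_def by (intro summable_on_cmult_right summable_walk_funpow u)
  have g1: "(\<Sum>\<^sub>\<infinity>x. \<bar>g k x\<bar>) \<le> sqrt_coeff k * W" for k
    using infsum_abs_walk_funpow_le[OF u, of k] sqrt_coeff_nonneg[of k]
    by (simp add: g_def abs_mult infsum_cmult_right' W_def mult_left_mono)
  have W0: "0 \<le> W" unfolding W_def by (intro infsum_nonneg) auto
  have bs: "(\<lambda>k. sqrt_coeff k * W) summable_on UNIV"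
    using summable_sqrt_coeff W0
    by (intro summable_on_cmult_left) (simp add: summable_on_UNIV_nonneg_real_iff sqrt_coeff_nonneg)
  have "(\<lambda>(k, x). norm (g k x)) summable_on UNIV \<times> UNIV"
  proof (rule summable_on_SigmaI)
    show "((\<lambda>x. case (k, x) of (k, x) \<Rightarrow> norm (g k x)) has_sum (\<Sum>\<^sub>\<infinity>x. \<bar>g k x\<bar>)) UNIV" for k
      using has_sum_infsum[OF summable_on_abs_real[OF gs[of k]]] by simp
    show "(\<lambda>k. \<Sum>\<^sub>\<infinity>x. \<bar>g k x\<bar>) summable_on UNIV"
      by (rule summable_on_comparison_test[OF bs g1]) (auto intro: infsum_nonneg)
  qed auto
  then have abs: "(\<lambda>(x, k). norm (g k x)) summable_on UNIV \<times> UNIV"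
    by (subst summable_on_swap) simp
  have P: "poisson u x = (\<Sum>\<^sub>\<infinity>k. g k x)" for x
  proof -
    have "norm (g k x) \<le> W * sqrt_coeff k" for k
      using mult_left_mono[OF walk_funpow_bound[of u W k x] sqrt_coeff_nonneg[of k]] summable_on_imp_bounded[OF u]
      by (simp add: g_def abs_mult W_def sqrt_coeff_nonneg mult.commute)
    then have "summable (\<lambda>k. norm (g k x))"
      by (intro summable_comparison_test'[OF summable_mult[OF summable_sqrt_coeff, of W], of 0]) auto
    moreover from this have "(\<lambda>k. g k x) sums (\<Sum>k. g k x)"
      by (rule summable_sums[OF summable_norm_cancel])
    then have "(\<lambda>k. g k x) sums poisson u x" by (simp add: poisson_def g_def)
    ultimately show ?thesis by (intro infsumI[symmetric] norm_summable_imp_has_sum)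
  qed
  have "(\<lambda>(x, k). g k x) summable_on UNIV \<times> UNIV"
    by (rule abs_summable_summable) (use abs in \<open>simp add: case_prod_unfold\<close>)
  from summable_on_Sigma_banach[OF this] show "poisson u summable_on UNIV"
    by (simp add: P[abs_def])
  have sw: "(\<lambda>(x, k). of_real (g k x) * character x \<xi>) summable_on UNIV \<times> UNIV"
    by (rule abs_summable_summable) (use abs in \<open>simp add: case_prod_unfold norm_mult\<close>)
  have "hat (poisson u) \<xi> = (\<Sum>\<^sub>\<infinity>x. \<Sum>\<^sub>\<infinity>k. of_real (g k x) * character x \<xi>)"
    unfolding hat_def P by (simp add: infsum_cmult_left' flip: infsum_complex_of_real)
  also have "\<dots> = (\<Sum>\<^sub>\<infinity>k. \<Sum>\<^sub>\<infinity>x. of_real (g k x) * character x \<xi>)"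
    by (rule infsum_swap_banach[OF sw])
  also have "\<dots> = (\<Sum>\<^sub>\<infinity>k. of_real (sqrt_coeff k * walk_symbol \<xi> ^ k) * hat u \<xi>)"
  proof (rule infsum_cong)
    fix k
    have "(\<Sum>\<^sub>\<infinity>x. of_real (g k x) * character x \<xi>) = of_real (sqrt_coeff k) * hat ((walk ^^ k) u) \<xi>"
      unfolding hat_def g_def by (simp add: mult.assoc infsum_cmult_right')
    then show "(\<Sum>\<^sub>\<infinity>x. of_real (g k x) * character x \<xi>) = of_real (sqrt_coeff k * walk_symbol \<xi> ^ k) * hat u \<xi>"
      using hat_walk_funpow[OF u] by simp
  qed
  also have "\<dots> = of_real (\<Sum>\<^sub>\<infinity>k. sqrt_coeff k * walk_symbol \<xi> ^ k) * hat u \<xi>"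
    by (simp only: infsum_cmult_left' infsum_complex_of_real)
  also have "(\<Sum>\<^sub>\<infinity>k. sqrt_coeff k * walk_symbol \<xi> ^ k) = poisson_symbol (walk_symbol \<xi>)"
    unfolding poisson_symbol_def using summable_poisson_symbol[OF walk_symbol_bounds, of \<xi>]
    by (intro infsumI norm_summable_imp_has_sum summable_sums)
      (auto simp: abs_mult sqrt_coeff_nonneg walk_symbol_bounds)
  finally show "hat (poisson u) \<xi> = of_real (poisson_symbol (walk_symbol \<xi>)) * hat u \<xi>" .
qed

lemma summable_poisson_funpow: "u summable_on UNIV \<Longrightarrow> (poisson ^^ k) u summable_on UNIV"
  by (induction k) (simp_all add: poisson_fourier)

lemma hat_poisson_funpow:
  "u summable_on UNIV \<Longrightarrow> hat ((poisson ^^ k) u) \<xi> = of_real (poisson_symbol (walk_symbol \<xi>) ^ k) * hat u \<xi>"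
  by (induction k) (simp_all add: poisson_fourier summable_poisson_funpow)

text \<open>The operator identity \<open>Q\<^sup>2 = 2Q - S\<close> is read off from the symbols.\<close>

lemma poisson_poisson:
  fixes u :: "int ^ 'd::finite \<Rightarrow> real"
  assumes u: "u summable_on UNIV" shows "poisson (poisson u) x = 2 * poisson u x - walk u x"
proof -
  have "poisson (poisson u) = (\<lambda>x. 2 * poisson u x + (- 1) * walk u x)"
  proof (rule hat_inject)
    show "poisson (poisson u) summable_on UNIV" by (intro poisson_fourier u)
    show "(\<lambda>x. 2 * poisson u x + (- 1) * walk u x) summable_on UNIV"
      by (intro summable_on_add summable_on_cmult_right poisson_fourier summable_walk u)
    fix \<xi> :: "real ^ 'd"
    define q where "q = poisson_symbol (walk_symbol \<xi>)"
    have "q * q = 2 * q - walk_symbol \<xi>"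
      unfolding q_def by (rule poisson_symbol_square[OF walk_symbol_bounds])
    then have "of_real q * (of_real q * hat u \<xi>) = of_real (2 * q - walk_symbol \<xi>) * hat u \<xi>"
      by (simp only: mult.assoc[symmetric] of_real_mult[symmetric])
    then show "hat (poisson (poisson u)) \<xi> = hat (\<lambda>x. 2 * poisson u x + (- 1) * walk u x) \<xi>"
      by (subst hat_linear) (simp_all add: poisson_fourier u summable_walk hat_walk q_def algebra_simps)
  qed
  then show ?thesis by (simp add: fun_eq_iff)
qed

lemma harmonic_poisson_funpow:
  assumes "u summable_on UNIV" shows "harmonic (\<lambda>k. (poisson ^^ k) u)"
  unfolding harmonic_def using poisson_poisson[OF summable_poisson_funpow[OF assms]] by simp

text \<open>The total mass is the value of the Fourier transform at 0, where the symbol is 1.\<close>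

lemma infsum_poisson:
  fixes u :: "int ^ 'd::finite \<Rightarrow> real"
  assumes u: "u summable_on UNIV" shows "(poisson u has_sum (\<Sum>\<^sub>\<infinity>x. u x)) UNIV"
proof -
  have h0: "hat v 0 = of_real (\<Sum>\<^sub>\<infinity>x. v x)" for v :: "int ^ 'd \<Rightarrow> real"
    by (simp add: hat_def character_def infsum_complex_of_real)
  have "walk_symbol (0 :: real ^ 'd) = 1" by (simp add: walk_symbol_def)
  then have "hat (poisson u) 0 = hat u 0"
    using poisson_fourier(2)[OF u, of 0] by (simp add: poisson_symbol_def suminf_sqrt_coeff)
  then have "(\<Sum>\<^sub>\<infinity>x. poisson u x) = (\<Sum>\<^sub>\<infinity>x. u x)" unfolding h0 by simp
  then show ?thesis using has_sum_infsum[OF poisson_fourier(1)[OF u]] by simp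
qed

section \<open>The bilinear energy estimate\<close>

abbreviation power_sum :: "real \<Rightarrow> ('a \<Rightarrow> real) \<Rightarrow> real" where
  "power_sum r f \<equiv> (\<Sum>\<^sub>\<infinity>x. f x powr r)"

definition energy :: "(int ^ 'd::finite \<Rightarrow> real) \<Rightarrow> (int ^ 'd \<Rightarrow> real) \<Rightarrow> nat
    \<Rightarrow> ('d \<times> bool) option option \<Rightarrow> ('d \<times> bool) option option \<Rightarrow> int ^ 'd \<Rightarrow> real" where
  "energy f h k i l x = \<bar>increment (\<lambda>k. (poisson ^^ k) f) k x i\<bar> * \<bar>increment (\<lambda>k. (poisson ^^ k) h) k x l\<bar>"

lemma has_sum_poisson_funpow:
  "u summable_on UNIV \<Longrightarrow> ((poisson ^^ k) u has_sum (\<Sum>\<^sub>\<infinity>x. u x)) UNIV"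
proof (induction k)
  case (Suc k)
  then show ?case
    using infsum_poisson[OF summable_poisson_funpow[OF Suc.prems, of k]] infsumI[OF Suc.IH] by simp
qed (simp add: has_sum_infsum)

lemma poisson_funpow_nonneg:
  assumes "u summable_on UNIV" "\<And>x. 0 \<le> u x" shows "0 \<le> (poisson ^^ k) u x"
proof (induction k arbitrary: x)
  case (Suc k)
  show ?case
    using poisson_nonneg[OF summable_on_imp_bounded[OF summable_poisson_funpow[OF assms(1)]] Suc] by simp
qed (use assms in simp)

lemma poisson_funpow_linear:
  assumes "u summable_on UNIV" "v summable_on UNIV"
  shows "(poisson ^^ k) (\<lambda>x. a * u x + b * v x) = (\<lambda>x. a * (poisson ^^ k) u x + b * (poisson ^^ k) v x)"
proof (induction k)
  case (Suc k)
  then show ?case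
    using poisson_linear[of "(poisson ^^ k) u" _ "(poisson ^^ k) v",
        OF summable_on_imp_bounded[OF summable_poisson_funpow[OF assms(1)]]
           summable_on_imp_bounded[OF summable_poisson_funpow[OF assms(2)]]]
    by simp
qed simp

text \<open>The pointwise domination of \<open>f\<close> by a power of \<open>g\<close> propagates to all levels by Jensen's inequality, so
the pair of extensions stays in the region of the Bellman function.\<close>

lemma energy_bound_dominated:
  fixes f g :: "int ^ 'd::finite \<Rightarrow> real"
  assumes a: "0 \<le> a" "a < 1" and f: "f summable_on UNIV" "\<And>x. 0 \<le> f x"
    and g: "g summable_on UNIV" "\<And>x. 0 \<le> g x" and fg: "\<And>x. f x \<le> g x powr (1 - a)"
    and M: "M = 56 * real CARD('d) / (1 - a)\<^sup>2"
  shows "energy f g k i l summable_on UNIV"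
    and "(\<Sum>k<N. real (k + 1) * (\<Sum>\<^sub>\<infinity>x. energy f g k i l x))
      \<le> 8 * real CARD('d) * (1 + M) * power_sum (2 - a) g"
proof -
  define K where "K = (\<Sum>\<^sub>\<infinity>x. g x)"
  have gk: "((poisson ^^ k) g has_sum K) UNIV" for k
    unfolding K_def by (rule has_sum_poisson_funpow[OF g(1)])
  have g0: "0 \<le> (poisson ^^ k) g x" for k x by (rule poisson_funpow_nonneg[OF g])
  have gK: "(poisson ^^ k) g x \<le> K" for k x
    using finite_sum_le_has_sum[OF gk, of "{x}"] g0 by simp
  have f0: "0 \<le> (poisson ^^ k) f x" for k x by (rule poisson_funpow_nonneg[OF f])
  have dom: "(poisson ^^ k) f x \<le> (poisson ^^ k) g x powr (1 - a)" for k x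
  proof (induction k arbitrary: x)
    case (Suc k)
    have "poisson ((poisson ^^ k) f) x \<le> poisson (\<lambda>x. (poisson ^^ k) g x powr (1 - a)) x"
    proof (rule poisson_mono[OF _ _ Suc])
      show "\<bar>(poisson ^^ k) f x\<bar> \<le> (\<Sum>\<^sub>\<infinity>x. \<bar>(poisson ^^ k) f x\<bar>)" for x
        by (rule summable_on_imp_bounded[OF summable_poisson_funpow[OF f(1)]])
      show "\<bar>(poisson ^^ k) g x powr (1 - a)\<bar> \<le> K powr (1 - a)" for x
        using g0 gK a by (auto intro: powr_mono2)
    qed
    also have "\<dots> \<le> poisson ((poisson ^^ k) g) x powr (1 - a)"
      by (rule poisson_powr_le[OF g0 gK]) (use a in auto)
    finally show ?case by simp
  qed (use fg in simp)
  note E = harmonic_energy[OF a harmonic_poisson_funpow[OF f(1)] harmonic_poisson_funpow[OF g(1)]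
      f0 dom g0 gK gk M]
  show "energy f g k i l summable_on UNIV"
    unfolding energy_def[abs_def] by (rule E(1))
  show "(\<Sum>k<N. real (k + 1) * (\<Sum>\<^sub>\<infinity>x. energy f g k i l x))
      \<le> 8 * real CARD('d) * (1 + M) * power_sum (2 - a) g"
    using E(2)[where N = N and i = i and l = l] by (simp add: energy_def)
qed

definition nonneg_fin :: "('a \<Rightarrow> real) \<Rightarrow> bool" where
  "nonneg_fin f \<longleftrightarrow> (\<forall>x. 0 \<le> f x) \<and> finite {x. f x \<noteq> 0}"

lemma nonneg_fin_summable: "nonneg_fin f \<Longrightarrow> f summable_on UNIV"
  by (rule finite_nonzero_values_imp_summable_on) (simp add: nonneg_fin_def)

lemma nonneg_fin_powr: "nonneg_fin f \<Longrightarrow> nonneg_fin (\<lambda>x. f x powr s)"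
  unfolding nonneg_fin_def by (auto elim: rev_finite_subset)

lemma nonneg_fin_add: "nonneg_fin f \<Longrightarrow> nonneg_fin g \<Longrightarrow> nonneg_fin (\<lambda>x. f x + g x)"
  unfolding nonneg_fin_def
  by (auto intro: finite_subset[of _ "{x. f x \<noteq> 0} \<union> {x. g x \<noteq> 0}"])

lemma powr_add_le_4:
  fixes x y s :: real assumes "0 \<le> x" "0 \<le> y" "0 \<le> s" "s \<le> 2"
  shows "(x + y) powr s \<le> 4 * (x powr s + y powr s)"
proof -
  have "(x + y) powr s \<le> (2 * max x y) powr s" using assms by (intro powr_mono2) auto
  also have "\<dots> = 2 powr s * max x y powr s" using assms by (simp add: powr_mult)
  also have "\<dots> \<le> 2 powr 2 * (x powr s + y powr s)"
    using assms by (intro mult_mono powr_mono) (auto simp: max_def)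
  finally show ?thesis by simp
qed

definition energy_bounded :: "real \<Rightarrow> real \<Rightarrow> real \<Rightarrow> (int ^ 'd::finite \<Rightarrow> real) \<Rightarrow> (int ^ 'd \<Rightarrow> real) \<Rightarrow> bool" where
  "energy_bounded C r s f h \<longleftrightarrow> (\<forall>i l.
    (\<forall>k. energy f h k i l summable_on UNIV) \<and>
    (\<forall>N. (\<Sum>k<N. real (k + 1) * (\<Sum>\<^sub>\<infinity>x. energy f h k i l x))
      \<le> C * (power_sum r f + power_sum s h)))"

text \<open>With \<open>e = f\<^sup>r\<^sup>-\<^sup>1\<close> both \<open>(f, e)\<close> and \<open>(f, h + e)\<close> satisfy the domination hypothesis, and \<open>h\<close> is the difference
of the second components. As \<open>e\<close> raised to the conjugate exponent is \<open>f\<^sup>r\<close>, this costs only a constant.\<close>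

lemma energy_bound_ge_2:
  assumes r: "2 \<le> r"
  shows "\<exists>C\<ge>0. \<forall>f h :: int ^ 'd::finite \<Rightarrow> real. nonneg_fin f \<longrightarrow> nonneg_fin h \<longrightarrow> energy_bounded C r (r / (r - 1)) f h"
proof -
  define a where "a = (r - 2) / (r - 1)"
  have a: "0 \<le> a" "a < 1" using r by (auto simp: a_def)
  have a1: "1 - a = 1 / (r - 1)" and a2: "2 - a = r / (r - 1)" using r by (auto simp: a_def field_simps)
  define M where "M = 56 * real CARD('d) / (1 - a)\<^sup>2"
  define K where "K = 8 * real CARD('d) * (1 + M)"
  have K: "0 \<le> K" by (simp add: K_def M_def)
  show ?thesis
    unfolding energy_bounded_def
  proof (intro exI[of _ "5 * K"] conjI allI impI)
    show "0 \<le> 5 * K" using K by simp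
    fix f h :: "int ^ 'd \<Rightarrow> real" and i l assume f: "nonneg_fin f" and h: "nonneg_fin h"
    define e where "e = (\<lambda>x. f x powr (r - 1))"
    define g where "g = (\<lambda>x. h x + e x)"
    have e: "nonneg_fin e" unfolding e_def by (rule nonneg_fin_powr[OF f])
    have g: "nonneg_fin g" unfolding g_def by (rule nonneg_fin_add[OF h e])
    have f0: "0 \<le> f x" and h0: "0 \<le> h x" and e0: "0 \<le> e x" and g0: "0 \<le> g x" for x
      using f g h e by (auto simp: nonneg_fin_def)
    have fe: "f x \<le> e x powr (1 - a)" for x
      using f0[of x] r by (simp add: e_def a1 powr_powr)
    also have "e x powr (1 - a) \<le> g x powr (1 - a)" for x
      using h0 e0 a by (intro powr_mono2) (auto simp: g_def)
    finally have fg: "f x \<le> g x powr (1 - a)" for x .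
    note Ee = energy_bound_dominated[OF a nonneg_fin_summable[OF f] f0 nonneg_fin_summable[OF e] e0 fe M_def]
    note Eg = energy_bound_dominated[OF a nonneg_fin_summable[OF f] f0 nonneg_fin_summable[OF g] g0 fg M_def]
    have hge: "(poisson ^^ k) h x = (poisson ^^ k) g x - (poisson ^^ k) e x" for k x
      using poisson_funpow_linear[OF nonneg_fin_summable[OF h] nonneg_fin_summable[OF e], of k 1 1]
      by (simp add: g_def)
    have inc: "increment (\<lambda>k. (poisson ^^ k) h) k x l
        = increment (\<lambda>k. (poisson ^^ k) g) k x l - increment (\<lambda>k. (poisson ^^ k) e) k x l" for k x
      unfolding increment_def hge by (auto split: option.split)
    have le: "energy f h k i l x \<le> energy f g k i l x + energy f e k i l x" for k x
      unfolding energy_def inc distrib_left[symmetric] by (intro mult_left_mono) auto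
    have sum: "(\<lambda>x. energy f g k i l x + energy f e k i l x) summable_on UNIV" for k
      by (intro summable_on_add Eg Ee)
    show s: "energy f h k i l summable_on UNIV" for k
      by (rule summable_on_comparison_test[OF sum le]) (simp add: energy_def)
    have le': "(\<Sum>\<^sub>\<infinity>x. energy f h k i l x) \<le> (\<Sum>\<^sub>\<infinity>x. energy f g k i l x) + (\<Sum>\<^sub>\<infinity>x. energy f e k i l x)" for k
      using infsum_mono[OF s sum le, of k] infsum_add[OF Eg(1) Ee(1)] by simp
    fix N
    have "(\<Sum>k<N. real (k + 1) * (\<Sum>\<^sub>\<infinity>x. energy f h k i l x))
      \<le> (\<Sum>k<N. real (k + 1) * ((\<Sum>\<^sub>\<infinity>x. energy f g k i l x) + (\<Sum>\<^sub>\<infinity>x. energy f e k i l x)))"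
      by (intro sum_mono mult_left_mono le') auto
    also have "\<dots> \<le> K * power_sum (2 - a) g + K * power_sum (2 - a) e"
      unfolding distrib_left sum.distrib
      by (intro add_mono Eg(2)[folded K_def] Ee(2)[folded K_def])
    also have "power_sum (2 - a) e = power_sum r f"
      using r by (simp add: e_def a2 powr_powr)
    also have "power_sum (2 - a) g \<le> (\<Sum>\<^sub>\<infinity>x. 4 * h x powr (r / (r - 1)) + 4 * f x powr r)"
    proof (rule infsum_mono)
      show "(\<lambda>x. g x powr (2 - a)) summable_on UNIV"
        by (intro nonneg_fin_summable nonneg_fin_powr g)
      show "(\<lambda>x. 4 * h x powr (r / (r - 1)) + 4 * f x powr r) summable_on UNIV"
        by (intro summable_on_add summable_on_cmult_right nonneg_fin_summable nonneg_fin_powr f h)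
      show "g x powr (2 - a) \<le> 4 * h x powr (r / (r - 1)) + 4 * f x powr r" for x
        using powr_add_le_4[OF h0[of x] e0[of x], of "2 - a"] a r
        by (simp add: g_def) (simp add: e_def a2 powr_powr)
    qed
    also have "\<dots> = 4 * power_sum (r / (r - 1)) h + 4 * power_sum r f"
    proof -
      have "(\<lambda>x. 4 * h x powr (r / (r - 1))) summable_on UNIV" "(\<lambda>x. 4 * f x powr r) summable_on UNIV"
        by (intro summable_on_cmult_right nonneg_fin_summable nonneg_fin_powr f h)+
      then show ?thesis by (simp add: infsum_add infsum_cmult_right')
    qed
    finally have "(\<Sum>k<N. real (k + 1) * (\<Sum>\<^sub>\<infinity>x. energy f h k i l x))
      \<le> K * (4 * power_sum (r / (r - 1)) h + 4 * power_sum r f) + K * power_sum r f"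
      using K by (simp add: mult_left_mono)
    also have "\<dots> \<le> 5 * K * (power_sum r f + power_sum (r / (r - 1)) h)"
      using K infsum_nonneg[of UNIV "\<lambda>x. h x powr (r / (r - 1))"] by (simp add: algebra_simps)
    finally show "(\<Sum>k<N. real (k + 1) * (\<Sum>\<^sub>\<infinity>x. energy f h k i l x))
      \<le> 5 * K * (power_sum r f + power_sum (r / (r - 1)) h)" .
  qed
qed

lemma energy_commute: "energy f h k i l x = energy h f k l i x"
  by (simp add: energy_def mult.commute)

text \<open>Exchanging \<open>f\<close> and \<open>h\<close> exchanges the exponent and its conjugate.\<close>

lemma energy_bound:
  assumes p: "1 < p"
  shows "\<exists>C\<ge>0. \<forall>f h :: int ^ 'd::finite \<Rightarrow> real. nonneg_fin f \<longrightarrow> nonneg_fin h \<longrightarrow> energy_bounded C p (p / (p - 1)) f h"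
proof (cases "2 \<le> p")
  case True
  then show ?thesis by (rule energy_bound_ge_2)
next
  case False
  define r where "r = p / (p - 1)"
  have r: "2 \<le> r" using p False by (simp add: r_def field_simps)
  have rp: "r / (r - 1) = p" using p by (simp add: r_def field_simps)
  obtain C where "C \<ge> 0" and C: "\<And>f h :: int ^ 'd \<Rightarrow> real. nonneg_fin f \<Longrightarrow> nonneg_fin h \<Longrightarrow> energy_bounded C r p f h"
    using energy_bound_ge_2[OF r, where 'd = 'd] unfolding rp by blast
  show ?thesis
    unfolding r_def[symmetric] energy_bounded_def
  proof (intro exI[of _ C] conjI allI impI)
    fix f h :: "int ^ 'd \<Rightarrow> real" and i l assume fh: "nonneg_fin f" "nonneg_fin h"
    have comm: "energy f h k i l = energy h f k l i" for k by (simp add: fun_eq_iff energy_commute)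
    show "energy f h k i l summable_on UNIV" for k using C[OF fh(2,1)] unfolding energy_bounded_def by (simp add: comm)
    show "(\<Sum>k<N. real (k + 1) * (\<Sum>\<^sub>\<infinity>x. energy f h k i l x))
      \<le> C * (power_sum p f + power_sum r h)" for N
      using C[OF fh(2,1)] unfolding energy_bounded_def by (simp add: comm add.commute)
  qed (use \<open>C \<ge> 0\<close> in simp)
qed

section \<open>The Riesz form as a weighted sum of pairings\<close>

definition forward_diff :: "'d::finite \<Rightarrow> (int ^ 'd \<Rightarrow> real) \<Rightarrow> int ^ 'd \<Rightarrow> real" where
  "forward_diff j u x = u x - u (x + axis j 1)"

text \<open>Splitting \<open>i\<close> into two almost equal halves places both factors at the same level of the half space, so that
each is an increment, or a difference of two increments, based at level \<open>i div 2 + 1\<close>.\<close>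

definition pairing :: "'d::finite \<Rightarrow> (int ^ 'd \<Rightarrow> real) \<Rightarrow> (int ^ 'd \<Rightarrow> real) \<Rightarrow> nat \<Rightarrow> real" where
  "pairing j f h i = (\<Sum>\<^sub>\<infinity>x. forward_diff j ((poisson ^^ (i div 2)) f) x *
     ((poisson ^^ ((i + 1) div 2)) h x - (poisson ^^ ((i + 1) div 2 + 1)) h x))"

lemma sum_lessThan_double: "(\<Sum>i<2 * N. F i) = (\<Sum>k<N. F (2 * k) + F (2 * k + 1))" for F :: "nat \<Rightarrow> real"
  by (induction N) (simp_all add: algebra_simps)

text \<open>The weights \<open>2k + 1\<close> and \<open>2k + 2\<close> of the two pairings at level \<open>k\<close> are at most \<open>2 (k + 1)\<close>, the weight in the
energy.\<close>

lemma pairing_bound: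
  assumes p: "1 < p"
  shows "\<exists>C\<ge>0. \<forall>f h :: int ^ 'd::finite \<Rightarrow> real. nonneg_fin f \<longrightarrow> nonneg_fin h \<longrightarrow>
    (\<forall>N. \<bar>\<Sum>i<2 * N. real (i + 1) * pairing j f h i\<bar>
      \<le> C * (power_sum p f + power_sum (p / (p - 1)) h))"
proof -
  obtain C where "C \<ge> 0" and C: "\<And>f h :: int ^ 'd \<Rightarrow> real. nonneg_fin f \<Longrightarrow> nonneg_fin h \<Longrightarrow> energy_bounded C p (p / (p - 1)) f h"
    using energy_bound[OF p, where 'd = 'd] by blast
  show ?thesis
  proof (intro exI[of _ "8 * C"] conjI allI impI)
    fix f h :: "int ^ 'd \<Rightarrow> real" and N assume fh: "nonneg_fin f" "nonneg_fin h"
    define S where "S = power_sum p f + power_sum (p / (p - 1)) h"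
    have s: "energy f h k i l summable_on UNIV" for k i l using C[OF fh] unfolding energy_bounded_def by blast
    define G where "G = (\<lambda>k i l. \<Sum>\<^sub>\<infinity>x. energy f h k i l x)"
    have G0: "0 \<le> G k i l" for k i l unfolding G_def by (intro infsum_nonneg) (simp add: energy_def)
    have G: "(\<Sum>k<N. real (k + 1) * G k i l) \<le> C * S" for i l
      unfolding G_def S_def using C[OF fh] unfolding energy_bounded_def by blast
    let ?o = "Some None :: ('d \<times> bool) option option" and ?e = "Some (Some (j, True)) :: ('d \<times> bool) option option"
    have est: "\<bar>\<Sum>\<^sub>\<infinity>x. forward_diff j ((poisson ^^ k) f) x * w x\<bar> \<le> G k ?o l + G k ?e l"
      if w: "\<And>x. \<bar>w x\<bar> = \<bar>increment (\<lambda>k. (poisson ^^ k) h) k x l\<bar>" for k l w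
    proof -
      have le: "norm (forward_diff j ((poisson ^^ k) f) x * w x) \<le> energy f h k ?o l x + energy f h k ?e l x" for x
        unfolding energy_def distrib_right[symmetric] real_norm_def abs_mult w
        by (intro mult_right_mono) (auto simp: forward_diff_def increment_def)
      have sum: "(\<lambda>x. energy f h k ?o l x + energy f h k ?e l x) summable_on UNIV"
        by (intro summable_on_add s)
      have sn: "(\<lambda>x. norm (forward_diff j ((poisson ^^ k) f) x * w x)) summable_on UNIV"
        by (rule summable_on_comparison_test[OF sum le]) auto
      have "\<bar>\<Sum>\<^sub>\<infinity>x. forward_diff j ((poisson ^^ k) f) x * w x\<bar> \<le> (\<Sum>\<^sub>\<infinity>x. norm (forward_diff j ((poisson ^^ k) f) x * w x))"
        using norm_infsum_bound[OF sn] by simp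
      also have "\<dots> \<le> (\<Sum>\<^sub>\<infinity>x. energy f h k ?o l x + energy f h k ?e l x)"
        by (rule infsum_mono[OF sn sum le])
      also have "\<dots> = G k ?o l + G k ?e l" unfolding G_def by (rule infsum_add[OF s s])
      finally show ?thesis .
    qed
    \<comment> \<open>even indices use a vertical step down for the second factor, odd ones a step up\<close>
    have even: "\<bar>pairing j f h (2 * k)\<bar> \<le> G k ?o ?o + G k ?e ?o" for k
      unfolding pairing_def by simp (rule est, simp add: increment_def abs_minus_commute)
    have odd: "\<bar>pairing j f h (2 * k + 1)\<bar> \<le> G k ?o None + G k ?e None" for k
      unfolding pairing_def by simp (rule est, simp add: increment_def abs_minus_commute)
    have "\<bar>\<Sum>i<2 * N. real (i + 1) * pairing j f h i\<bar> \<le> (\<Sum>i<2 * N. real (i + 1) * \<bar>pairing j f h i\<bar>)"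
      by (rule order_trans[OF sum_abs]) (simp add: abs_mult)
    also have "\<dots> = (\<Sum>k<N. real (2 * k + 1) * \<bar>pairing j f h (2 * k)\<bar> + real (2 * k + 2) * \<bar>pairing j f h (2 * k + 1)\<bar>)"
      by (subst sum_lessThan_double) simp
    also have "\<dots> \<le> (\<Sum>k<N. (2 * real (k + 1)) * (G k ?o ?o + G k ?e ?o) + (2 * real (k + 1)) * (G k ?o None + G k ?e None))"
      by (intro sum_mono add_mono mult_mono even odd) (auto intro: add_nonneg_nonneg G0)
    also have "\<dots> = 2 * ((\<Sum>k<N. real (k + 1) * G k ?o ?o) + (\<Sum>k<N. real (k + 1) * G k ?e ?o)
        + (\<Sum>k<N. real (k + 1) * G k ?o None) + (\<Sum>k<N. real (k + 1) * G k ?e None))"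
      by (simp only: sum.distrib[symmetric] sum_distrib_left) (simp add: algebra_simps)
    also have "\<dots> \<le> 8 * C * S"
      using G[of ?o ?o] G[of ?e ?o] G[of ?o None] G[of ?e None] by simp
    finally show "\<bar>\<Sum>i<2 * N. real (i + 1) * pairing j f h i\<bar>
      \<le> 8 * C * (power_sum p f + power_sum (p / (p - 1)) h)" by (simp add: S_def)
  qed (use \<open>C \<ge> 0\<close> in simp)
qed


lemma forward_diff_fourier:
  assumes u: "u summable_on UNIV"
  shows "forward_diff j u summable_on UNIV"
    "hat (forward_diff j u) \<xi> = (1 - cnj (character (axis j 1) \<xi>)) * hat u \<xi>"
proof -
  have e: "forward_diff j u = (\<lambda>x. 1 * u x + (- 1) * u (x + axis j 1))"
    by (simp add: fun_eq_iff forward_diff_def)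
  show "forward_diff j u summable_on UNIV"
    unfolding e by (intro summable_on_add summable_on_cmult_right summable_shift u)
  have "hat (\<lambda>x. u (x + axis j 1)) \<xi> = cnj (character (axis j 1) \<xi>) * hat u \<xi>"
    by (subst hat_def) (rule infsumI[OF has_sum_hat_shift[OF u]])
  then show "hat (forward_diff j u) \<xi> = (1 - cnj (character (axis j 1) \<xi>)) * hat u \<xi>"
    unfolding e by (subst hat_linear) (simp_all add: u summable_shift algebra_simps)
qed

lemma poisson_diff_fourier:
  assumes u: "u summable_on UNIV"
  shows "(\<lambda>x. (poisson ^^ k) u x - (poisson ^^ (k + 1)) u x) summable_on UNIV"
    "hat (\<lambda>x. (poisson ^^ k) u x - (poisson ^^ (k + 1)) u x) \<xi>
      = of_real ((1 - poisson_symbol (walk_symbol \<xi>)) * poisson_symbol (walk_symbol \<xi>) ^ k) * hat u \<xi>"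
proof -
  have e: "(\<lambda>x. (poisson ^^ k) u x - (poisson ^^ (k + 1)) u x)
      = (\<lambda>x. 1 * (poisson ^^ k) u x + (- 1) * (poisson ^^ (k + 1)) u x)"
    by (simp add: fun_eq_iff)
  show "(\<lambda>x. (poisson ^^ k) u x - (poisson ^^ (k + 1)) u x) summable_on UNIV"
    unfolding e by (intro summable_on_add summable_on_cmult_right summable_poisson_funpow u)
  show "hat (\<lambda>x. (poisson ^^ k) u x - (poisson ^^ (k + 1)) u x) \<xi>
      = of_real ((1 - poisson_symbol (walk_symbol \<xi>)) * poisson_symbol (walk_symbol \<xi>) ^ k) * hat u \<xi>"
    unfolding e by (subst hat_linear; (intro summable_poisson_funpow u)?)
      (simp add: hat_poisson_funpow u algebra_simps del: funpow.simps)
qed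

section \<open>The Riesz multiplier as a limit of damped multipliers\<close>

text \<open>The defect \<open>1 - (n+1) q\<^sup>n + n q\<^sup>n\<^sup>+\<^sup>1\<close> is \<open>(1 - q)\<^sup>2\<close> times the partial sum of the series \<open>\<Sum> (i+1) q\<^sup>i = 1/(1 - q)\<^sup>2\<close>.\<close>

definition damping :: "nat \<Rightarrow> real \<Rightarrow> real" where
  "damping n q = 1 - real (n + 1) * q ^ n + real n * q ^ (n + 1)"

lemma damping_eq: "(1 - q)\<^sup>2 * (\<Sum>i<n. real (i + 1) * q ^ i) = damping n q"
proof (induction n)
  case (Suc n)
  have "(1 - q)\<^sup>2 * (\<Sum>i<Suc n. real (i + 1) * q ^ i) = damping n q + (1 - q)\<^sup>2 * (real (n + 1) * q ^ n)"
    using Suc by (simp add: distrib_left)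
  then show ?case by (simp add: damping_def power2_eq_square algebra_simps)
qed (simp add: damping_def)

lemma damping_bounds:
  assumes "0 \<le> q" "q \<le> 1" shows "0 \<le> damping n q" "damping n q \<le> 1"
proof -
  show "0 \<le> damping n q"
    unfolding damping_eq[symmetric] using assms by (intro mult_nonneg_nonneg sum_nonneg) auto
  have "real n * (q ^ n * q) \<le> real n * (q ^ n * 1)"
    using assms by (intro mult_left_mono) auto
  moreover have "0 \<le> q ^ n" using assms by simp
  ultimately show "damping n q \<le> 1" by (simp add: damping_def algebra_simps)
qed

lemma damping_tendsto:
  assumes "0 \<le> q" "q < 1" shows "(\<lambda>n. damping (2 * n) q) \<longlonglongrightarrow> 1"
proof -
  have "(\<lambda>n. damping n q) \<longlonglongrightarrow> 1 - (0 + 0) + 0 * q"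
  proof -
    have "(\<lambda>n. real n * q ^ n) \<longlonglongrightarrow> 0" "(\<lambda>n. q ^ n) \<longlonglongrightarrow> 0"
      using assms by (auto intro: powser_times_n_limit_0 LIMSEQ_realpow_zero)
    then have "(\<lambda>n. 1 - (real n * q ^ n + q ^ n) + (real n * q ^ n) * q) \<longlonglongrightarrow> 1 - (0 + 0) + 0 * q"
      by (intro tendsto_add tendsto_diff tendsto_mult tendsto_const)
    then show ?thesis by (simp add: damping_def algebra_simps)
  qed
  then have "(\<lambda>n. damping n q) \<longlonglongrightarrow> 1" by simp
  from LIMSEQ_subseq_LIMSEQ[OF this, of "\<lambda>n. 2 * n"] show ?thesis
    by (simp add: comp_def strict_mono_def)
qed

lemma one_minus_cnj_character:
  "1 - cnj (character (axis j 1) \<xi>) = 2 * \<i> * exp (- \<i> * of_real pi * of_real (\<xi> $ j)) * of_real (sin (pi * \<xi> $ j))"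
proof -
  define t where "t = pi * \<xi> $ j"
  have "exp (- \<i> * of_real pi * of_real (\<xi> $ j)) = cis (- t)"
    by (simp add: cis_conv_exp t_def mult.assoc)
  moreover have "cnj (character (axis j 1) \<xi>) = cis (- (2 * t))"
    by (simp add: character_axis cis_cnj t_def mult.assoc)
  moreover have "1 - cis (- (2 * t)) = 2 * \<i> * cis (- t) * of_real (sin t)"
    using sin_squared_eq[of t]
    by (simp add: complex_eq_iff cos_double sin_double power2_eq_square)
  ultimately show ?thesis by (simp add: t_def)
qed

abbreviation extension_symbol :: "real ^ 'd::finite \<Rightarrow> real" where
  "extension_symbol \<xi> \<equiv> poisson_symbol (walk_symbol \<xi>)"

lemma one_minus_extension_symbol:
  "1 - extension_symbol \<xi> = sqrt (\<Sum>k\<in>UNIV. (sin (pi * \<xi> $ k))\<^sup>2) / sqrt (real CARD('d))"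
  for \<xi> :: "real ^ 'd::finite"
  using one_minus_poisson_symbol[OF walk_symbol_bounds, of \<xi>]
  by (simp add: walk_symbol_def real_sqrt_divide)

lemma extension_symbol_bounds: "0 \<le> extension_symbol \<xi>" "extension_symbol \<xi> \<le> 1"
  by (intro poisson_symbol_nonneg poisson_symbol_le_1 walk_symbol_bounds)+

text \<open>The factor \<open>1 - q\<close> is the square root in the denominator of the multiplier up to the factor \<open>\<surd>d\<close>, so the
multiplier is \<open>D / (4 \<i> \<surd>d (1 - q))\<close> with \<open>D\<close> the symbol of the difference. Where the square root
vanishes both sides are 0, by the convention \<open>x / 0 = 0\<close>.\<close>

lemma riesz_multiplier_damped:
  fixes \<xi> :: "real ^ 'd::finite"
  shows "riesz_multiplier j \<xi> * of_real (damping n (extension_symbol \<xi>))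
     = of_real ((1 - extension_symbol \<xi>) * (\<Sum>i<n. real (i + 1) * extension_symbol \<xi> ^ i))
       * (1 - cnj (character (axis j 1) \<xi>)) / (4 * \<i> * of_real (sqrt (real CARD('d))))"
proof -
  define s where "s = sqrt (\<Sum>k\<in>UNIV. (sin (pi * \<xi> $ k))\<^sup>2)"
  define r where "r = sqrt (real CARD('d))"
  define T where "T = (\<Sum>i<n. real (i + 1) * extension_symbol \<xi> ^ i)"
  define E where "E = exp (- \<i> * of_real pi * of_real (\<xi> $ j)) * of_real (sin (pi * \<xi> $ j))"
  have r: "r > 0" by (simp add: r_def)
  have q: "1 - extension_symbol \<xi> = s / r" by (simp add: one_minus_extension_symbol s_def r_def)
  have "of_real (s / r) * of_real T * (2 * \<i> * E) / (4 * \<i> * of_real r)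
      = E / of_real (2 * s) * (of_real ((s / r)\<^sup>2) * of_real T)"
    using r by (cases "s = 0") (simp_all add: power2_eq_square field_simps)
  then show ?thesis
    unfolding riesz_multiplier_def damping_eq[symmetric] one_minus_cnj_character q
      s_def[symmetric] r_def[symmetric] T_def[symmetric] E_def[symmetric]
    by (simp add: E_def mult.assoc)
qed

lemma norm_riesz_multiplier_le: "norm (riesz_multiplier j \<xi>) \<le> 1"
proof -
  define s where "s = sqrt (\<Sum>k\<in>UNIV. (sin (pi * \<xi> $ k))\<^sup>2)"
  have s0: "0 \<le> s" by (simp add: s_def sum_nonneg)
  have "\<bar>sin (pi * \<xi> $ j)\<bar> = sqrt ((sin (pi * \<xi> $ j))\<^sup>2)" by simp
  also have "\<dots> \<le> s" unfolding s_def
    by (intro real_sqrt_le_mono member_le_sum) auto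
  finally have "\<bar>sin (pi * \<xi> $ j)\<bar> \<le> 2 * s" using s0 by simp
  moreover have "norm (riesz_multiplier j \<xi>) = \<bar>sin (pi * \<xi> $ j)\<bar> / (2 * s)"
    unfolding riesz_multiplier_def s_def[symmetric] using s0
    by (simp add: norm_mult norm_divide norm_exp_eq_Re)
  ultimately show ?thesis using s0 by (cases "s = 0") (simp_all add: divide_le_eq)
qed

lemma measurable_riesz_multiplier [measurable]: "riesz_multiplier j \<in> borel_measurable torus"
proof (rule borel_measurable_torusI)
  have [measurable]: "(\<lambda>\<xi> :: real ^ 'a. \<xi> $ k) \<in> borel_measurable borel" for k
    by (intro borel_measurable_continuous_onI continuous_intros)
  show "riesz_multiplier j \<in> borel_measurable (borel :: (real ^ 'a) measure)"
    unfolding riesz_multiplier_def[abs_def] by measurable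
qed

lemma measurable_extension_symbol: "extension_symbol \<in> borel_measurable torus"
proof (rule borel_measurable_torusI)
  have "extension_symbol = (\<lambda>\<xi> :: real ^ 'a. 1 - sqrt (\<Sum>k\<in>UNIV. (sin (pi * \<xi> $ k))\<^sup>2) / sqrt (real CARD('a)))"
    unfolding one_minus_extension_symbol[symmetric] by simp
  also have "\<dots> \<in> borel_measurable borel"
    by (intro borel_measurable_continuous_onI continuous_intros) auto
  finally show "extension_symbol \<in> borel_measurable (borel :: (real ^ 'a) measure)" .
qed

definition damped_multiplier :: "'d::finite \<Rightarrow> nat \<Rightarrow> real ^ 'd \<Rightarrow> complex" where
  "damped_multiplier j n \<xi> = riesz_multiplier j \<xi> * of_real (damping (2 * n) (extension_symbol \<xi>))"

lemma measurable_damped_multiplier [measurable]: "damped_multiplier j n \<in> borel_measurable torus"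
proof -
  note [measurable] = measurable_extension_symbol
  show ?thesis unfolding damped_multiplier_def[abs_def] damping_def by measurable
qed

lemma norm_damped_multiplier_le: "norm (damped_multiplier j n \<xi>) \<le> 1"
proof -
  have "norm (riesz_multiplier j \<xi>) * \<bar>damping (2 * n) (extension_symbol \<xi>)\<bar> \<le> 1 * 1"
    using damping_bounds[OF extension_symbol_bounds, of "2 * n" \<xi>]
    by (intro mult_mono norm_riesz_multiplier_le) auto
  then show ?thesis by (simp add: damped_multiplier_def norm_mult)
qed

lemma damped_multiplier_tendsto: "(\<lambda>n. damped_multiplier j n \<xi>) \<longlonglongrightarrow> riesz_multiplier j \<xi>"
proof (cases "extension_symbol \<xi> < 1")
  case True
  have "(\<lambda>n. damped_multiplier j n \<xi>) \<longlonglongrightarrow> riesz_multiplier j \<xi> * of_real 1"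
    unfolding damped_multiplier_def
    by (intro tendsto_intros damping_tendsto True extension_symbol_bounds)
  then show ?thesis by simp
next
  case False
  then have "1 - extension_symbol \<xi> = 0" using extension_symbol_bounds(2)[of \<xi>] by simp
  then have "(\<Sum>k\<in>UNIV. (sin (pi * \<xi> $ k))\<^sup>2) = 0"
    unfolding one_minus_extension_symbol by simp
  then show ?thesis by (simp add: damped_multiplier_def riesz_multiplier_def)
qed

text \<open>Parseval. The symbol of the Poisson operator is real, so its powers can be moved from one factor to the
other.\<close>

lemma pairing_fourier:
  fixes f h :: "int ^ 'd::finite \<Rightarrow> real"
  assumes f: "f summable_on UNIV" and h: "h summable_on UNIV"
  shows "of_real (pairing j f h i) = (\<integral>\<xi>. of_real ((1 - extension_symbol \<xi>) * extension_symbol \<xi> ^ i)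
      * (1 - cnj (character (axis j 1) \<xi>)) * hat f \<xi> * cnj (hat h \<xi>) \<partial>torus)"
proof -
  define k where "k = i div 2"
  define l where "l = (i + 1) div 2"
  have kl: "i = k + l" by (simp add: k_def l_def)
  let ?u = "forward_diff j ((poisson ^^ k) f)" and ?w = "\<lambda>x. (poisson ^^ l) h x - (poisson ^^ (l + 1)) h x"
  have "of_real (pairing j f h i) = (\<Sum>\<^sub>\<infinity>x. of_real (?u x * ?w x) :: complex)"
    unfolding pairing_def k_def[symmetric] l_def[symmetric] by (simp only: infsum_complex_of_real)
  also have "\<dots> = (\<integral>\<xi>. hat ?u \<xi> * cnj (hat ?w \<xi>) \<partial>torus)"
    by (rule infsumI[OF parseval_l1]) (intro forward_diff_fourier poisson_diff_fourier summable_poisson_funpow f h)+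
  also have "\<dots> = (\<integral>\<xi>. of_real ((1 - extension_symbol \<xi>) * extension_symbol \<xi> ^ i)
      * (1 - cnj (character (axis j 1) \<xi>)) * hat f \<xi> * cnj (hat h \<xi>) \<partial>torus)"
    unfolding poisson_diff_fourier(2)[OF h] forward_diff_fourier(2)[OF summable_poisson_funpow[OF f]]
      hat_poisson_funpow[OF f]
    by (simp add: kl power_add mult_ac)
  finally show ?thesis .
qed


lemma damped_pairing:
  fixes f h :: "int ^ 'd::finite \<Rightarrow> real"
  assumes f: "f summable_on UNIV" and h: "h summable_on UNIV"
  shows "(\<integral>\<xi>. damped_multiplier j n \<xi> * hat f \<xi> * cnj (hat h \<xi>) \<partial>torus)
     = of_real (\<Sum>i<2 * n. real (i + 1) * pairing j f h i) / (4 * \<i> * of_real (sqrt (real CARD('d))))"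
proof -
  note [measurable] = measurable_extension_symbol measurable_hat[OF f] measurable_hat[OF h]
  define c where "c = 4 * \<i> * of_real (sqrt (real CARD('d)))"
  define X where "X = (\<lambda>i \<xi>. of_real ((1 - extension_symbol \<xi>) * extension_symbol \<xi> ^ i)
      * (1 - cnj (character (axis j 1) \<xi>)) * hat f \<xi> * cnj (hat h \<xi>))"
  have X: "integrable torus (X i)" for i
  proof (rule integrable_torus_bounded)
    show "X i \<in> borel_measurable torus" unfolding X_def by measurable
    fix \<xi> :: "real ^ 'd"
    have 1: "norm (complex_of_real ((1 - extension_symbol \<xi>) * extension_symbol \<xi> ^ i)) \<le> 1"
      unfolding norm_of_real using extension_symbol_bounds[of \<xi>] by (simp add: abs_mult power_le_one mult_le_one)
    have 2: "norm (1 - cnj (character (axis j 1) \<xi>)) \<le> 2"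
      by (rule order_trans[OF norm_triangle_ineq4]) simp
    show "norm (X i \<xi>) \<le> 1 * 2 * (\<Sum>\<^sub>\<infinity>n. \<bar>f n\<bar>) * (\<Sum>\<^sub>\<infinity>n. \<bar>h n\<bar>)"
      unfolding X_def norm_mult complex_mod_cnj
      by (intro mult_mono 1[unfolded norm_mult] 2 norm_hat_le f h mult_nonneg_nonneg norm_ge_zero infsum_nonneg)
        (auto intro!: mult_nonneg_nonneg infsum_nonneg)
  qed
  have "damped_multiplier j n \<xi> * hat f \<xi> * cnj (hat h \<xi>) = (\<Sum>i<2 * n. of_real (real (i + 1)) * X i \<xi>) / c" for \<xi>
    unfolding damped_multiplier_def riesz_multiplier_damped c_def[symmetric] X_def
    by (simp add: sum_distrib_left sum_distrib_right sum_divide_distrib mult_ac)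
  then have "(\<integral>\<xi>. damped_multiplier j n \<xi> * hat f \<xi> * cnj (hat h \<xi>) \<partial>torus)
      = (\<integral>\<xi>. (\<Sum>i<2 * n. of_real (real (i + 1)) * X i \<xi>) \<partial>torus) / c"
    by simp
  also have "(\<integral>\<xi>. (\<Sum>i<2 * n. of_real (real (i + 1)) * X i \<xi>) \<partial>torus)
      = (\<Sum>i<2 * n. \<integral>\<xi>. of_real (real (i + 1)) * X i \<xi> \<partial>torus)"
    by (intro Bochner_Integration.integral_sum integrable_mult_right X)
  also have "\<dots> = (\<Sum>i<2 * n. of_real (real (i + 1)) * of_real (pairing j f h i))"
    unfolding integral_mult_right_zero pairing_fourier[OF f h] X_def ..
  finally show ?thesis by (simp add: c_def)
qed

abbreviation riesz_form :: "'d::finite \<Rightarrow> (real ^ 'd \<Rightarrow> complex) \<Rightarrow> (real ^ 'd \<Rightarrow> complex) \<Rightarrow> complex" where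
  "riesz_form j F G \<equiv> (\<integral>\<xi>. riesz_multiplier j \<xi> * F \<xi> * cnj (G \<xi>) \<partial>torus)"

lemma riesz_form_bound:
  assumes p: "1 < p"
  shows "\<exists>C\<ge>0. \<forall>f h :: int ^ 'd::finite \<Rightarrow> real. nonneg_fin f \<longrightarrow> nonneg_fin h \<longrightarrow>
    norm (riesz_form j (hat f) (hat h))
      \<le> C * (power_sum p f + power_sum (p / (p - 1)) h)"
proof -
  obtain C where "C \<ge> 0" and C: "\<And>f h N. nonneg_fin f \<Longrightarrow> nonneg_fin (h :: int ^ 'd \<Rightarrow> real) \<Longrightarrow>
      \<bar>\<Sum>i<2 * N. real (i + 1) * pairing j f h i\<bar>
      \<le> C * (power_sum p f + power_sum (p / (p - 1)) h)"
    using pairing_bound[OF p, of j] by blast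
  show ?thesis
  proof (intro exI[of _ C] conjI allI impI \<open>C \<ge> 0\<close>)
    fix f h :: "int ^ 'd \<Rightarrow> real" assume fh: "nonneg_fin f" "nonneg_fin h"
    note f = nonneg_fin_summable[OF fh(1)] and h = nonneg_fin_summable[OF fh(2)]
    note [measurable] = measurable_hat[OF f] measurable_hat[OF h]
    define S where "S = C * (power_sum p f + power_sum (p / (p - 1)) h)"
    define r where "r = sqrt (real CARD('d))"
    have r: "r \<ge> 1" unfolding r_def by (simp add: Suc_leI)
    define W where "W = 1 * (\<Sum>\<^sub>\<infinity>n. \<bar>f n\<bar>) * (\<Sum>\<^sub>\<infinity>n. \<bar>h n\<bar>)"
    define D where "D = (\<lambda>n. \<integral>\<xi>. damped_multiplier j n \<xi> * hat f \<xi> * cnj (hat h \<xi>) \<partial>torus)"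
    have "D
      \<longlonglongrightarrow> riesz_form j (hat f) (hat h)"
      unfolding D_def
    proof (rule integral_dominated_convergence[where w = "\<lambda>_. W"])
      show "integrable (torus :: (real ^ 'd) measure) (\<lambda>_. W)" by (rule integrable_torus_bounded[of _ "\<bar>W\<bar>"]) auto
      show "AE \<xi> in torus. (\<lambda>n. damped_multiplier j n \<xi> * hat f \<xi> * cnj (hat h \<xi>))
          \<longlonglongrightarrow> riesz_multiplier j \<xi> * hat f \<xi> * cnj (hat h \<xi>)"
        by (intro always_eventually allI tendsto_mult tendsto_const damped_multiplier_tendsto)
      show "AE \<xi> in torus. norm (damped_multiplier j n \<xi> * hat f \<xi> * cnj (hat h \<xi>)) \<le> W" for n
        unfolding W_def norm_mult complex_mod_cnj
        by (intro always_eventually allI mult_mono norm_damped_multiplier_le norm_hat_le f h)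
          (auto intro!: mult_nonneg_nonneg infsum_nonneg)
    qed measurable
    then have "(\<lambda>n. norm (D n))
      \<longlonglongrightarrow> norm (riesz_form j (hat f) (hat h))"
      by (rule tendsto_norm)
    moreover have "norm (D n) \<le> S" for n
    proof -
      define T where "T = (\<Sum>i<2 * n. real (i + 1) * pairing j f h i)"
      have "norm (D n) = \<bar>T\<bar> / (4 * r)"
        unfolding D_def damped_pairing[OF f h] T_def[symmetric] r_def[symmetric] using r
        by (simp add: norm_divide norm_mult)
      also have "\<dots> \<le> \<bar>T\<bar> / 1" using r by (intro divide_left_mono) auto
      also have "\<dots> \<le> S" using C[OF fh, of n] by (simp add: T_def S_def)
      finally show ?thesis .
    qed
    ultimately show "norm (riesz_form j (hat f) (hat h)) \<le> C * (power_sum p f + power_sum (p / (p - 1)) h)"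
      unfolding S_def[symmetric] by (intro tendsto_upperbound[where F = sequentially]) auto
  qed
qed

lemma trig_closure_sum:
  fixes F :: "'i \<Rightarrow> real ^ 'd::finite \<Rightarrow> complex"
  assumes "finite I" "\<And>i. i \<in> I \<Longrightarrow> F i \<in> trig_closure"
  shows "(\<lambda>\<xi>. \<Sum>i\<in>I. F i \<xi>) \<in> trig_closure"
  using assms
proof (induction I)
  case empty
  have "fourier_partial (\<lambda>_. 0) {} = (\<lambda>_ :: real ^ 'd. 0)" by (simp add: fun_eq_iff fourier_partial_eq)
  then have "(\<lambda>_ :: real ^ 'd. 0) \<in> trig_closure" by (metis fourier_partial_in_trig_closure)
  then show ?case by simp
next
  case (insert i I)
  then show ?case by (simp add: trig_closure_add)
qed

text \<open>The damped multiplier is a finite combination of symbols of operators on summable functions.\<close>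

lemma damped_hat_in_trig_closure:
  fixes f :: "int ^ 'd::finite \<Rightarrow> real"
  assumes f: "f summable_on UNIV"
  shows "(\<lambda>\<xi>. damped_multiplier j n \<xi> * hat f \<xi>) \<in> trig_closure"
proof -
  define c where "c = 4 * \<i> * of_real (sqrt (real CARD('d)))"
  define u where "u = (\<lambda>i. forward_diff j (\<lambda>x. (poisson ^^ i) f x - (poisson ^^ (i + 1)) f x))"
  have us: "u i summable_on UNIV" for i
    unfolding u_def by (intro forward_diff_fourier poisson_diff_fourier f)
  have uh: "hat (u i) \<xi> = (1 - cnj (character (axis j 1) \<xi>)) *
      (of_real ((1 - extension_symbol \<xi>) * extension_symbol \<xi> ^ i) * hat f \<xi>)" for i \<xi>
    unfolding u_def forward_diff_fourier(2)[OF poisson_diff_fourier(1)[OF f]] poisson_diff_fourier(2)[OF f] ..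
  have "(\<lambda>\<xi>. \<Sum>i<2 * n. of_real (real (i + 1)) / c * hat (u i) \<xi>) \<in> trig_closure"
    by (intro trig_closure_sum trig_closure_scale hat_in_trig_closure us) simp
  moreover have "(\<Sum>i<2 * n. of_real (real (i + 1)) / c * hat (u i) \<xi>) = damped_multiplier j n \<xi> * hat f \<xi>" for \<xi>
    unfolding damped_multiplier_def riesz_multiplier_damped c_def[symmetric] uh
    by (simp add: sum_distrib_left sum_distrib_right sum_divide_distrib mult_ac)
  ultimately show ?thesis by simp
qed

lemma riesz_hat_in_trig_closure:
  fixes f :: "int ^ 'd::finite \<Rightarrow> real"
  assumes f: "f summable_on UNIV"
  shows "(\<lambda>\<xi>. riesz_multiplier j \<xi> * hat f \<xi>) \<in> trig_closure"
proof (rule trig_closure_limit[OF _ damped_hat_in_trig_closure[OF f] sequentially_bot])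
  note [measurable] = measurable_hat[OF f]
  show "(\<lambda>\<xi>. riesz_multiplier j \<xi> * hat f \<xi>) \<in> torus_L2"
    by (rule torus_L2_mult_bounded[OF torus_L2_hat[OF f] _ norm_riesz_multiplier_le]) measurable
  define W where "W = (2 * (\<Sum>\<^sub>\<infinity>n. \<bar>f n\<bar>))\<^sup>2"
  have "(\<lambda>n. L2_dist (\<lambda>\<xi>. riesz_multiplier j \<xi> * hat f \<xi>) (\<lambda>\<xi>. damped_multiplier j n \<xi> * hat f \<xi>))
      \<longlonglongrightarrow> (\<integral>\<xi>. (norm (riesz_multiplier j \<xi> * hat f \<xi> - riesz_multiplier j \<xi> * hat f \<xi>))\<^sup>2 \<partial>torus)"
    unfolding L2_dist_def
  proof (rule integral_dominated_convergence[where w = "\<lambda>_. W"])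
    show "integrable (torus :: (real ^ 'd) measure) (\<lambda>_. W)" by (rule integrable_torus_bounded[of _ "\<bar>W\<bar>"]) auto
    show "AE \<xi> in torus. (\<lambda>n. (norm (riesz_multiplier j \<xi> * hat f \<xi> - damped_multiplier j n \<xi> * hat f \<xi>))\<^sup>2)
        \<longlonglongrightarrow> (norm (riesz_multiplier j \<xi> * hat f \<xi> - riesz_multiplier j \<xi> * hat f \<xi>))\<^sup>2"
      by (intro always_eventually allI tendsto_intros damped_multiplier_tendsto)
    have "norm (riesz_multiplier j \<xi> * hat f \<xi> - damped_multiplier j n \<xi> * hat f \<xi>) \<le> 2 * (\<Sum>\<^sub>\<infinity>n. \<bar>f n\<bar>)" for \<xi> n
    proof -
      have "norm (riesz_multiplier j \<xi> - damped_multiplier j n \<xi>) \<le> 2"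
        using norm_triangle_ineq4[of "riesz_multiplier j \<xi>" "damped_multiplier j n \<xi>"]
          norm_riesz_multiplier_le[of j \<xi>] norm_damped_multiplier_le[of j n \<xi>] by linarith
      then show ?thesis
        unfolding left_diff_distrib[symmetric] norm_mult by (intro mult_mono norm_hat_le f) auto
    qed
    then have "(norm (riesz_multiplier j \<xi> * hat f \<xi> - damped_multiplier j n \<xi> * hat f \<xi>))\<^sup>2 \<le> W" for \<xi> n
      unfolding W_def by (intro power_mono) auto
    then show "AE \<xi> in torus. norm ((norm (riesz_multiplier j \<xi> * hat f \<xi> - damped_multiplier j n \<xi> * hat f \<xi>))\<^sup>2) \<le> W" for n
      by simp
  qed measurable
  then show "(\<lambda>n. L2_dist (\<lambda>\<xi>. riesz_multiplier j \<xi> * hat f \<xi>) (\<lambda>\<xi>. damped_multiplier j n \<xi> * hat f \<xi>)) \<longlonglongrightarrow> 0"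
    by simp
qed

section \<open>Complex functions and the discrete Riesz transform\<close>

text \<open>The coefficients of \<open>z\<close> along \<open>1, \<i>, -1, -\<i>\<close>, which reduce complex functions to four nonnegative ones.\<close>

definition quadrant_part :: "nat \<Rightarrow> complex \<Rightarrow> real" where
  "quadrant_part s z = max 0 (Re (z * (- \<i>) ^ s))"

lemma quadrant_part_bounds: "0 \<le> quadrant_part s z" "quadrant_part s z \<le> norm z"
proof -
  have "Re (z * (- \<i>) ^ s) \<le> norm (z * (- \<i>) ^ s)" by (rule complex_Re_le_cmod)
  also have "\<dots> = norm z" by (simp add: norm_mult norm_power)
  finally show "quadrant_part s z \<le> norm z" by (simp add: quadrant_part_def)
qed (simp add: quadrant_part_def)

lemma quadrant_decomposition: "z = (\<Sum>s<4. \<i> ^ s * of_real (quadrant_part s z))"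
  by (simp add: quadrant_part_def eval_nat_numeral complex_eq_iff max_def)

lemma fourier_partial_quadrants:
  assumes "finite A"
  shows "fourier_partial c A \<xi> = (\<Sum>s<4. \<i> ^ s * hat (\<lambda>n. if n \<in> A then quadrant_part s (c n) else 0) \<xi>)"
proof -
  have "hat (\<lambda>n. if n \<in> A then quadrant_part s (c n) else 0) \<xi> = (\<Sum>n\<in>A. of_real (quadrant_part s (c n)) * character n \<xi>)" for s
    unfolding hat_def using assms by (intro infsumI has_sum_finite_neutralI[of A]) auto
  then have "(\<Sum>s<4. \<i> ^ s * hat (\<lambda>n. if n \<in> A then quadrant_part s (c n) else 0) \<xi>)
      = (\<Sum>s<4. \<Sum>n\<in>A. \<i> ^ s * of_real (quadrant_part s (c n)) * character n \<xi>)"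
    by (simp add: sum_distrib_left mult.assoc)
  also have "\<dots> = (\<Sum>n\<in>A. (\<Sum>s<4. \<i> ^ s * of_real (quadrant_part s (c n))) * character n \<xi>)"
    by (subst sum.swap) (simp add: sum_distrib_right)
  finally show ?thesis by (simp only: quadrant_decomposition[symmetric] fourier_partial_eq)
qed

lemma nonneg_fin_quadrant: "finite A \<Longrightarrow> nonneg_fin (\<lambda>n. if n \<in> A then quadrant_part s (c n) else 0)"
  unfolding nonneg_fin_def by (auto simp: quadrant_part_bounds intro: finite_subset[of _ A])

lemma riesz_partial_in_trig_closure: "(\<lambda>\<xi>. riesz_multiplier j \<xi> * fourier_partial c A \<xi>) \<in> trig_closure"
proof (cases "finite A")
  case True
  have "(\<lambda>\<xi>. \<Sum>s<4. \<i> ^ s * (riesz_multiplier j \<xi> * hat (\<lambda>n. if n \<in> A then quadrant_part s (c n) else 0) \<xi>)) \<in> trig_closure"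
    by (intro trig_closure_sum trig_closure_scale riesz_hat_in_trig_closure nonneg_fin_summable
        nonneg_fin_quadrant True) simp
  then show ?thesis unfolding fourier_partial_quadrants[OF True] by (simp add: sum_distrib_left mult.left_commute)
next
  case False
  then have "(\<lambda>\<xi>. riesz_multiplier j \<xi> * fourier_partial c A \<xi>) = fourier_partial c A"
    by (simp add: fourier_partial_eq fun_eq_iff)
  then show ?thesis by (simp add: fourier_partial_in_trig_closure)
qed

lemma riesz_form_bound_complex:
  assumes p: "1 < p"
  shows "\<exists>C\<ge>0. \<forall>c d :: int ^ 'd::finite \<Rightarrow> complex. \<forall>A B. finite A \<longrightarrow> finite B \<longrightarrow>
    norm (riesz_form j (fourier_partial c A) (fourier_partial d B))
      \<le> C * ((\<Sum>n\<in>A. norm (c n) powr p) + (\<Sum>n\<in>B. norm (d n) powr (p / (p - 1))))"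
proof -
  define p' where "p' = p / (p - 1)"
  have p': "p' > 0" using p by (simp add: p'_def)
  obtain C where "C \<ge> 0" and C: "\<And>f h :: int ^ 'd \<Rightarrow> real. nonneg_fin f \<Longrightarrow> nonneg_fin h \<Longrightarrow>
    norm (riesz_form j (hat f) (hat h))
      \<le> C * (power_sum p f + (power_sum p' h))"
    using riesz_form_bound[OF p, of j] unfolding p'_def by blast
  show ?thesis
    unfolding p'_def[symmetric]
  proof (intro exI[of _ "16 * C"] conjI allI impI)
    fix c d :: "int ^ 'd \<Rightarrow> complex" and A B :: "(int ^ 'd) set" assume A: "finite A" and B: "finite B"
    define f where "f = (\<lambda>s n. if n \<in> A then quadrant_part s (c n) else 0)"
    define h where "h = (\<lambda>s n. if n \<in> B then quadrant_part s (d n) else 0)"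
    have fh: "nonneg_fin (f s)" "nonneg_fin (h s)" for s
      unfolding f_def h_def by (intro nonneg_fin_quadrant A B)+
    note sum = nonneg_fin_summable[OF fh(1)] nonneg_fin_summable[OF fh(2)]
    define I where "I = (\<lambda>s t. \<integral>\<xi>. riesz_multiplier j \<xi> * hat (f s) \<xi> * cnj (hat (h t) \<xi>) \<partial>torus)"
    define S where "S = (\<Sum>n\<in>A. norm (c n) powr p) + (\<Sum>n\<in>B. norm (d n) powr p')"
    have int: "integrable torus (\<lambda>\<xi>. riesz_multiplier j \<xi> * hat (f s) \<xi> * cnj (hat (h t) \<xi>))" for s t
    proof (rule integrable_torus_bounded)
      show "(\<lambda>\<xi>. riesz_multiplier j \<xi> * hat (f s) \<xi> * cnj (hat (h t) \<xi>)) \<in> borel_measurable torus"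
        using measurable_hat[OF sum(1)[of s]] measurable_hat[OF sum(2)[of t]] by measurable
      show "norm (riesz_multiplier j \<xi> * hat (f s) \<xi> * cnj (hat (h t) \<xi>))
          \<le> 1 * (\<Sum>\<^sub>\<infinity>n. \<bar>f s n\<bar>) * (\<Sum>\<^sub>\<infinity>n. \<bar>h t n\<bar>)" for \<xi>
        unfolding norm_mult complex_mod_cnj
        by (intro mult_mono norm_riesz_multiplier_le norm_hat_le sum)
          (auto intro!: mult_nonneg_nonneg infsum_nonneg)
    qed
    have fin: "(\<Sum>\<^sub>\<infinity>n. (if n \<in> A then x n else 0) powr r) = (\<Sum>n\<in>A. x n powr r)"
      if "finite A" for A :: "(int ^ 'd) set" and x r
      using that by (intro infsumI has_sum_finite_neutralI[of A]) auto
    have IS: "norm (I s t) \<le> C * S" for s t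
    proof -
      have "norm (I s t) \<le> C * ((\<Sum>n\<in>A. quadrant_part s (c n) powr p) + (\<Sum>n\<in>B. quadrant_part t (d n) powr p'))"
        using C[OF fh(1)[of s] fh(2)[of t]] by (simp add: I_def f_def h_def fin A B)
      also have "\<dots> \<le> C * S"
        unfolding S_def using p p' \<open>C \<ge> 0\<close>
        by (intro mult_left_mono add_mono sum_mono powr_mono2) (auto simp: quadrant_part_bounds)
      finally show ?thesis .
    qed
    have "riesz_form j (fourier_partial c A) (fourier_partial d B)
        = (\<integral>\<xi>. (\<Sum>s<4. \<Sum>t<4. \<i> ^ s * cnj (\<i> ^ t) * (riesz_multiplier j \<xi> * hat (f s) \<xi> * cnj (hat (h t) \<xi>))) \<partial>torus)"
    proof (intro Bochner_Integration.integral_cong refl)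
      fix \<xi> :: "real ^ 'd"
      have "fourier_partial c A \<xi> = (\<Sum>s<4. \<i> ^ s * hat (f s) \<xi>)"
        and "fourier_partial d B \<xi> = (\<Sum>t<4. \<i> ^ t * hat (h t) \<xi>)"
        unfolding f_def h_def by (rule fourier_partial_quadrants; fact)+
      then show "riesz_multiplier j \<xi> * fourier_partial c A \<xi> * cnj (fourier_partial d B \<xi>)
          = (\<Sum>s<4. \<Sum>t<4. \<i> ^ s * cnj (\<i> ^ t) * (riesz_multiplier j \<xi> * hat (f s) \<xi> * cnj (hat (h t) \<xi>)))"
        by (simp add: mult.assoc sum_product) (simp add: sum_distrib_left mult_ac)
    qed
    also have "\<dots> = (\<Sum>s<4. \<Sum>t<4. \<i> ^ s * cnj (\<i> ^ t) * I s t)"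
      unfolding I_def
      by (subst Bochner_Integration.integral_sum; (subst Bochner_Integration.integral_sum)?;
          (intro Bochner_Integration.integrable_sum integrable_mult_right int)?)
        (simp only: integral_mult_right_zero)
    finally have "norm (riesz_form j (fourier_partial c A) (fourier_partial d B))
        \<le> (\<Sum>s<4::nat. \<Sum>t<4::nat. norm (\<i> ^ s * cnj (\<i> ^ t) * I s t))"
      by (simp only:) (intro order_trans[OF norm_sum] sum_mono norm_sum)
    also have "\<dots> \<le> (\<Sum>s<4::nat. \<Sum>t<4::nat. C * S)"
      by (intro sum_mono) (simp add: norm_mult norm_power IS)
    finally show "norm (riesz_form j (fourier_partial c A) (fourier_partial d B))
        \<le> 16 * C * ((\<Sum>n\<in>A. norm (c n) powr p) + (\<Sum>n\<in>B. norm (d n) powr p'))"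
      by (simp add: S_def)
  qed (use \<open>C \<ge> 0\<close> in simp)
qed

text \<open>The product of the multiplier and the transform lies in the closure of the trigonometric polynomials, so
its coefficients solve the defining equation; they are the only solution because a square summable
function is recovered from its transform.\<close>

lemma discrete_riesz_eq:
  assumes f: "f \<in> lp_space 2"
  shows "discrete_riesz j f = fourier_coeff (\<lambda>\<xi>. riesz_multiplier j \<xi> * fourier_transform f \<xi>)"
proof -
  note s = fourier_transform_spec[OF f]
  define G where "G = (\<lambda>\<xi>. riesz_multiplier j \<xi> * fourier_transform f \<xi>)"
  have GL: "G \<in> torus_L2"
    unfolding G_def by (rule torus_L2_mult_bounded[OF s(1) measurable_riesz_multiplier norm_riesz_multiplier_le])
  have "((\<lambda>A. L2_dist G (\<lambda>\<xi>. riesz_multiplier j \<xi> * fourier_partial f A \<xi>)) \<longlongrightarrow> 0) (finite_sets)"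
  proof (rule tendsto_sandwich[OF _ _ tendsto_const s(2)])
    show "eventually (\<lambda>A. 0 \<le> L2_dist G (\<lambda>\<xi>. riesz_multiplier j \<xi> * fourier_partial f A \<xi>)) (finite_sets)"
      by (simp add: L2_dist_nonneg)
    show "eventually (\<lambda>A. L2_dist G (\<lambda>\<xi>. riesz_multiplier j \<xi> * fourier_partial f A \<xi>)
        \<le> L2_dist (fourier_transform f) (fourier_partial f A)) (finite_sets)"
      unfolding G_def
      using L2_dist_mult_le[OF s(1) torus_L2_fourier_partial measurable_riesz_multiplier norm_riesz_multiplier_le]
      by (intro always_eventually allI) simp
  qed
  then have G: "G \<in> trig_closure"
    by (rule trig_closure_limit[OF GL riesz_partial_in_trig_closure finite_subsets_at_top_neq_bot])
  show ?thesis
    unfolding discrete_riesz_def G_def[symmetric]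
  proof (rule the_equality)
    show "fourier_coeff G \<in> lp_space 2 \<and>
      (AE \<xi> in torus. fourier_transform (fourier_coeff G) \<xi> = riesz_multiplier j \<xi> * fourier_transform f \<xi>)"
      using fourier_coeff_in_l2[OF GL] fourier_transform_fourier_coeff[OF G] by (simp add: G_def)
  next
    fix g assume g: "g \<in> lp_space 2 \<and>
      (AE \<xi> in torus. fourier_transform g \<xi> = riesz_multiplier j \<xi> * fourier_transform f \<xi>)"
    then have g2: "g \<in> lp_space 2" and AE: "AE \<xi> in torus. fourier_transform g \<xi> = G \<xi>" by (auto simp: G_def)
    note [measurable] = torus_L2_D(1)[OF GL] torus_L2_D(1)[OF fourier_transform_spec(1)[OF g2]]
    have "fourier_coeff (fourier_transform g) n = fourier_coeff G n" for n
      unfolding fourier_coeff_def by (rule integral_cong_AE) (use AE in \<open>auto elim: eventually_mono\<close>)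
    then show "g = fourier_coeff G"
      unfolding fourier_coeff_fourier_transform[OF g2] by auto
  qed
qed

lemma integral_cnj_fourier_partial:
  assumes "G \<in> torus_L2"
  shows "(\<integral>\<xi>. G \<xi> * cnj (fourier_partial d B \<xi>) \<partial>torus) = (\<Sum>n\<in>B. fourier_coeff G n * cnj (d n))"
proof -
  have "(\<integral>\<xi>. G \<xi> * cnj (fourier_partial d B \<xi>) \<partial>torus) = (\<integral>\<xi>. (\<Sum>n\<in>B. cnj (d n) * (G \<xi> * cnj (character n \<xi>))) \<partial>torus)"
    by (simp add: fourier_partial_eq sum_distrib_left mult_ac)
  also have "\<dots> = (\<Sum>n\<in>B. \<integral>\<xi>. cnj (d n) * (G \<xi> * cnj (character n \<xi>)) \<partial>torus)"
    by (intro Bochner_Integration.integral_sum integrable_mult_right integrable_mult_cnj_character assms)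
  finally show ?thesis by (simp add: fourier_coeff_def mult.commute)
qed

text \<open>Truncations of \<open>f\<close> converge in \<open>L\<^sup>2\<close> on the Fourier side, while the bound depends only on their \<open>p\<close>-sums.\<close>

lemma discrete_riesz_form_bound:
  assumes p: "1 < p"
  shows "\<exists>C\<ge>1. \<forall>f :: int ^ 'd::finite \<Rightarrow> complex. \<forall>d B. f \<in> lp_space 2 \<longrightarrow> f \<in> lp_space p \<longrightarrow> finite B \<longrightarrow>
    norm (\<Sum>n\<in>B. discrete_riesz j f n * cnj (d n))
      \<le> C * ((\<Sum>\<^sub>\<infinity>n. norm (f n) powr p) + (\<Sum>n\<in>B. norm (d n) powr (p / (p - 1))))"
proof -
  obtain C where "C \<ge> 0" and C: "\<And>c d A B. finite A \<Longrightarrow> finite (B :: (int ^ 'd) set) \<Longrightarrow>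
    norm (riesz_form j (fourier_partial c A) (fourier_partial d B))
      \<le> C * ((\<Sum>n\<in>A. norm (c n) powr p) + (\<Sum>n\<in>B. norm (d n) powr (p / (p - 1))))"
    using riesz_form_bound_complex[OF p, of j] by blast
  show ?thesis
  proof (intro exI[of _ "max C 1"] conjI allI impI)
    fix f d :: "int ^ 'd \<Rightarrow> complex" and B :: "(int ^ 'd) set"
    assume f: "f \<in> lp_space 2" "f \<in> lp_space p" and B: "finite B"
    note s = fourier_transform_spec[OF f(1)]
    define S where "S = (\<Sum>\<^sub>\<infinity>n. norm (f n) powr p) + (\<Sum>n\<in>B. norm (d n) powr (p / (p - 1)))"
    define m where "m = (\<lambda>\<xi>. riesz_multiplier j \<xi> * cnj (fourier_partial d B \<xi>))"
    have m: "m \<in> borel_measurable torus" unfolding m_def by measurable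
    have mb: "norm (m \<xi>) \<le> 1 * (\<Sum>n\<in>B. norm (d n))" for \<xi>
      unfolding m_def norm_mult complex_mod_cnj
      by (intro mult_mono norm_riesz_multiplier_le norm_fourier_partial_le) auto
    have GL: "(\<lambda>\<xi>. riesz_multiplier j \<xi> * fourier_transform f \<xi>) \<in> torus_L2"
      by (rule torus_L2_mult_bounded[OF s(1) measurable_riesz_multiplier norm_riesz_multiplier_le])
    have "(\<Sum>n\<in>B. discrete_riesz j f n * cnj (d n)) = (\<integral>\<xi>. fourier_transform f \<xi> * m \<xi> \<partial>torus)"
      unfolding discrete_riesz_eq[OF f(1)] integral_cnj_fourier_partial[OF GL, symmetric] m_def by (simp add: mult_ac)
    moreover have "((\<lambda>A. \<integral>\<xi>. fourier_partial f A \<xi> * m \<xi> \<partial>torus) \<longlongrightarrow> (\<integral>\<xi>. fourier_transform f \<xi> * m \<xi> \<partial>torus)) (finite_sets)"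
      by (rule integral_mult_tendsto[OF s(1) torus_L2_fourier_partial s(2) m mb])
    ultimately have "((\<lambda>A. norm (\<integral>\<xi>. fourier_partial f A \<xi> * m \<xi> \<partial>torus)) \<longlongrightarrow> norm (\<Sum>n\<in>B. discrete_riesz j f n * cnj (d n))) (finite_sets)"
      by (intro tendsto_norm) simp
    moreover have "norm (\<integral>\<xi>. fourier_partial f A \<xi> * m \<xi> \<partial>torus) \<le> C * S" if "finite A" for A
    proof -
      have "(\<integral>\<xi>. fourier_partial f A \<xi> * m \<xi> \<partial>torus)
          = riesz_form j (fourier_partial f A) (fourier_partial d B)"
        by (simp add: m_def mult_ac)
      also have "norm \<dots> \<le> C * ((\<Sum>n\<in>A. norm (f n) powr p) + (\<Sum>n\<in>B. norm (d n) powr (p / (p - 1))))"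
        by (rule C[OF that B])
      also have "\<dots> \<le> C * S"
        unfolding S_def using \<open>C \<ge> 0\<close> f(2) that
        by (intro mult_left_mono add_right_mono finite_sum_le_infsum) (auto simp: lp_space_def)
      finally show ?thesis .
    qed
    ultimately have "norm (\<Sum>n\<in>B. discrete_riesz j f n * cnj (d n)) \<le> C * S"
      by (intro tendsto_upperbound[where F = "finite_sets"])
        (auto intro: eventually_finite_subsets_at_top_weakI)
    also have "\<dots> \<le> max C 1 * S"
      unfolding S_def by (intro mult_right_mono add_nonneg_nonneg infsum_nonneg sum_nonneg) auto
    finally show "norm (\<Sum>n\<in>B. discrete_riesz j f n * cnj (d n))
      \<le> max C 1 * ((\<Sum>\<^sub>\<infinity>n. norm (f n) powr p) + (\<Sum>n\<in>B. norm (d n) powr (p / (p - 1))))"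
      unfolding S_def .
  qed simp
qed

theorem mainTheorem3:
  fixes j :: "'d::finite" and p :: real
  assumes "1 < p"
  shows "bounded_on_lp p (discrete_riesz j)"
proof -
  define p' where "p' = p / (p - 1)"
  obtain C where "C \<ge> 1" and C: "\<And>(f :: int ^ 'd \<Rightarrow> complex) d B. f \<in> lp_space 2 \<Longrightarrow> f \<in> lp_space p \<Longrightarrow> finite B \<Longrightarrow>
    norm (\<Sum>n\<in>B. discrete_riesz j f n * cnj (d n))
      \<le> C * ((\<Sum>\<^sub>\<infinity>n. norm (f n) powr p) + (\<Sum>n\<in>B. norm (d n) powr p'))"
    using discrete_riesz_form_bound[OF assms, of j] unfolding p'_def by blast
  \<comment> \<open>chosen so that the term with \<open>t\<close> on the right is half of the one on the left\<close>
  define t where "t = (2 * C) powr (1 - p)"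
  define K where "K = 2 * C / t"
  have t: "t > 0" using \<open>C \<ge> 1\<close> by (simp add: t_def)
  have K: "K > 0" using t \<open>C \<ge> 1\<close> by (simp add: K_def)
  have tp: "C * t powr p' = t / 2"
  proof -
    have "t powr p' = (2 * C) powr (- p)"
    proof -
      have "(1 - p) * p' = - p" using assms by (simp add: p'_def divide_eq_eq algebra_simps)
      then show ?thesis by (simp add: t_def powr_powr)
    qed
    moreover have "t = (2 * C) * (2 * C) powr (- p)"
      using \<open>C \<ge> 1\<close> by (simp add: t_def powr_diff powr_minus_divide)
    ultimately show ?thesis by simp
  qed
  show ?thesis
    unfolding bounded_on_lp_def
  proof (intro exI[of _ "K powr (1 / p)"] ballI)
    fix f :: "int ^ 'd \<Rightarrow> complex" assume "f \<in> lp_space 2 \<inter> lp_space p"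
    then have f: "f \<in> lp_space 2" "f \<in> lp_space p" by auto
    define g where "g = discrete_riesz j f"
    define S where "S = (\<Sum>\<^sub>\<infinity>n. norm (f n) powr p)"
    have S0: "0 \<le> S" unfolding S_def by (intro infsum_nonneg) simp
    have bound: "(\<Sum>n\<in>B. norm (g n) powr p) \<le> K * S" if B: "finite B" for B :: "(int ^ 'd) set"
    proof -
      define X where "X = (\<Sum>n\<in>B. norm (g n) powr p)"
      \<comment> \<open>the extremal function for the duality of \<open>\<ell>\<^sup>p\<close>, scaled by \<open>t\<close>\<close>
      define d where "d = (\<lambda>n. of_real (t * norm (g n) powr (p - 1)) * sgn (g n))"
      have gd: "g n * cnj (d n) = of_real (t * norm (g n) powr p)" for n
      proof (cases "g n = 0")
        case False
        have "g n * cnj (sgn (g n)) = of_real (norm (g n))"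
        proof -
          have "g n * cnj (sgn (g n)) = of_real (inverse (norm (g n))) * (g n * cnj (g n))"
            by (simp add: sgn_div_norm scaleR_conv_of_real mult_ac)
          also have "g n * cnj (g n) = of_real ((norm (g n))\<^sup>2)"
            by (rule complex_norm_square[symmetric])
          finally show ?thesis using False by (simp add: power2_eq_square)
        qed
        then have "g n * cnj (d n) = of_real (t * (norm (g n) powr (p - 1) * norm (g n)))"
          by (simp add: d_def mult_ac)
        also have "norm (g n) powr (p - 1) * norm (g n) = norm (g n) powr p"
          using False by (simp add: powr_diff)
        finally show ?thesis .
      qed simp
      have dp: "norm (d n) powr p' = t powr p' * norm (g n) powr p" for n
        using t assms by (cases "g n = 0") (simp_all add: d_def norm_mult norm_sgn powr_mult powr_powr p'_def)
      have "(\<Sum>n\<in>B. g n * cnj (d n)) = of_real (t * X)"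
        by (simp add: gd X_def sum_distrib_left)
      moreover have "0 \<le> t * X" using t by (simp add: X_def sum_nonneg)
      ultimately have "norm (\<Sum>n\<in>B. g n * cnj (d n)) = t * X"
        by (simp only: norm_of_real abs_of_nonneg)
      then have "t * X \<le> C * (S + t powr p' * X)"
        using C[OF f B, of d] unfolding g_def[symmetric] dp X_def S_def sum_distrib_left[symmetric] by simp
      also have "\<dots> = C * S + t / 2 * X"
        unfolding tp[symmetric] by (simp add: algebra_simps)
      finally have "X \<le> K * S" using t by (simp add: K_def field_simps)
      then show ?thesis by (simp add: X_def)
    qed
    have sum: "(\<lambda>n. norm (g n) powr p) summable_on UNIV"
      by (rule nonneg_bounded_partial_sums_imp_summable_on[where C = "K * S"])
        (auto intro!: eventually_finite_subsets_at_top_weakI bound)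
    have "(\<Sum>\<^sub>\<infinity>n. norm (g n) powr p) \<le> K * S"
      by (rule infsum_le_finite_sums[OF sum]) (auto intro: bound)
    then have "(\<Sum>\<^sub>\<infinity>n. norm (g n) powr p) powr (1 / p) \<le> (K * S) powr (1 / p)"
      using assms by (intro powr_mono2 infsum_nonneg) auto
    also have "\<dots> = K powr (1 / p) * S powr (1 / p)" using K S0 by (simp add: powr_mult)
    finally show "discrete_riesz j f \<in> lp_space p \<and> lp_norm p (discrete_riesz j f) \<le> K powr (1 / p) * lp_norm p f"
      using sum by (simp add: lp_space_def lp_norm_def g_def S_def)
  qed
qed

end
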